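(* Let $P_n, P, Q_n, Q$ ($n \ge 1$) be Borel probability measures on $\mathbb{R}^d$ such that $P_n \to P$ and $Q_n \to Q$ weakly as $n \to \infty$. Let $\pi_n \in \Pi(P_n, Q_n)$ and $\pi \in \Pi(P, Q)$ be such that there exist maximal cyclically monotone sets $T_n, T \in \mathcal{F}(\mathbb{R}^d \times \mathbb{R}^d)$ with $\operatorname{spt} \pi_n \subset T_n$ and $\operatorname{spt} \pi \subset T$. Assume that $\pi$ is the only element of $\Pi(P,Q)$ with cyclically monotone support. Write $V = \operatorname{int}(\operatorname{spt} P)$ and assume $V \neq \emptyset$. (a) We have $\pi_n \to \pi$ weakly, $V \subset \operatorname{dom} T$, and $T_n|_V \to T|_V$ in $\mathcal{F}(V \times \mathbb{R}^d)$ as $n \to \infty$. In particular, for any compact $K \subset V \times \mathbb{R}^d$ such that $T \cap K = \emptyset$ we have $T_n \cap K = \emptyset$ for all large $n$, and for any open $G \subset V \times \mathbb{R}^d$ such that $T \cap G \neq \emptyset$ we have $T_n \cap G \neq \emptyset$ for all large $n$. (b) For any compact $K \subset V$, we have $K \subset \operatorname{int}(\operatorname{dom} T_n)$, and thus $T_n(K)$ is compact, for all large $n$. If $T$ is single-valued on $\partial K$, then $d_H(T_n(K), T(K)) \to 0$ as $n \to \infty$. If $T$ is single-valued on the whole of $K$, then $$\sup_{x \in K} \sup_{y \in T_n(x)} |y - T(x)| \to 0, \qquad n \to \infty.$$ In particular, if $P(W) = 1$ for some Borel set $W \subset V$ on which $T$ is single-valued, then for $P$-almost every $x \in \mathbb{R}^d$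 the set $T_n(x)$ is non-empty for all large $n$ and $\sup_{y \in T_n(x)} |y - T(x)| \to 0$ as $n \to \infty$. (c) Assume that $\operatorname{rge} T$ is bounded, that there exists an open set $U \subset \operatorname{spt} P$ such that $T(U) \subset \operatorname{int}(\operatorname{rge} T)$ and $\operatorname{rge} T \subset \operatorname{cl}(T(U))$, and that $\operatorname{rge} T_n \subset \operatorname{cl}(\operatorname{rge} T)$ for all but finitely many $n$. Then $\operatorname{dom} T = \mathbb{R}^d$, $\operatorname{dom} T_n = \mathbb{R}^d$ for all but finitely many $n$, and $T_n \to T$ in $\mathcal{F}(\mathbb{R}^d \times \mathbb{R}^d)$ as $n \to \infty$. (d) If, in addition to the conditions in (c), $T$ is single-valued on the closure of a set $E \subset \mathbb{R}^d$ that recedes only in directions in which the (necessarily convex) set $\operatorname{cl}(\operatorname{rge} T)$ is strictly convex, then $$\sup_{x \in E} \sup_{y \in T_n(x)} |y - T(x)| \to 0, \qquad n \to \infty.$$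
   Context: For Borel probability measures $P,Q$ on $\mathbb{R}^d$, $\Pi(P,Q)$ is the set of Borel probability measures on $\mathbb{R}^d \times \mathbb{R}^d$ with first margin $P$ and second margin $Q$. The support $\operatorname{spt}\mu$ of a probability measure $\mu$ is the set of points all of whose open neighbourhoods have positive $\mu$-mass. For a locally compact Hausdorff second countable space $\mathbb{E}$, $\mathcal{F}(\mathbb{E})$ is the set of all closed subsets of $\mathbb{E}$ (including $\emptyset$), equipped with the Fell topology, i.e. the topology generated by the collections $\{F : F \cap G \ne \emptyset\}$ for open $G \subset \mathbb{E}$ and $\{F : F \cap K = \emptyset\}$ for compact $K \subset \mathbb{E}$. A set $T \subset \mathbb{R}^d \times \mathbb{R}^d$ is identified with the multivalued mapping $T(x) = \{y : (x,y) \in T\}$; $T(A) = \bigcup_{x \in A} T(x)$, $\operatorname{dom} T = \{x : T(x) \neq \emptyset\}$, $\operatorname{rge} T = T(\mathbb{R}^d)$. $T$ is single-valued at $x$ if $T(x)$ is a singleton, in which case $T(x)$ also denotes its unique element; it is single-valued on a set if it is so at each of its points. For non-empty $V \subset \mathbb{R}^d$, $T|_V = T \cap (V \times \mathbb{R}^d)$; if $V$ is open and $T$ closed, it is regarded as an element of $\mathcal{F}(V \times \mathbb{R}^d)$. $T$ is cyclically monotone if for every integer $m \ge 1$ and all $(x_1,y_1),\dots,(x_m,y_m) \in T$ we have $\sum_{i=1}^m \langle x_i, y_i\rangle \ge \sum_{i=1}^m \langle x_i, y_{i+1}\rangle$ with $y_{m+1} := y_1$; it is maximal cyclically monotone if it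 is cyclically monotone and not properly contained in another cyclically monotone subset of $\mathbb{R}^d\times\mathbb{R}^d$. $|\cdot|$ is the Euclidean norm. For $A,B \subset \mathbb{R}^d$, $d_H(A,B) = \max\{\sup_{a\in A} d(a,B), \sup_{b \in B} d(b,A)\}$, where $d(x,Y) = \inf_{y\in Y}|x-y|$ and $d(x,\emptyset)=\infty$; suprema are taken in $[0,\infty]$. A set $E \subset \mathbb{R}^d$ recedes in direction $u$ (with $|u|=1$) if there exist $x_n \in E$ with $|x_n| \to \infty$ and $x_n/|x_n| \to u$. A non-empty compact convex set $C \subset \mathbb{R}^d$ is strictly convex in direction $u$ if $\arg\max_{c \in C} \langle c, u\rangle$ is a singleton. *)

theory Defs
  imports "HOL-Probability.Probability"
begin

definition borel_prob_measure :: "'a::topological_space measure \<Rightarrow> bool" where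
  "borel_prob_measure M \<longleftrightarrow> prob_space M \<and> sets M = sets borel"

text \<open>Weak convergence against bounded continuous test functions; the library's
  \<open>weak_conv_m\<close> only covers measures on the real line.\<close>

definition weak_conv_to :: "(nat \<Rightarrow> 'a::topological_space measure) \<Rightarrow> 'a measure \<Rightarrow> bool" where
  "weak_conv_to M L \<longleftrightarrow>
    (\<forall>f::'a \<Rightarrow> real. continuous_on UNIV f \<and> bounded (range f) \<longrightarrow>
      (\<lambda>n. \<integral>x. f x \<partial>M n) \<longlonglongrightarrow> (\<integral>x. f x \<partial>L))"

definition couplings ::
  "'a::topological_space measure \<Rightarrow> 'b::topological_space measure \<Rightarrow> ('a \<times> 'b) measure set" where
  "couplings P Q = {\<rho>. borel_prob_measure \<rho> \<and> distr \<rho> borel fst = P \<and> distr \<rho> borel snd = Q}"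

definition spt :: "'a::topological_space measure \<Rightarrow> 'a set" where
  "spt M = {x. \<forall>G. open G \<and> x \<in> G \<longrightarrow> emeasure M G > 0}"

text \<open>The Fell topology on the closed subsets of a space \<open>X\<close>. Spaces are abstract topologies so
  that an open subset of a Euclidean space, with its own closed and compact sets, can take the
  role of \<open>X\<close>.\<close>

definition fell_topology :: "'a topology \<Rightarrow> 'a set topology" where
  "fell_topology X = topology_generated_by
     ({{F. closedin X F \<and> F \<inter> G \<noteq> {}} | G. openin X G} \<union>
      {{F. closedin X F \<and> F \<inter> K = {}} | K. compactin X K})"

lemma topspace_fell_topology: "topspace (fell_topology X) = {F. closedin X F}"
proof -
  have "\<Union>({{F. closedin X F \<and> F \<inter> G \<noteq> {}} | G. openin X G} \<union>
      {{F. closedin X F \<and> F \<inter> K = {}} | K. compactin X K}) = {F. closedin X F}" (is "\<Union>?S = ?C")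
  proof
    have "?C = {F. closedin X F \<and> F \<inter> {} = {}}" by simp
    then have "?C \<in> ?S" using compactin_empty by blast
    then show "?C \<subseteq> \<Union>?S" by (rule Union_upper)
  qed blast
  then show ?thesis
    by (simp only: fell_topology_def topology_generated_by_topspace)
qed

text \<open>A multivalued mapping is its graph, a relation: \<open>T(A)\<close> is \<open>T `` A\<close>, and the domain and
  range are \<open>Domain T\<close> and \<open>Range T\<close>. Unlike the library's \<open>single_valued\<close>, being single-valued
  at a point includes that the image is non-empty; the unique element of the image is then
  \<open>the_elem (T `` {x})\<close>.\<close>

definition single_valued_at :: "('a \<times> 'b) set \<Rightarrow> 'a \<Rightarrow> bool" where
  "single_valued_at T x \<longleftrightarrow> is_singleton (T `` {x})"

text \<open>Tuples of length \<open>m\<close> are indexed by \<open>0, \<dots>, m - 1\<close>, so the successor index is cyclic modulo \<open>m\<close>.\<close>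

definition cyclically_monotone :: "('a::real_inner \<times> 'a) set \<Rightarrow> bool" where
  "cyclically_monotone T \<longleftrightarrow>
    (\<forall>m\<ge>1. \<forall>x y :: nat \<Rightarrow> 'a. (\<forall>i<m. (x i, y i) \<in> T) \<longrightarrow>
      (\<Sum>i<m. x i \<bullet> y i) \<ge> (\<Sum>i<m. x i \<bullet> y (Suc i mod m)))"

definition maximal_cyclically_monotone :: "('a::real_inner \<times> 'a) set \<Rightarrow> bool" where
  "maximal_cyclically_monotone T \<longleftrightarrow>
    cyclically_monotone T \<and> \<not> (\<exists>S. cyclically_monotone S \<and> T \<subset> S)"

text \<open>Distances take values in \<open>ennreal\<close>, where the infimum over the empty set is \<open>\<infinity>\<close> and the
  supremum over the empty set is \<open>0\<close>; the library's \<open>infdist\<close> would give \<open>infdist x {} = 0\<close>.\<close>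

definition edist_set :: "'a::metric_space \<Rightarrow> 'a set \<Rightarrow> ennreal" where
  "edist_set x Y = (INF y\<in>Y. ennreal (dist x y))"

definition hausdorff_edist :: "'a::metric_space set \<Rightarrow> 'a set \<Rightarrow> ennreal" where
  "hausdorff_edist A B = max (SUP a\<in>A. edist_set a B) (SUP b\<in>B. edist_set b A)"

definition recedes_in_direction :: "'a::real_normed_vector set \<Rightarrow> 'a \<Rightarrow> bool" where
  "recedes_in_direction E u \<longleftrightarrow> norm u = 1 \<and>
    (\<exists>x :: nat \<Rightarrow> 'a. (\<forall>n. x n \<in> E) \<and> filterlim (\<lambda>n. norm (x n)) at_top sequentially \<and>
      (\<lambda>n. x n /\<^sub>R norm (x n)) \<longlonglongrightarrow> u)"

definition strictly_convex_in_direction :: "'a::real_inner set \<Rightarrow> 'a \<Rightarrow> bool" where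
  "strictly_convex_in_direction C u \<longleftrightarrow> is_singleton {c. is_arg_max (\<lambda>c. c \<bullet> u) (\<lambda>c. c \<in> C) c}"

end

theory Submission
  imports Defs
begin

text \<open>By Rockafellar's theorem a maximal cyclically monotone set is the subdifferential of a convex
  potential, hence convex-valued. The sets \<open>T\<^sub>n\<close> approximate every point of \<open>S = spt \<pi>\<close>, and \<open>S\<close>
  has dense projection in \<open>V\<close>. Monotonicity against points surrounding \<open>x \<in> V\<close> makes all \<open>T\<^sub>n\<close>
  uniformly bounded near \<open>x\<close>; and a pair over \<open>V\<close> that is monotonically related to \<open>S\<close> already lies
  in \<open>T\<close>, by separating it from the convex set \<open>T(x)\<close>. So a pair outside \<open>T\<close> has negative product with
  some point of \<open>S\<close>, which keeps \<open>T\<^sub>n\<close> away from it. Conversely the resolvent of \<open>T\<^sub>n\<close> produces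
  points on a small compact disc that meets \<open>T\<close> only in a prescribed point. Part (c) applies the same
  exclusion principle to the inverse mappings over the interior of the range. Weak convergence of
  the couplings is compactness together with uniqueness of the limit.\<close>

section \<open>Potentials of cyclically monotone sets\<close>

text \<open>Off \<open>V\<close> the support of \<pi> does not determine \<open>T\<close>: different
  maximal sets may contain it. Exclusion is therefore confined to pairs over \<open>V\<close>, or in
  part (c) to values in the closed range, where the inclusion of \<open>Range (Tn n)\<close> in
  \<open>closure (Range T)\<close> disposes of the remaining values. Failure of the two-point
  inequality \<open>0 \<le> (x - a) \<bullet> (y - b)\<close> is an open condition, hence survives
  small perturbations of both pairs; this is what transports exclusion from \<open>T\<close> to
  \<open>Tn n\<close>. Longer cycles matter only through the potential, which supplies convex
  images, subgradients at interior points and the resolvent, and in identifying the weak limit of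
  the couplings. An extended-valued convex function is represented by its effective domain
  \<open>D\<close> and a real function \<open>f\<close> on it; lower semicontinuity becomes
  closedness of \<open>epigraph D f\<close>.\<close>

definition subgradients :: "'a::real_inner set \<Rightarrow> ('a \<Rightarrow> real) \<Rightarrow> ('a \<times> 'a) set" where
  "subgradients D f = {(x, y). x \<in> D \<and> (\<forall>z\<in>D. f x + (z - x) \<bullet> y \<le> f z)}"

lemma subgradientsD:
  assumes "(x, y) \<in> subgradients D f"
  shows "x \<in> D" and "z \<in> D \<Longrightarrow> f x + (z - x) \<bullet> y \<le> f z"
  using assms by (auto simp: subgradients_def)

lemma sum_lessThan_Suc_mod:
  fixes h :: "nat \<Rightarrow> 'b::comm_monoid_add"
  shows "(\<Sum>i<m. h (Suc i mod m)) = (\<Sum>i<m. h i)"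
proof (cases m)
  case (Suc k)
  have "(\<Sum>i<m. h (Suc i mod m)) = (\<Sum>i<k. h (Suc i mod Suc k)) + h 0"
    by (simp add: Suc)
  also have "(\<Sum>i<k. h (Suc i mod Suc k)) = (\<Sum>i<k. h (Suc i))"
    by (intro sum.cong) auto
  finally show ?thesis
    unfolding Suc sum.lessThan_Suc_shift by (simp add: add.commute)
qed simp

text \<open>Adding around the cycle the subgradient inequalities at \<open>x (i+1)\<close>, tested
  at \<open>x i\<close>, cancels all values of \<open>f\<close>, because the cyclic shift permutes
  the indices.\<close>

lemma cyclically_monotone_subgradients:
  assumes "T \<subseteq> subgradients D f"
  shows "cyclically_monotone T"
  unfolding cyclically_monotone_def
proof (intro allI impI)
  fix m :: nat and x y :: "nat \<Rightarrow> 'a"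
  assume m: "1 \<le> m" and xy: "\<forall>i<m. (x i, y i) \<in> T"
  have *: "f (x (Suc i mod m)) + (x i - x (Suc i mod m)) \<bullet> y (Suc i mod m) \<le> f (x i)" if "i < m" for i
  proof -
    have "(x i, y i) \<in> subgradients D f" "(x (Suc i mod m), y (Suc i mod m)) \<in> subgradients D f"
      using m xy assms that by auto
    then show ?thesis using subgradientsD by metis
  qed
  have "(\<Sum>i<m. f (x (Suc i mod m)) + (x i - x (Suc i mod m)) \<bullet> y (Suc i mod m)) \<le> (\<Sum>i<m. f (x i))"
    by (intro sum_mono *) auto
  then show "(\<Sum>i<m. x i \<bullet> y (Suc i mod m)) \<le> (\<Sum>i<m. x i \<bullet> y i)"
    using sum_lessThan_Suc_mod[of "\<lambda>i. f (x i)" m] sum_lessThan_Suc_mod[of "\<lambda>i. x i \<bullet> y i" m]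
    by (simp add: sum.distrib inner_diff_left sum_subtractf)
qed

text \<open>The same cancellation with the inequality at \<open>x i\<close> tested at
  \<open>x (i+1)\<close>. The potential spares the reversal of the cycle that a direct passage to
  the inverse would require.\<close>

lemma cyclically_monotone_converse_subgradients:
  assumes "T \<subseteq> subgradients D f"
  shows "cyclically_monotone (T\<inverse>)"
  unfolding cyclically_monotone_def
proof (intro allI impI)
  fix m :: nat and y x :: "nat \<Rightarrow> 'a"
  assume m: "1 \<le> m" and xy: "\<forall>i<m. (y i, x i) \<in> T\<inverse>"
  have *: "f (x i) + (x (Suc i mod m) - x i) \<bullet> y i \<le> f (x (Suc i mod m))" if "i < m" for i
  proof -
    have "(x i, y i) \<in> subgradients D f" "(x (Suc i mod m), y (Suc i mod m)) \<in> subgradients D f"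
      using m xy assms that by auto
    then show ?thesis using subgradientsD by metis
  qed
  have "(\<Sum>i<m. f (x i) + (x (Suc i mod m) - x i) \<bullet> y i) \<le> (\<Sum>i<m. f (x (Suc i mod m)))"
    by (intro sum_mono *) auto
  then show "(\<Sum>i<m. y i \<bullet> x (Suc i mod m)) \<le> (\<Sum>i<m. y i \<bullet> x i)"
    using sum_lessThan_Suc_mod[of "\<lambda>i. f (x i)" m]
    by (simp add: sum.distrib inner_diff_left inner_diff_right sum_subtractf inner_commute)
qed

text \<open>The list runs backwards: its head is the pair visited last before reaching \<open>z\<close>.\<close>

primrec chain_value :: "'a::real_inner \<times> 'a \<Rightarrow> ('a \<times> 'a) list \<Rightarrow> 'a \<Rightarrow> real" where
  "chain_value p [] z = (z - fst p) \<bullet> snd p"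
| "chain_value p (q # qs) z = (z - fst q) \<bullet> snd q + chain_value p qs (fst q)"

lemma chain_value_diff:
  "chain_value p qs z = chain_value p qs w + (z - w) \<bullet> snd (hd (qs @ [p]))"
  by (cases qs) (auto simp: inner_diff_left)

text \<open>Translates the recursion into the index sums of cyclic monotonicity. The pairs are read
  along \<open>qs @ [p]\<close>, so the starting pair \<open>p\<close> has the last index.\<close>

lemma chain_value_eq_sum:
  "chain_value p qs z + (\<Sum>i<Suc (length qs). fst ((qs @ [p]) ! i) \<bullet> snd ((qs @ [p]) ! i)) =
    z \<bullet> snd ((qs @ [p]) ! 0) + (\<Sum>i<length qs. fst ((qs @ [p]) ! i) \<bullet> snd ((qs @ [p]) ! Suc i))"
proof (induction qs arbitrary: z)
  case (Cons q qs)
  show ?case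
    using Cons.IH[of "fst q"]
    by (simp only: length_Cons chain_value.simps sum.lessThan_Suc_shift append_Cons nth_Cons_0 nth_Cons_Suc)
       (simp add: inner_diff_left)
qed (simp add: inner_diff_left)

text \<open>A chain that returns to its start is a cycle, and its value is the shifted sum minus the
  diagonal sum. This keeps the supremum over all chains finite at \<open>fst p\<close>.\<close>

lemma chain_value_closed_nonpos:
  assumes T: "cyclically_monotone T" and "p \<in> T" "set qs \<subseteq> T"
  shows "chain_value p qs (fst p) \<le> 0"
proof -
  let ?l = "qs @ [p]" and ?m = "Suc (length qs)"
  have "(\<Sum>i<?m. fst (?l ! i) \<bullet> snd (?l ! (Suc i mod ?m))) \<le> (\<Sum>i<?m. fst (?l ! i) \<bullet> snd (?l ! i))"
  proof -
    have "(fst (?l ! i), snd (?l ! i)) \<in> T" if "i < ?m" for i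
      using assms nth_mem[of i ?l] that by (auto simp del: nth_mem)
    then show ?thesis
      using T[unfolded cyclically_monotone_def, rule_format, of ?m "\<lambda>i. fst (?l ! i)" "\<lambda>i. snd (?l ! i)"] by simp
  qed
  moreover have "(\<Sum>i<?m. fst (?l ! i) \<bullet> snd (?l ! (Suc i mod ?m))) =
      (\<Sum>i<length qs. fst (?l ! i) \<bullet> snd (?l ! Suc i)) + fst p \<bullet> snd (?l ! 0)"
    by (auto simp: sum.lessThan_Suc intro!: sum.cong)
  ultimately show ?thesis
    using chain_value_eq_sum[of p qs "fst p"] by linarith
qed

text \<open>Rockafellar's construction: the potential is the supremum of the chain values over all chains
  in \<open>T\<close> that start at a fixed point of \<open>T\<close>.\<close>

lemma cyclically_monotone_potential:
  fixes T :: "('a::euclidean_space \<times> 'a) set"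
  assumes T: "cyclically_monotone T" "T \<noteq> {}"
  obtains D f where "convex_on D f" "closed (epigraph D f)" "T \<subseteq> subgradients D f"
    "bounded (Range T) \<Longrightarrow> D = UNIV"
proof -
  obtain p where p: "p \<in> T" using T by blast
  define C where "C = {qs. set qs \<subseteq> T}"
  \<comment> \<open>\<open>D\<close> is the effective domain: outside it the real supremum in
    \<open>f\<close> carries no meaning.\<close>
  define D where "D = {x. bdd_above ((\<lambda>qs. chain_value p qs x) ` C)}"
  define f where "f x = (SUP qs\<in>C. chain_value p qs x)" for x
  have C: "[] \<in> C" "C \<noteq> {}" by (auto simp: C_def intro: exI[of _ "[]"])
  have upper: "chain_value p qs x \<le> f x" if "x \<in> D" "qs \<in> C" for x qs
    using that unfolding f_def D_def by (auto intro: cSUP_upper)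
  \<comment> \<open>As an intersection of closed half-spaces the epigraph is closed and convex at
    once.\<close>
  have epi: "epigraph D f = (\<Inter>qs\<in>C. {(x, t). chain_value p qs x \<le> t})"
  proof -
    have 1: "x \<in> D \<and> f x \<le> t" if *: "\<And>qs. qs \<in> C \<Longrightarrow> chain_value p qs x \<le> t" for x t
      using C * unfolding D_def f_def by (auto intro!: bdd_aboveI cSUP_least)
    have 2: "chain_value p qs x \<le> t" if "x \<in> D" "f x \<le> t" "qs \<in> C" for qs x t
      using upper[OF that(1,3)] that(2) by simp
    have "(x, t) \<in> epigraph D f \<longleftrightarrow> (\<forall>qs\<in>C. chain_value p qs x \<le> t)" for x t
      unfolding mem_epigraph using 2[of x t] by (intro iffI ballI 1) blast+
    then show ?thesis by auto
  qed
  have affine: "\<exists>a c. (\<lambda>x. chain_value p qs x) = (\<lambda>x. x \<bullet> a + c)" for qs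
    by (rule exI[of _ "snd (hd (qs @ [p]))"], rule exI[of _ "chain_value p qs 0"])
       (rule ext, subst chain_value_diff[of _ _ _ 0], simp)
  have half: "closed {(x, t). chain_value p qs x \<le> t} \<and> convex {(x, t). chain_value p qs x \<le> t}" for qs
  proof -
    obtain a c where "(\<lambda>x. chain_value p qs x) = (\<lambda>x. x \<bullet> a + c)" using affine by blast
    then have "{(x, t). chain_value p qs x \<le> t} = {z. (a, -1) \<bullet> z \<le> - c}"
      by (auto simp: fun_eq_iff inner_commute)
    then show ?thesis by (simp add: closed_halfspace_le convex_halfspace_le)
  qed
  have zero: "fst p \<in> D" "f (fst p) \<le> 0"
  proof -
    have "(fst p, 0) \<in> epigraph D f"
      unfolding epi using chain_value_closed_nonpos[OF T(1) p] by (auto simp: C_def)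
    then show "fst p \<in> D" "f (fst p) \<le> 0" by (auto simp: mem_epigraph)
  qed
  show thesis
  proof
    show "convex_on D f"
      unfolding convex_epigraph[symmetric] epi using half by (intro convex_INT) auto
    show "closed (epigraph D f)"
      unfolding epi using half by (intro closed_INT) auto
    show "T \<subseteq> subgradients D f"
    proof clarify
      fix x y assume xy: "(x, y) \<in> T"
      \<comment> \<open>The chain is prolonged by \<open>(x, y)\<close> as the pair visited last;
        its value at \<open>z\<close> cannot exceed \<open>f z\<close>.\<close>
      have step: "chain_value p qs x + (z - x) \<bullet> y \<le> f z" if "qs \<in> C" "z \<in> D" for qs z
        using upper[of z "(x, y) # qs"] that xy by (auto simp: C_def)
      \<comment> \<open>Testing the prolonged chains at \<open>fst p\<close>, where \<open>f\<close>
        is known to be finite, bounds all chain values at \<open>x\<close>.\<close>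
      have "x \<in> D" unfolding D_def
        using step[OF _ zero(1)] by (auto intro!: bdd_aboveI[of _ "f (fst p) - (fst p - x) \<bullet> y"] simp: algebra_simps)
      moreover have "f x + (z - x) \<bullet> y \<le> f z" if "z \<in> D" for z
      proof -
        have "f x \<le> f z - (z - x) \<bullet> y"
          unfolding f_def[of x] using C step[OF _ that] by (intro cSUP_least) (auto simp: algebra_simps)
        then show ?thesis by simp
      qed
      ultimately show "(x, y) \<in> subgradients D f" by (auto simp: subgradients_def)
    qed
    \<comment> \<open>The slopes of the chains lie in the range, so finiteness at
      \<open>fst p\<close> spreads to every point at a uniform linear rate.\<close>
    show "D = UNIV" if bd: "bounded (Range T)"
    proof -
      obtain M where M: "\<And>y. y \<in> Range T \<Longrightarrow> norm y \<le> M" using bd by (auto simp: bounded_iff)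
      have "chain_value p qs x \<le> f (fst p) + norm (x - fst p) * M" if "qs \<in> C" for qs x
      proof -
        have "hd (qs @ [p]) \<in> T" using that p by (cases qs) (auto simp: C_def)
        then have "norm (snd (hd (qs @ [p]))) \<le> M" using M by (metis Range.intros prod.collapse)
        then have "(x - fst p) \<bullet> snd (hd (qs @ [p])) \<le> norm (x - fst p) * M"
          by (meson mult_left_mono norm_cauchy_schwarz norm_ge_zero order_trans)
        then show ?thesis
          using chain_value_diff[of p qs x "fst p"] upper[OF zero(1) that] by linarith
      qed
      then show ?thesis unfolding D_def by (auto intro!: bdd_aboveI)
    qed
  qed
qed

lemma maximal_cyclically_monotone_nonempty:
  assumes "maximal_cyclically_monotone T"
  shows "T \<noteq> {}"
proof
  assume "T = {}"
  moreover have "cyclically_monotone {(0::'a, 0::'a)}"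
    by (auto simp: cyclically_monotone_def)
  ultimately show False
    using assms unfolding maximal_cyclically_monotone_def by blast
qed

text \<open>The full subgradient set of the potential is itself cyclically monotone, so maximality
  turns the inclusion into an equality.\<close>

lemma maximal_cyclically_monotone_potential:
  fixes T :: "('a::euclidean_space \<times> 'a) set"
  assumes "maximal_cyclically_monotone T"
  obtains D f where "convex_on D f" "closed (epigraph D f)" "T = subgradients D f"
    "bounded (Range T) \<Longrightarrow> D = UNIV"
proof -
  obtain D f where Df: "convex_on D f" "closed (epigraph D f)" "T \<subseteq> subgradients D f"
    "bounded (Range T) \<Longrightarrow> D = UNIV"
    using cyclically_monotone_potential maximal_cyclically_monotone_nonempty assms
    by (metis maximal_cyclically_monotone_def)
  moreover have "T = subgradients D f"
    using assms Df(3) cyclically_monotone_subgradients[OF order_refl]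
    unfolding maximal_cyclically_monotone_def by blast
  ultimately show thesis using that by blast
qed

text \<open>Inversion is an involution that preserves cyclic monotonicity, so a proper extension of
  the inverse would invert to one of \<open>T\<close>. The empty set is treated apart, since a
  potential needs a starting pair.\<close>

lemma maximal_cyclically_monotone_converse:
  fixes T :: "('a::euclidean_space \<times> 'a) set"
  assumes T: "maximal_cyclically_monotone T"
  shows "maximal_cyclically_monotone (T\<inverse>)"
proof -
  have conv: "cyclically_monotone (S\<inverse>)" if S: "cyclically_monotone S" for S :: "('a \<times> 'a) set"
  proof (cases "S = {}")
    case True
    with S show ?thesis by simp
  next
    case False
    then obtain D f where "S \<subseteq> subgradients D f"
      using cyclically_monotone_potential[OF S] by blast
    then show ?thesis by (rule cyclically_monotone_converse_subgradients)
  qed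
  have "\<not> T\<inverse> \<subset> S" if "cyclically_monotone S" for S
  proof
    assume "T\<inverse> \<subset> S"
    then have "T \<subset> S\<inverse>" by fast
    then show False using T conv[OF that] by (auto simp: maximal_cyclically_monotone_def)
  qed
  then show ?thesis using T conv by (auto simp: maximal_cyclically_monotone_def)
qed

section \<open>Two-point monotonicity, interior subgradients and domains\<close>

lemma cyclically_monotone_subset:
  assumes "cyclically_monotone T" "S \<subseteq> T"
  shows "cyclically_monotone S"
  using assms unfolding cyclically_monotone_def by (metis subsetD)

lemma cyclically_monotoneD2:
  assumes "cyclically_monotone T" "(x, y) \<in> T" "(a, b) \<in> T"
  shows "0 \<le> (x - a) \<bullet> (y - b)"
proof -
  have "(\<Sum>i<2. (if i = 0 then x else a) \<bullet> (if Suc i mod 2 = 0 then y else b))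
      \<le> (\<Sum>i<2::nat. (if i = 0 then x else a) \<bullet> (if i = 0 then y else b))"
    using assms unfolding cyclically_monotone_def
    by (elim allE[of _ 2] impE allE[of _ "\<lambda>i. if i = 0 then x else a"] allE[of _ "\<lambda>i. if i = 0 then y else b"]) auto
  then show ?thesis
    by (simp add: numeral_2_eq_2 algebra_simps inner_commute)
qed

text \<open>Separating \<open>(x, f x)\<close> from the strict epigraph gives a normal
  \<open>(p, q)\<close>. It is not horizontal because \<open>x\<close> is interior, and
  \<open>- p / q\<close> is then a subgradient.\<close>

lemma subgradient_exists_interior:
  fixes f :: "'a::euclidean_space \<Rightarrow> real"
  assumes f: "convex_on D f" and x: "x \<in> interior D"
  shows "\<exists>y. (x, y) \<in> subgradients D f"
proof -
  let ?E = "{(z, t). z \<in> D \<and> f z < t}"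
  have xD: "x \<in> D" using x interior_subset by blast
  have D: "convex D" using f by (simp add: convex_on_def)
  have "convex ?E"
    unfolding convex_def
  proof (clarsimp, intro conjI)
    fix a s b t and u v :: real
    assume *: "a \<in> D" "f a < s" "b \<in> D" "f b < t" "0 \<le> u" "0 \<le> v" "u + v = 1"
    show "u *\<^sub>R a + v *\<^sub>R b \<in> D" using D * by (auto simp: convex_def)
    have "f (u *\<^sub>R a + v *\<^sub>R b) \<le> u * f a + v * f b" using f * by (auto simp: convex_on_def)
    also have "\<dots> < u * s + v * t"
    proof (cases "u = 0")
      case False
      then have "u * f a < u * s" "v * f b \<le> v * t" using * by (auto intro: mult_left_mono)
      then show ?thesis by simp
    qed (use * in auto)
    finally show "f (u *\<^sub>R a + v *\<^sub>R b) < u * s + v * t" .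
  qed
  moreover have "?E \<noteq> {}" using xD less_add_one by blast
  moreover have "{(x, f x)} \<inter> ?E = {}" by auto
  ultimately obtain w b where w: "w \<noteq> 0" "\<forall>e\<in>{(x, f x)}. w \<bullet> e \<le> b" "\<forall>e\<in>?E. b \<le> w \<bullet> e"
    using separating_hyperplane_sets[of "{(x, f x)}" ?E] convex_singleton by (metis (lifting) insert_not_empty)
  obtain p q where pq: "w = (p, q)" by (cases w)
  have sep: "p \<bullet> x + q * f x \<le> p \<bullet> z + q * t" if "z \<in> D" "f z < t" for z t
  proof -
    have "w \<bullet> (x, f x) \<le> b" "b \<le> w \<bullet> (z, t)" using w(2,3) that by blast+
    then show ?thesis by (simp add: pq)
  qed
  have "q \<ge> 0" using sep[OF xD, of "f x + 1"] by (simp add: algebra_simps)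
  \<comment> \<open>With \<open>q = 0\<close> the separation would fail at the point of
    \<open>D\<close> at distance \<open>e\<close> from \<open>x\<close> in the direction of
    \<open>- p\<close>.\<close>
  moreover have "q \<noteq> 0"
  proof
    assume q: "q = 0"
    obtain e where e: "e > 0" "cball x e \<subseteq> D" using x by (auto simp: mem_interior_cball)
    let ?z = "x - (e / norm p) *\<^sub>R p"
    have "p \<noteq> 0" using w(1) q by (auto simp: pq zero_prod_def)
    then have "?z \<in> D" using e by (intro subsetD[OF e(2)]) (auto simp: dist_norm)
    from sep[OF this, of "f ?z + 1"] have "(e / norm p) * (p \<bullet> p) \<le> 0"
      by (simp add: q inner_diff_right)
    moreover have "(e / norm p) * (p \<bullet> p) > 0" using e \<open>p \<noteq> 0\<close> by simp
    ultimately show False by simp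
  qed
  ultimately have q: "q > 0" by simp
  \<comment> \<open>The separation is available only for heights strictly above \<open>f z\<close>,
    hence the limit in \<open>e\<close>.\<close>
  have "f x + (z - x) \<bullet> (- (1 / q) *\<^sub>R p) \<le> f z" if "z \<in> D" for z
  proof (rule field_le_epsilon)
    fix e :: real assume "e > 0"
    then have "p \<bullet> x + q * f x \<le> p \<bullet> z + q * (f z + e)" using sep that by simp
    then have "(p \<bullet> x + q * f x) / q \<le> (p \<bullet> z + q * (f z + e)) / q"
      using q by (intro divide_right_mono) auto
    then show "f x + (z - x) \<bullet> (- (1 / q) *\<^sub>R p) \<le> f z + e"
      using q by (simp add: add_divide_distrib diff_divide_distrib inner_diff_left inner_diff_right inner_commute)
  qed
  then have "(x, - (1 / q) *\<^sub>R p) \<in> subgradients D f" using xD by (auto simp: subgradients_def)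
  then show ?thesis ..
qed

lemma bounded_Range_imp_Domain_UNIV:
  fixes T :: "('a::euclidean_space \<times> 'a) set"
  assumes "maximal_cyclically_monotone T" "bounded (Range T)"
  shows "Domain T = UNIV"
proof -
  obtain D f where Df: "convex_on D f" "T = subgradients D f" "D = UNIV"
    using maximal_cyclically_monotone_potential[OF assms(1)] assms(2) by metis
  then have "\<exists>y. (x, y) \<in> T" for x using subgradient_exists_interior[OF Df(1), of x] by simp
  then show ?thesis by blast
qed

text \<open>The domain of \<open>T\<close> lies between \<open>interior D\<close> and the convex set
  \<open>D\<close>, which have the same closure once the interior is non-empty. Applied to the
  inverse, this gives convexity of the closed range.\<close>

lemma convex_closure_Domain:
  fixes T :: "('a::euclidean_space \<times> 'a) set"
  assumes T: "maximal_cyclically_monotone T" and int: "interior (Domain T) \<noteq> {}"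
  shows "convex (closure (Domain T))"
proof -
  obtain D f where Df: "convex_on D f" "T = subgradients D f"
    using maximal_cyclically_monotone_potential[OF T] by metis
  have D: "convex D" using Df(1) by (simp add: convex_on_def)
  have TD: "Domain T \<subseteq> D" using Df(2) by (auto simp: subgradients_def)
  have DT: "interior D \<subseteq> Domain T" using subgradient_exists_interior[OF Df(1)] Df(2) by blast
  have "interior D \<noteq> {}" using int interior_mono[OF TD] by blast
  then have "closure D \<subseteq> closure (Domain T)"
    using convex_closure_interior[OF D] closure_mono[OF DT] by simp
  then have "closure (Domain T) = closure D" using closure_mono[OF TD] by blast
  then show ?thesis using convex_closure[OF D] by simp
qed

section \<open>Stability of maximal cyclically monotone sets\<close>

text \<open>A quantitative form of \<open>x\<close> being interior to the convex hull of
  \<open>A\<close>, phrased by directions so that moving the points or the centre by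
  \<open>d\<close> costs at most \<open>d\<close> of the radius.\<close>

definition surrounds :: "'a::real_inner set \<Rightarrow> 'a \<Rightarrow> real \<Rightarrow> bool" where
  "surrounds A x r \<longleftrightarrow> (\<forall>u. \<exists>a\<in>A. r * norm u \<le> (a - x) \<bullet> u)"

text \<open>\<open>A\<close> consists of the vertices of a cube. For a direction \<open>u\<close>
  the vertex with the signs of its coordinates yields \<open>r\<close> times the l1 norm, which
  dominates \<open>r * norm u\<close>; the triangle inequality over the basis places the vertices
  within \<open>r * DIM('a)\<close>.\<close>

lemma surrounds_cube:
  fixes x :: "'a::euclidean_space"
  assumes "r \<ge> 0"
  obtains A where "finite A" "surrounds A x r" "A \<subseteq> cball x (r * DIM('a))"
proof
  let ?v = "\<lambda>s::'a \<Rightarrow> real. \<Sum>i\<in>Basis. (r * s i) *\<^sub>R i"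
  let ?A = "(\<lambda>s. x + ?v s) ` (Basis \<rightarrow>\<^sub>E {-1, 1})"
  show "finite ?A" by (intro finite_imageI finite_PiE) auto
  show "surrounds ?A x r"
    unfolding surrounds_def
  proof
    fix u :: 'a
    define s where "s = restrict (\<lambda>i. if u \<bullet> i < 0 then -1 else 1 :: real) Basis"
    have "r * norm u \<le> r * (\<Sum>i\<in>Basis. \<bar>u \<bullet> i\<bar>)"
      using assms by (intro mult_left_mono norm_le_l1) auto
    also have "\<dots> = ?v s \<bullet> u"
      unfolding inner_sum_left sum_distrib_left
      by (intro sum.cong) (auto simp: s_def inner_commute)
    finally show "\<exists>a\<in>?A. r * norm u \<le> (a - x) \<bullet> u"
      by (intro bexI[of _ "x + ?v s"] imageI) (auto simp: s_def)
  qed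
  show "?A \<subseteq> cball x (r * DIM('a))"
  proof clarsimp
    fix s :: "'a \<Rightarrow> real" assume s: "s \<in> Basis \<rightarrow>\<^sub>E {-1, 1}"
    have "norm (?v s) \<le> (\<Sum>i::'a\<in>Basis. r)"
    proof (rule sum_norm_le)
      fix i :: 'a assume i: "i \<in> Basis"
      then have "s i = -1 \<or> s i = 1" using s by auto
      then show "norm ((r * s i) *\<^sub>R i) \<le> r" using i assms by auto
    qed
    then show "dist x (x + ?v s) \<le> r * DIM('a)" by (simp add: dist_norm mult.commute)
  qed
qed

lemma surrounds_perturb:
  assumes "surrounds A x r" "\<And>a. a \<in> A \<Longrightarrow> \<exists>b\<in>B. dist a b \<le> d"
  shows "surrounds B x (r - d)"
  unfolding surrounds_def
proof
  fix u
  obtain a where a: "a \<in> A" "r * norm u \<le> (a - x) \<bullet> u" using assms(1) by (auto simp: surrounds_def)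
  obtain b where b: "b \<in> B" "dist a b \<le> d" using assms(2)[OF a(1)] by blast
  have "(a - b) \<bullet> u \<le> norm (a - b) * norm u" by (rule norm_cauchy_schwarz)
  also have "\<dots> \<le> d * norm u" using b by (intro mult_right_mono) (auto simp: dist_norm)
  finally have "(r - d) * norm u \<le> (b - x) \<bullet> u" using a(2) by (simp add: algebra_simps)
  then show "\<exists>b\<in>B. (r - d) * norm u \<le> (b - x) \<bullet> u" using b(1) by blast
qed

lemma surrounds_shift:
  assumes "surrounds A x r" "dist x z \<le> d"
  shows "surrounds A z (r - d)"
  unfolding surrounds_def
proof
  fix u
  obtain a where a: "a \<in> A" "r * norm u \<le> (a - x) \<bullet> u" using assms(1) by (auto simp: surrounds_def)
  have "(z - x) \<bullet> u \<le> norm (z - x) * norm u" by (rule norm_cauchy_schwarz)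
  also have "\<dots> \<le> d * norm u" using assms(2) by (intro mult_right_mono) (auto simp: dist_norm norm_minus_commute)
  finally have "(r - d) * norm u \<le> (a - z) \<bullet> u" using a(2) by (simp add: algebra_simps)
  then show "\<exists>a\<in>A. (r - d) * norm u \<le> (a - z) \<bullet> u" using a(1) by blast
qed

lemma surrounds_ball_subset_closure_hull:
  fixes x :: "'a::euclidean_space"
  assumes A: "surrounds A x r"
  shows "ball x r \<subseteq> closure (convex hull A)"
proof (rule subsetI, rule ccontr)
  fix z assume z: "z \<in> ball x r" "z \<notin> closure (convex hull A)"
  obtain a b where ab: "a \<bullet> z < b" "\<And>w. w \<in> closure (convex hull A) \<Longrightarrow> b < a \<bullet> w"
    using separating_hyperplane_closed_point[OF _ closed_closure z(2)] convex_closure convex_convex_hull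
    by blast
  obtain p where p: "p \<in> A" "r * norm a \<le> (p - x) \<bullet> (- a)"
    using A[unfolded surrounds_def, rule_format, of "- a"] by auto
  have "p \<in> closure (convex hull A)" using p(1) hull_inc[of p A convex] closure_subset by blast
  then have "a \<bullet> z < a \<bullet> p" using ab by fastforce
  then have "r * norm a < (z - x) \<bullet> (- a)" using p(2) by (simp add: algebra_simps inner_commute)
  also have "\<dots> \<le> norm (z - x) * norm a" using norm_cauchy_schwarz[of "z - x" "- a"] by simp
  also have "\<dots> \<le> r * norm a" using z(1) by (intro mult_right_mono) (auto simp: dist_norm norm_minus_commute)
  finally show False by simp
qed

text \<open>For the point \<open>a\<close> that surrounds \<open>z\<close> in the direction of
  \<open>w\<close>, monotonicity gives the chain \<open>r * norm w \<le> (a - z) \<bullet> w \<le>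
  (a - z) \<bullet> b \<le> C * M\<close>.\<close>

lemma cyclically_monotone_norm_bound:
  assumes T: "cyclically_monotone T" "(z, w) \<in> T"
    and A: "surrounds A z r" "r > 0"
    and AT: "\<And>a. a \<in> A \<Longrightarrow> \<exists>b. (a, b) \<in> T \<and> norm b \<le> M \<and> dist a z \<le> C"
  shows "norm w \<le> C * M / r"
proof -
  obtain a where a: "a \<in> A" "r * norm w \<le> (a - z) \<bullet> w" using A by (auto simp: surrounds_def)
  obtain b where b: "(a, b) \<in> T" "norm b \<le> M" "dist a z \<le> C" using AT[OF a(1)] by blast
  have "(a - z) \<bullet> w \<le> (a - z) \<bullet> b"
    using cyclically_monotoneD2[OF T(1,2) b(1)] by (simp add: algebra_simps)
  also have "\<dots> \<le> norm (a - z) * norm b" by (rule norm_cauchy_schwarz)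
  also have "\<dots> \<le> C * M" using b order_trans[OF zero_le_dist b(3)] by (intro mult_mono) (auto simp: dist_norm)
  finally show ?thesis using a(2) A(2) by (simp add: field_simps)
qed

text \<open>The domain of \<open>T\<close> need not be convex, so the hull is taken in the domain
  \<open>D\<close> of the potential. For convex \<open>D\<close> the interior of the closure is the
  interior of \<open>D\<close>, where subgradients exist.\<close>

lemma ball_subset_Domain:
  fixes x :: "'a::euclidean_space"
  assumes T: "maximal_cyclically_monotone T" and A: "surrounds A x r" "A \<subseteq> Domain T"
  shows "ball x r \<subseteq> Domain T"
proof -
  obtain D f where Df: "convex_on D f" "T = subgradients D f"
    using maximal_cyclically_monotone_potential[OF T] by metis
  have D: "convex D" using Df(1) by (simp add: convex_on_def)
  have "A \<subseteq> D" using A(2) Df(2) by (auto simp: subgradients_def)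
  then have "closure (convex hull A) \<subseteq> closure D" using D by (intro closure_mono hull_minimal)
  then have "ball x r \<subseteq> interior (closure D)"
    using surrounds_ball_subset_closure_hull[OF A(1)] by (intro interior_maximal) auto
  also have "\<dots> \<subseteq> Domain T"
    unfolding convex_interior_closure[OF D] Df(2) using subgradient_exists_interior[OF Df(1)] by blast
  finally show ?thesis .
qed

lemma uniform_local_bound:
  fixes Tn :: "nat \<Rightarrow> ('a::euclidean_space \<times> 'a) set"
  assumes V: "open V" "V \<subseteq> closure (Domain S)"
    and Tn: "\<And>n. maximal_cyclically_monotone (Tn n)"
    and S: "\<And>p e. p \<in> S \<Longrightarrow> 0 < e \<Longrightarrow> \<forall>\<^sub>F n in sequentially. \<exists>q\<in>Tn n. dist q p < e"
    and x: "x \<in> V"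
  obtains r M where "r > 0" "\<forall>\<^sub>F n in sequentially. ball x r \<subseteq> Domain (Tn n) \<and> Tn n `` ball x r \<subseteq> cball 0 M"
proof -
  obtain e where e: "e > 0" "cball x e \<subseteq> V" using V(1) x open_contains_cball by blast
  \<comment> \<open>Budget for the radius: the vertices surround \<open>x\<close> with radius
    \<open>4 * r\<close>; replacing them first by points of \<open>Domain S\<close> and then by
    points of \<open>Domain (Tn n)\<close> costs \<open>2 * r\<close>, and moving the centre to
    \<open>z\<close> costs a further \<open>r\<close>. The factor \<open>DIM('a)\<close> keeps the
    vertices in \<open>cball x e\<close>.\<close>
  define r where "r = e / (4 * DIM('a))"
  have r: "r > 0" using e by (simp add: r_def)
  have er: "4 * r * DIM('a) = e" by (simp add: r_def)
  obtain A where A: "finite A" "surrounds A x (4 * r)" "A \<subseteq> cball x e"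
    using surrounds_cube[of "4 * r" x] r er by force
  have "\<exists>p\<in>S. dist (fst p) a < r" if "a \<in> A" for a
  proof -
    have "a \<in> closure (Domain S)" using that A(3) e(2) V(2) by blast
    then obtain a' where "a' \<in> Domain S" "dist a' a < r" using r unfolding closure_approachable by blast
    then show ?thesis by force
  qed
  then obtain p where p: "\<And>a. a \<in> A \<Longrightarrow> p a \<in> S" "\<And>a. a \<in> A \<Longrightarrow> dist (fst (p a)) a < r" by metis
  define M where "M = (\<Sum>a\<in>A. norm (snd (p a))) + r"
  have M: "norm (snd (p a)) + r \<le> M" if "a \<in> A" for a
    unfolding M_def using A(1) that by (auto intro!: member_le_sum)
  define C where "C = e + 3 * r"
  have "\<forall>\<^sub>F n in sequentially. \<forall>a\<in>A. \<exists>q\<in>Tn n. dist q (p a) < r"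
    using A(1) S p(1) r by (intro eventually_ball_finite) auto
  then have "\<forall>\<^sub>F n in sequentially. ball x r \<subseteq> Domain (Tn n) \<and> Tn n `` ball x r \<subseteq> cball 0 (C * M / r)"
  proof eventually_elim
    case (elim n)
    define B where "B = {a. \<exists>b. (a, b) \<in> Tn n \<and> norm b \<le> M \<and> dist a x \<le> e + 2 * r}"
    have "\<exists>b\<in>B. dist a b \<le> 2 * r" if a: "a \<in> A" for a
    proof -
      obtain q where q: "q \<in> Tn n" "dist q (p a) < r" using elim a by blast
      have 1: "dist (fst q) (fst (p a)) < r" "dist (snd q) (snd (p a)) < r"
        using q(2) dist_fst_le[of q "p a"] dist_snd_le[of q "p a"] by linarith+
      have 2: "dist (fst q) a \<le> 2 * r" using 1(1) p(2)[OF a] dist_triangle[of "fst q" a "fst (p a)"] by linarith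
      have "norm (snd q) \<le> norm (snd (p a)) + norm (snd q - snd (p a))" by (rule norm_triangle_sub)
      then have "norm (snd q) \<le> M" using M[OF a] 1(2) by (simp add: dist_norm)
      moreover have "dist (fst q) x \<le> e + 2 * r"
        using 2 a A(3) dist_triangle[of "fst q" x a] by (fastforce simp: dist_commute)
      ultimately have "fst q \<in> B" unfolding B_def using q(1) by (intro CollectI exI[of _ "snd q"]) auto
      then show ?thesis using 2 by (auto simp: dist_commute)
    qed
    from surrounds_perturb[OF A(2) this] have B: "surrounds B x (2 * r)" by simp
    have "ball x (2 * r) \<subseteq> Domain (Tn n)" using B by (intro ball_subset_Domain[OF Tn]) (auto simp: B_def)
    moreover have "norm w \<le> C * M / r" if "(z, w) \<in> Tn n" "z \<in> ball x r" for z w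
    proof (rule cyclically_monotone_norm_bound[OF _ that(1), of B])
      show "surrounds B z r" using surrounds_shift[OF B, of z r] that(2) by auto
      show "\<exists>b. (a, b) \<in> Tn n \<and> norm b \<le> M \<and> dist a z \<le> C" if a: "a \<in> B" for a
      proof -
        have "dist a z \<le> dist a x + dist x z" by (rule dist_triangle)
        then show ?thesis using a \<open>z \<in> ball x r\<close> unfolding B_def C_def by auto
      qed
    qed (use r Tn in \<open>auto simp: maximal_cyclically_monotone_def\<close>)
    ultimately show ?case using r by (auto simp: subset_eq)
  qed
  with r show thesis by (rule that)
qed

lemma uniform_bound_compact:
  fixes Tn :: "nat \<Rightarrow> ('a::euclidean_space \<times> 'a) set"
  assumes V: "open V" "V \<subseteq> closure (Domain S)"
    and Tn: "\<And>n. maximal_cyclically_monotone (Tn n)"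
    and S: "\<And>p e. p \<in> S \<Longrightarrow> 0 < e \<Longrightarrow> \<forall>\<^sub>F n in sequentially. \<exists>q\<in>Tn n. dist q p < e"
    and K: "compact K" "K \<subseteq> V"
  obtains M where "\<forall>\<^sub>F n in sequentially. K \<subseteq> interior (Domain (Tn n)) \<and> Tn n `` K \<subseteq> cball 0 M"
proof -
  define good where "good x r M \<longleftrightarrow> r > 0 \<and>
    (\<forall>\<^sub>F n in sequentially. ball x r \<subseteq> Domain (Tn n) \<and> Tn n `` ball x r \<subseteq> cball 0 M)" for x r M
  have "\<exists>r M. good x r M" if "x \<in> K" for x
  proof -
    have "x \<in> V" using that K(2) by blast
    from uniform_local_bound[OF V Tn S this] show ?thesis unfolding good_def by blast
  qed
  then obtain r M where good: "\<And>x. x \<in> K \<Longrightarrow> good x (r x) (M x)" by metis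
  note rM = good[unfolded good_def, THEN conjunct1] good[unfolded good_def, THEN conjunct2]
  have "K \<subseteq> (\<Union>x\<in>K. ball x (r x))" using rM(1) by auto
  then obtain F where F: "F \<subseteq> K" "finite F" "K \<subseteq> (\<Union>x\<in>F. ball x (r x))"
    using compactE_image[OF K(1), of K "\<lambda>x. ball x (r x)"] by auto
  have "\<forall>\<^sub>F n in sequentially. \<forall>x\<in>F. ball x (r x) \<subseteq> Domain (Tn n) \<and> Tn n `` ball x (r x) \<subseteq> cball 0 (M x)"
    using F rM(2) by (intro eventually_ball_finite) auto
  then have "\<forall>\<^sub>F n in sequentially. K \<subseteq> interior (Domain (Tn n)) \<and> Tn n `` K \<subseteq> cball 0 (\<Sum>x\<in>F. \<bar>M x\<bar>)"
  proof eventually_elim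
    case (elim n)
    have "K \<subseteq> interior (Domain (Tn n))"
      using elim by (intro order_trans[OF F(3)] UN_least interior_maximal) auto
    moreover have "norm w \<le> (\<Sum>x\<in>F. \<bar>M x\<bar>)" if w: "w \<in> Tn n `` K" for w
    proof -
      obtain x where x: "x \<in> F" "w \<in> Tn n `` ball x (r x)" using w F(3) by blast
      then have "norm w \<le> \<bar>M x\<bar>" using elim by fastforce
      also have "\<dots> \<le> (\<Sum>x\<in>F. \<bar>M x\<bar>)" using x F(2) by (intro member_le_sum) auto
      finally show ?thesis .
    qed
    ultimately show ?case by (metis mem_cball_0 subsetI)
  qed
  then show thesis by (rule that)
qed

text \<open>Existence for the resolvent, localised: minimising \<open>f - \<langle>\<cdot>, y\<rangle> + |\<cdot> - x|\<^sup>2 / (2\<lambda>)\<close> over a small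
  ball around \<open>x\<close> gives an interior minimiser when \<open>\<lambda>\<close> is small.\<close>

lemma local_resolvent:
  fixes T :: "('a::euclidean_space \<times> 'a) set"
  assumes T: "maximal_cyclically_monotone T" and xv: "(x, v) \<in> T" "norm v \<le> M"
    and r: "ball x r \<subseteq> Domain T" and s: "s < r" and l: "0 < l" "2 * l * (norm y + M) < s"
  obtains z where "z \<in> cball x s" "(z, y - (z - x) /\<^sub>R l) \<in> T"
proof -
  obtain D f where Df: "convex_on D f" "T = subgradients D f"
    using maximal_cyclically_monotone_potential[OF T] by metis
  have M: "0 \<le> M" using xv(2) norm_ge_zero order_trans by blast
  then have "0 \<le> 2 * l * (norm y + M)" using l(1) by simp
  then have s0: "0 < s" using l(2) by simp
  have D: "convex D" using Df(1) by (simp add: convex_on_def)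
  have bD: "ball x r \<subseteq> D" using r Df(2) by (auto simp: subgradients_def)
  define g where "g z = f z - z \<bullet> y + (z - x) \<bullet> (z - x) / (2 * l)" for z
  have "continuous_on (ball x r) f"
    using Df(1) bD by (intro convex_on_continuous) (auto intro: convex_on_subset)
  then have "continuous_on (cball x s) f" by (rule continuous_on_subset) (use s in auto)
  then have "continuous_on (cball x s) g"
    unfolding g_def using l(1) by (intro continuous_intros) auto
  moreover have "cball x s \<noteq> {}" using s0 by simp
  ultimately obtain z where z: "z \<in> cball x s" "\<And>w. w \<in> cball x s \<Longrightarrow> g z \<le> g w"
    using continuous_attains_inf[OF compact_cball] by metis
  have zD: "z \<in> D" using z(1) s bD by auto
  have xD: "x \<in> D" using bD s s0 by auto
  \<comment> \<open>Comparison of the minimum with \<open>g x\<close>, where the subgradient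
    \<open>v\<close> controls the decrease of \<open>f\<close>, yields
    \<open>norm (z - x) \<le> 2 * l * (norm y + M)\<close>, which is below \<open>s\<close>.\<close>
  have "norm (z - x) < s"
  proof (rule ccontr)
    assume n: "\<not> norm (z - x) < s"
    then have zx: "norm (z - x) > 0" using s0 by linarith
    have "g z \<le> g x" using z(2)[of x] s0 by simp
    moreover have "f x + (z - x) \<bullet> v \<le> f z" using xv(1) zD Df(2) by (auto simp: subgradients_def)
    ultimately have "(z - x) \<bullet> (z - x) / (2 * l) \<le> (z - x) \<bullet> (y - v)"
      unfolding g_def by (simp add: inner_diff_left inner_diff_right)
    also have "\<dots> \<le> norm (z - x) * norm (y - v)" by (rule norm_cauchy_schwarz)
    also have "\<dots> \<le> norm (z - x) * (norm y + M)"
      using xv(2) norm_triangle_ineq4[of y v] by (intro mult_left_mono) auto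
    finally have "norm (z - x) * norm (z - x) / (2 * l) \<le> norm (z - x) * (norm y + M)"
      by (simp add: dot_square_norm power2_eq_square)
    then have "norm (z - x) * norm (z - x) \<le> norm (z - x) * (2 * l * (norm y + M))"
      using l(1) by (simp add: field_simps)
    then have "norm (z - x) \<le> 2 * l * (norm y + M)" using zx by (simp only: mult_le_cancel_left_pos)
    with n l(2) show False by linarith
  qed
  have "f z + (w - z) \<bullet> (y - (z - x) /\<^sub>R l) \<le> f w" if w: "w \<in> D" for w
  proof -
    define h where "h = w - z"
    \<comment> \<open>Minimality is used at \<open>z + t *\<^sub>R h\<close> only for small
      \<open>t\<close>. Convexity of \<open>f\<close> allows division by \<open>t\<close>, and the
      quadratic remainder vanishes as \<open>t\<close> tends to 0, so a local minimum gives a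
      subgradient inequality on all of \<open>D\<close>.\<close>
    have ineq: "f z + h \<bullet> (y - (z - x) /\<^sub>R l) - t * (h \<bullet> h) / (2 * l) \<le> f w"
      if t: "0 < t" "t \<le> 1" "norm (t *\<^sub>R h) < s - norm (z - x)" for t
    proof -
      have sq: "(z + t *\<^sub>R h - x) \<bullet> (z + t *\<^sub>R h - x) =
          (z - x) \<bullet> (z - x) + (2 * t * (h \<bullet> (z - x)) + t * t * (h \<bullet> h))"
        by (simp add: algebra_simps inner_commute)
      have "norm (z + t *\<^sub>R h - x) \<le> norm (z - x) + norm (t *\<^sub>R h)"
        using norm_triangle_ineq[of "z - x" "t *\<^sub>R h"] by (simp add: algebra_simps)
      then have "g z \<le> g (z + t *\<^sub>R h)"
        using t(3) by (intro z(2)) (auto simp: dist_norm norm_minus_commute)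
      then have 1: "f z \<le> f (z + t *\<^sub>R h) - t * (h \<bullet> y) + (2 * t * (h \<bullet> (z - x)) + t * t * (h \<bullet> h)) / (2 * l)"
        unfolding g_def sq by (simp add: inner_add_left add_divide_distrib)
      have "z + t *\<^sub>R h = (1 - t) *\<^sub>R z + t *\<^sub>R w" by (simp add: h_def algebra_simps)
      then have "f (z + t *\<^sub>R h) \<le> (1 - t) * f z + t * f w"
        using convex_onD[OF Df(1), of t z w] t w zD by simp
      with 1 have "t * f z \<le> t * f w - t * (h \<bullet> y) + (2 * t * (h \<bullet> (z - x)) + t * t * (h \<bullet> h)) / (2 * l)"
        by (simp add: algebra_simps)
      also have "\<dots> = t * (f w - h \<bullet> y + h \<bullet> (z - x) / l + t * (h \<bullet> h) / (2 * l))"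
        using l(1) by (simp add: field_simps)
      finally have "f z \<le> f w - h \<bullet> y + h \<bullet> (z - x) / l + t * (h \<bullet> h) / (2 * l)"
        using t(1) by simp
      moreover have "h \<bullet> (y - (z - x) /\<^sub>R l) = h \<bullet> y - h \<bullet> (z - x) / l"
        unfolding inner_diff_right[of h y] inner_scaleR_right by (simp add: divide_inverse_commute)
      ultimately show ?thesis by simp
    qed
    have "((\<lambda>t. f z + h \<bullet> (y - (z - x) /\<^sub>R l) - t * (h \<bullet> h) / (2 * l)) \<longlongrightarrow>
        f z + h \<bullet> (y - (z - x) /\<^sub>R l) - 0 * (h \<bullet> h) / (2 * l)) (at_right 0)"
      using l(1) by (intro tendsto_intros) auto
    moreover have "\<forall>\<^sub>F t in at_right 0. f z + h \<bullet> (y - (z - x) /\<^sub>R l) - t * (h \<bullet> h) / (2 * l) \<le> f w"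
    proof -
      have "((\<lambda>t. norm (t *\<^sub>R h)) \<longlongrightarrow> norm (0 *\<^sub>R h)) (at_right 0)" by (intro tendsto_intros)
      then have "\<forall>\<^sub>F t in at_right 0. norm (t *\<^sub>R h) < s - norm (z - x)"
        using \<open>norm (z - x) < s\<close> by (intro order_tendstoD) auto
      moreover have "\<forall>\<^sub>F t::real in at_right 0. 0 < t \<and> t \<le> 1"
        unfolding eventually_at_right_field by (intro exI[of _ 1]) auto
      ultimately show ?thesis by eventually_elim (use ineq in auto)
    qed
    ultimately show ?thesis 
      using tendsto_upperbound[OF _ _ trivial_limit_at_right_real] unfolding h_def[symmetric]
      by (simp only: mult_zero_left div_0 diff_zero)
  qed
  then have "(z, y - (z - x) /\<^sub>R l) \<in> T" using zD Df(2) by (auto simp: subgradients_def)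
  with z(1) show thesis by (rule that)
qed

text \<open>Exclusion of compact sets yields approximation: the disc of resolvent candidates minus
  the \<open>e\<close>-ball misses \<open>T\<close>, hence eventually \<open>Tn n\<close>, while the
  resolvent of \<open>Tn n\<close> supplies a point on the disc. That point must lie in the
  ball.\<close>

lemma approximation_from_upper_limit:
  fixes T :: "('a::euclidean_space \<times> 'a) set"
  assumes T: "cyclically_monotone T" "(x, y) \<in> T"
    and V: "open V" "x \<in> V"
    and Tn: "\<And>n. maximal_cyclically_monotone (Tn n)"
    and upper: "\<And>K. compact K \<Longrightarrow> K \<subseteq> V \<times> UNIV \<Longrightarrow> T \<inter> K = {} \<Longrightarrow> \<forall>\<^sub>F n in sequentially. Tn n \<inter> K = {}"
    and bd: "r > 0" "\<forall>\<^sub>F n in sequentially. ball x r \<subseteq> Domain (Tn n) \<and> Tn n `` ball x r \<subseteq> cball 0 M"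
    and e: "e > 0"
  shows "\<forall>\<^sub>F n in sequentially. \<exists>q\<in>Tn n. dist q (x, y) < e"
proof -
  obtain t where t: "t > 0" "cball x t \<subseteq> V" using V open_contains_cball by blast
  define s where "s = min t (r / 2)"
  have s: "0 < s" "s < r" "cball x s \<subseteq> V" using t bd(1) unfolding s_def by auto
  \<comment> \<open>Chosen to meet the smallness condition of \<open>local_resolvent\<close>. The
    absolute value is there because \<open>M\<close> is not assumed non-negative, the summand 1 to
    keep the denominator positive.\<close>
  define l where "l = s / (4 * (norm y + \<bar>M\<bar> + 1))"
  have pos: "norm y + \<bar>M\<bar> + 1 > 0" using norm_ge_zero[of y] by linarith
  have l: "0 < l" using s(1) pos by (simp add: l_def)
  have "2 * l * (norm y + \<bar>M\<bar>) < 4 * l * (norm y + \<bar>M\<bar> + 1)"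
    using l pos by (auto intro!: mult_strict_mono' simp: add_nonneg_nonneg)
  also have "\<dots> = s" unfolding l_def using pos by (simp add: nonzero_divide_eq_eq)
  finally have ls: "2 * l * (norm y + \<bar>M\<bar>) < s" .
  define C where "C = (\<lambda>z. (z, y - (z - x) /\<^sub>R l)) ` cball x s"
  have "compact C" unfolding C_def by (intro compact_continuous_image continuous_intros) auto
  then have "compact (C - ball (x, y) e)" by (intro compact_diff) auto
  moreover have "C - ball (x, y) e \<subseteq> V \<times> UNIV" using s(3) by (auto simp: C_def)
  moreover have "T \<inter> (C - ball (x, y) e) = {}"
  proof -
    \<comment> \<open>Two-point monotonicity of a candidate with \<open>(x, y)\<close> reads
      \<open>0 \<le> - ((z - x) \<bullet> (z - x)) / l\<close>.\<close>
    have "z = x" if "(z, y - (z - x) /\<^sub>R l) \<in> T" for z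
    proof -
      have "0 \<le> - ((z - x) \<bullet> (z - x)) / l"
        using cyclically_monotoneD2[OF T(1) that T(2)] by (simp add: divide_inverse mult.commute)
      then have "(z - x) \<bullet> (z - x) \<le> 0" using l by (simp add: field_simps)
      then have "z - x = 0" by (metis inner_ge_zero inner_eq_zero_iff order_antisym)
      then show ?thesis by simp
    qed
    then have "q = (x, y)" if "q \<in> T" "q \<in> C" for q using that by (force simp: C_def)
    then show ?thesis using e by auto
  qed
  ultimately have "\<forall>\<^sub>F n in sequentially. Tn n \<inter> (C - ball (x, y) e) = {}" by (rule upper)
  with bd(2) show ?thesis
  proof eventually_elim
    case (elim n)
    have xb: "x \<in> ball x r" using bd(1) by simp
    then obtain v where v: "(x, v) \<in> Tn n" using elim by blast
    then have "v \<in> cball 0 M" using elim xb by blast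
    then have "norm v \<le> \<bar>M\<bar>" by simp
    then obtain z where "z \<in> cball x s" "(z, y - (z - x) /\<^sub>R l) \<in> Tn n"
      using local_resolvent[OF Tn v _ _ s(2) l ls] elim by blast
    moreover have "(z, y - (z - x) /\<^sub>R l) \<in> C" using calculation(1) by (auto simp: C_def)
    ultimately show ?case using elim by (metis Diff_iff IntI dist_commute empty_iff mem_ball)
  qed
qed

section \<open>Pairs monotonically related to a dense part of the graph, and their exclusion\<close>

lemma maximal_cyclically_monotone_imp_convex_image:
  fixes T :: "('a::euclidean_space \<times> 'a) set"
  assumes "maximal_cyclically_monotone T"
  shows "convex (T `` {x})"
proof -
  obtain D f where Df: "T = subgradients D f"
    using maximal_cyclically_monotone_potential[OF assms] by metis
  show ?thesis
  proof (cases "x \<in> D")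
    case True
    then have "T `` {x} = (\<Inter>z\<in>D. {y. (z - x) \<bullet> y \<le> f z - f x})"
      by (auto simp: Df subgradients_def algebra_simps)
    then show ?thesis by (auto intro!: convex_INT convex_halfspace_le)
  next
    case False
    then have "T `` {x} = {}" by (auto simp: Df subgradients_def)
    then show ?thesis by simp
  qed
qed

lemma closed_Image_singleton:
  fixes T :: "('a::t1_space \<times> 'b::t1_space) set"
  assumes "closed T"
  shows "closed (T `` {x})"
proof -
  have "T `` {x} = (\<lambda>y. (x, y)) -` T" by auto
  then show ?thesis using assms by (auto intro!: continuous_closed_vimage continuous_intros)
qed

text \<open>Local boundedness of \<open>T\<close> alone is the uniform bound for the constant
  sequence. It makes the values over a sequence converging in \<open>V\<close> subconverge, and
  closedness of \<open>T\<close> catches the limit.\<close>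

lemma graph_subsequence:
  fixes T :: "('a::euclidean_space \<times> 'a) set"
  assumes T: "maximal_cyclically_monotone T" "closed T"
    and V: "open V" "V \<subseteq> closure (Domain T)" "x \<in> V"
    and p: "\<And>k. p k \<in> T" "(\<lambda>k. fst (p k)) \<longlonglongrightarrow> x"
  obtains c r where "strict_mono (r :: nat \<Rightarrow> nat)" "(\<lambda>k. snd (p (r k))) \<longlonglongrightarrow> c" "(x, c) \<in> T"
proof -
  obtain e M where e: "e > 0" "\<forall>\<^sub>F n::nat in sequentially. ball x e \<subseteq> Domain T \<and> T `` ball x e \<subseteq> cball 0 M"
  proof (rule uniform_local_bound[OF V(1,2) T(1) _ V(3)])
    show "\<forall>\<^sub>F n in sequentially. \<exists>q\<in>T. dist q p < e" if "p \<in> T" "0 < e" for p e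
      using that by (intro always_eventually) (auto intro!: bexI[of _ p])
  qed blast
  then have M: "T `` ball x e \<subseteq> cball 0 M" by simp
  have "\<forall>\<^sub>F k in sequentially. dist (fst (p k)) x < e" using p(2) e(1) by (rule tendstoD)
  then obtain N where N: "\<And>k. k \<ge> N \<Longrightarrow> dist (fst (p k)) x < e"
    by (auto simp: eventually_sequentially)
  have "snd (p (k + N)) \<in> cball 0 M" for k
  proof -
    have "fst (p (k + N)) \<in> ball x e" using N[of "k + N"] by (simp add: dist_commute)
    moreover have "(fst (p (k + N)), snd (p (k + N))) \<in> T" using p(1) by simp
    ultimately show ?thesis using M by blast
  qed
  then obtain c r where r: "strict_mono (r :: nat \<Rightarrow> nat)" "((\<lambda>k. snd (p (k + N))) \<circ> r) \<longlonglongrightarrow> c"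
    using compact_cball[of "0::'a" M] unfolding compact_eq_seq_compact_metric seq_compact_def by metis
  define q where "q k = r k + N" for k
  have q: "strict_mono q" using r(1) by (auto simp: q_def strict_mono_def)
  have c: "(\<lambda>k. snd (p (q k))) \<longlonglongrightarrow> c" using r(2) by (simp add: q_def o_def)
  have "(\<lambda>k. (fst (p (q k)), snd (p (q k)))) \<longlonglongrightarrow> (x, c)"
    using LIMSEQ_subseq_LIMSEQ[OF p(2) q] c by (intro tendsto_Pair) (auto simp: o_def)
  then have "(\<lambda>k. p (q k)) \<longlonglongrightarrow> (x, c)" by simp
  then have "(x, c) \<in> T" by (rule closed_sequentially[OF T(2) p(1)])
  with q c show thesis by (rule that)
qed

text \<open>\<open>S\<close> may have no pair over \<open>w\<close> itself. Density gives pairs over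
  nearby points, their values subconverge, and the weak inequality passes to the limit pair of
  \<open>T\<close>.\<close>

lemma related_extend:
  fixes T :: "('a::euclidean_space \<times> 'a) set"
  assumes T: "maximal_cyclically_monotone T" "closed T" "S \<subseteq> T"
    and V: "open V" "V \<subseteq> closure (Domain S)" "w \<in> V"
    and xy: "\<And>a b. (a, b) \<in> S \<Longrightarrow> 0 \<le> (x - a) \<bullet> (y - b)"
  obtains c where "(w, c) \<in> T" "0 \<le> (x - w) \<bullet> (y - c)"
proof -
  have "w \<in> closure (Domain S)" using V by blast
  then obtain a where a: "\<And>k. a k \<in> Domain S" "a \<longlonglongrightarrow> w" by (auto simp: closure_sequential)
  then have "\<exists>b. (a k, b) \<in> S" for k by blast
  then obtain b where ab: "\<And>k. (a k, b k) \<in> S" by metis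
  define p where "p k = (a k, b k)" for k :: nat
  have "V \<subseteq> closure (Domain T)" using V(2) T(3) closure_mono[of "Domain S" "Domain T"] by blast
  moreover have "p k \<in> T" for k using ab T(3) by (auto simp: p_def)
  moreover have "(\<lambda>k. fst (p k)) \<longlonglongrightarrow> w" using a(2) by (simp add: p_def)
  ultimately obtain c r where r: "strict_mono (r :: nat \<Rightarrow> nat)" "(\<lambda>k. snd (p (r k))) \<longlonglongrightarrow> c" "(w, c) \<in> T"
    by (rule graph_subsequence[OF T(1,2) V(1) _ V(3)])
  have "(\<lambda>k. (x - a (r k)) \<bullet> (y - b (r k))) \<longlonglongrightarrow> (x - w) \<bullet> (y - c)"
    using r(2) LIMSEQ_subseq_LIMSEQ[OF a(2) r(1)] by (intro tendsto_intros) (auto simp: p_def o_def)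
  then have "0 \<le> (x - w) \<bullet> (y - c)"
    by (rule LIMSEQ_le_const) (use ab xy in auto)
  with r(3) show thesis by (rule that)
qed

text \<open>If \<open>u\<close> strictly separates \<open>y\<close> from \<open>T(x)\<close>,
  approach \<open>x\<close> along \<open>x - t *\<^sub>R u\<close>. Related pairs of
  \<open>T\<close> over these points have values \<open>c\<close> with
  \<open>u \<bullet> c \<le> u \<bullet> y\<close>; a limit of such values lies in
  \<open>T(x)\<close> and contradicts the separation.\<close>

lemma related_imp_mem:
  fixes T :: "('a::euclidean_space \<times> 'a) set"
  assumes T: "maximal_cyclically_monotone T" "closed T" "S \<subseteq> T"
    and V: "open V" "V \<subseteq> closure (Domain S)" "x \<in> V"
    and xy: "\<And>a b. (a, b) \<in> S \<Longrightarrow> 0 \<le> (x - a) \<bullet> (y - b)"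
  shows "(x, y) \<in> T"
proof (rule ccontr)
  assume "(x, y) \<notin> T"
  then have "y \<notin> T `` {x}" by blast
  then obtain u b where ub: "u \<bullet> y < b" "\<And>w. w \<in> T `` {x} \<Longrightarrow> b < u \<bullet> w"
    using separating_hyperplane_closed_point[OF maximal_cyclically_monotone_imp_convex_image[OF T(1)]
        closed_Image_singleton[OF T(2)]] by blast
  obtain e where e: "e > 0" "ball x e \<subseteq> V" using V openE by blast
  define t where "t k = e / (norm u + 1) / real (k + 2)" for k
  have pos: "norm u + 1 > 0" using norm_ge_zero[of u] by linarith
  have t: "t k > 0" for k using e(1) pos by (simp add: t_def)
  define z where "z k = x - t k *\<^sub>R u" for k
  have "z k \<in> V" for k
  proof -
    have "t k * norm u < t k * (norm u + 1) * real (k + 2)"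
    proof -
      have "t k * norm u < t k * (norm u + 1)" using t by simp
      also have "\<dots> \<le> t k * (norm u + 1) * real (k + 2)" using t[of k] pos by simp
      finally show ?thesis .
    qed
    also have "\<dots> = e" unfolding t_def using pos by (simp add: nonzero_eq_divide_eq)
    finally show ?thesis using t[of k] e(2) by (auto simp: z_def dist_norm)
  qed
  then have "\<exists>c. (z k, c) \<in> T \<and> 0 \<le> (x - z k) \<bullet> (y - c)" for k
    using related_extend[OF T V(1,2) _ xy] by metis
  then obtain c where c: "\<And>k. (z k, c k) \<in> T" "\<And>k. 0 \<le> (x - z k) \<bullet> (y - c k)" by metis
  have uc: "u \<bullet> c k \<le> u \<bullet> y" for k
    using c(2)[of k] t[of k] by (simp add: z_def inner_diff_right zero_le_mult_iff)
  have "t \<longlonglongrightarrow> 0" unfolding t_def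
    using LIMSEQ_ignore_initial_segment[OF lim_const_over_n[of "e / (norm u + 1)"], of 2] by simp
  then have "z \<longlonglongrightarrow> x - 0 *\<^sub>R u" unfolding z_def by (intro tendsto_intros)
  moreover have "V \<subseteq> closure (Domain T)" using V(2) T(3) closure_mono[of "Domain S" "Domain T"] by blast
  moreover define p where "p k = (z k, c k)" for k
  moreover have "p k \<in> T" for k using c(1) by (simp add: p_def)
  moreover have "(\<lambda>k. fst (p k)) \<longlonglongrightarrow> x" using calculation(1) by (simp add: p_def)
  ultimately obtain d r where "strict_mono (r :: nat \<Rightarrow> nat)" "(\<lambda>k. snd (p (r k))) \<longlonglongrightarrow> d" "(x, d) \<in> T"
    using graph_subsequence[OF T(1,2) V(1) _ V(3), of p] by blast
  then have r: "(\<lambda>k. c (r k)) \<longlonglongrightarrow> d" "(x, d) \<in> T" by (simp_all add: p_def)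
  have "(\<lambda>k. u \<bullet> c (r k)) \<longlonglongrightarrow> u \<bullet> d" using r(1) by (intro tendsto_intros)
  then have "u \<bullet> d \<le> u \<bullet> y" by (rule LIMSEQ_le_const2) (use uc in auto)
  then show False using ub r(2) by force
qed

text \<open>Compared with \<open>related_imp_mem\<close>, the point may lie on the boundary of the domain. There
  \<open>T\<close> is not locally bounded, so the inequality is instead integrated along segments to the
  boundary point and passed to the limit by lower semicontinuity of the potential.\<close>

lemma related_imp_mem_closure:
  fixes T :: "('a::euclidean_space \<times> 'a) set"
  assumes T: "maximal_cyclically_monotone T" "closed T" "S \<subseteq> T"
    and S: "interior (Domain T) \<noteq> {}" "interior (Domain T) \<subseteq> closure (Domain S)"
    and x: "x \<in> closure (Domain T)"
    and xy: "\<And>a b. (a, b) \<in> S \<Longrightarrow> 0 \<le> (x - a) \<bullet> (y - b)"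
  shows "(x, y) \<in> T"
proof -
  obtain D f where Df: "convex_on D f" "closed (epigraph D f)" "T = subgradients D f"
    using maximal_cyclically_monotone_potential[OF T(1)] by metis
  have D: "convex D" using Df(1) by (simp add: convex_on_def)
  have TD: "Domain T \<subseteq> D" using Df(3) by (auto simp: subgradients_def)
  have "interior D \<subseteq> Domain T" using subgradient_exists_interior[OF Df(1)] Df(3) by blast
  then have W: "interior D = interior (Domain T)" using TD by (metis interior_maximal interior_mono open_interior subset_antisym)
  have xD: "x \<in> closure D" using x TD closure_mono by blast
  \<comment> \<open>On the segment from \<open>x\<close> to \<open>w\<close>, relatedness bounds the
    slope of \<open>y\<close> towards \<open>w\<close> by that of a value \<open>c\<close> of
    \<open>T\<close>, hence \<open>f (z t) + (w - z t) \<bullet> y \<le> f w\<close>. Stated as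
    membership in the closed epigraph, the limit at \<open>t = 0\<close> yields both
    \<open>x \<in> D\<close> and the inequality.\<close>
  have step: "x \<in> D \<and> f x + (w - x) \<bullet> y \<le> f w" if w: "w \<in> interior D" for w
  proof -
    define z where "z t = x + t *\<^sub>R (w - x)" for t :: real
    have "(z t, f w - (w - z t) \<bullet> y) \<in> epigraph D f" if t: "0 < t" "t < 1" for t
    proof (cases "w = x")
      case True
      then show ?thesis using w interior_subset by (auto simp: z_def mem_epigraph)
    next
      case False
      have "z t \<in> open_segment x w" using t False by (auto simp: z_def in_segment algebra_simps intro!: exI[of _ t])
      then have zt: "z t \<in> interior D"
        using in_interior_closure_convex_segment[OF D w xD] by (auto simp: open_segment_commute)
      then obtain c where c: "(z t, c) \<in> T" "0 \<le> (x - z t) \<bullet> (y - c)"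
        using related_extend[OF T open_interior S(2) _ xy] W by metis
      have "(w - x) \<bullet> y \<le> (w - x) \<bullet> c"
        using c(2) t(1) by (simp add: z_def inner_diff_right zero_le_mult_iff mult_le_0_iff)
      then have "(1 - t) * ((w - x) \<bullet> y) \<le> (1 - t) * ((w - x) \<bullet> c)" using t by (intro mult_left_mono) auto
      moreover have "w - z t = (1 - t) *\<^sub>R (w - x)" by (simp add: z_def algebra_simps)
      ultimately have "(w - z t) \<bullet> y \<le> (w - z t) \<bullet> c" by simp
      moreover have "f (z t) + (w - z t) \<bullet> c \<le> f w"
        using c(1) w interior_subset Df(3) by (auto simp: subgradients_def)
      ultimately show ?thesis using zt interior_subset by (auto simp: mem_epigraph)
    qed
    then have "\<forall>\<^sub>F t in at_right 0. (z t, f w - (w - z t) \<bullet> y) \<in> epigraph D f"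
      unfolding eventually_at_right_field by (intro exI[of _ 1]) auto
    moreover have "((\<lambda>t. (z t, f w - (w - z t) \<bullet> y)) \<longlongrightarrow> (z 0, f w - (w - z 0) \<bullet> y)) (at_right 0)"
      unfolding z_def by (intro tendsto_intros)
    ultimately have "(z 0, f w - (w - z 0) \<bullet> y) \<in> epigraph D f"
      by (intro Lim_in_closed_set[OF Df(2)]) auto
    then show ?thesis by (auto simp: z_def mem_epigraph)
  qed
  obtain v where v: "v \<in> interior D" using S(1) W by blast
  \<comment> \<open>A general \<open>w\<close> is moved slightly towards the interior point
    \<open>v\<close>; convexity bounds \<open>f\<close> along this segment by its chord.\<close>
  have "f x + (w - x) \<bullet> y \<le> f w" if w: "w \<in> D" for w
  proof -
    define z where "z t = w + t *\<^sub>R (v - w)" for t :: real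
    have ineq: "f x + (z t - x) \<bullet> y \<le> (1 - t) * f w + t * f v" if t: "0 < t" "t < 1" for t
    proof -
      have vD: "v \<in> D" using v interior_subset by blast
      have zc: "z t = (1 - t) *\<^sub>R w + t *\<^sub>R v" by (simp add: z_def algebra_simps)
      have "z t \<in> interior D"
      proof (cases "v = w")
        case True
        then show ?thesis using v by (simp add: z_def)
      next
        case False
        then have "z t \<in> open_segment v w" unfolding open_segment_commute[of v]
          using t by (auto simp: zc in_segment intro!: exI[of _ t])
        then show ?thesis
          using in_interior_closure_convex_segment[OF D v] w closure_subset by blast
      qed
      then have "f x + (z t - x) \<bullet> y \<le> f (z t)" using step by blast
      also have "\<dots> \<le> (1 - t) * f w + t * f v"
        unfolding zc using convex_onD[OF Df(1), of t w v] t w vD by simp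
      finally show ?thesis .
    qed
    have "((\<lambda>t. f x + (z t - x) \<bullet> y) \<longlongrightarrow> f x + (z 0 - x) \<bullet> y) (at_right 0)"
      unfolding z_def by (intro tendsto_intros)
    moreover have "((\<lambda>t. (1 - t) * f w + t * f v) \<longlongrightarrow> (1 - 0) * f w + 0 * f v) (at_right 0)"
      by (intro tendsto_intros)
    moreover have "\<forall>\<^sub>F t in at_right 0. f x + (z t - x) \<bullet> y \<le> (1 - t) * f w + t * f v"
      unfolding eventually_at_right_field using ineq by (intro exI[of _ 1]) auto
    ultimately have "f x + (z 0 - x) \<bullet> y \<le> (1 - 0) * f w + 0 * f v"
      by (intro tendsto_le[OF trivial_limit_at_right_real])
    then show ?thesis by (simp add: z_def)
  qed
  then show ?thesis using step[OF v] Df(3) by (auto simp: subgradients_def)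
qed

text \<open>Negativity of the product persists on a product neighbourhood of the two pairs. Since
  \<open>Tn n\<close> has a pair near \<open>(a, b)\<close>, a pair near \<open>(x, y)\<close> would
  violate its monotonicity.\<close>

lemma eventually_miss_ball:
  fixes x y :: "'a::euclidean_space"
  assumes Tn: "\<And>n. cyclically_monotone (Tn n)"
    and ab: "\<And>e. 0 < e \<Longrightarrow> \<forall>\<^sub>F n in sequentially. \<exists>q\<in>Tn n. dist q (a, b) < e"
    and neg: "(x - a) \<bullet> (y - b) < 0"
  obtains e where "e > 0" "\<forall>\<^sub>F n in sequentially. Tn n \<inter> ball (x, y) e = {}"
proof -
  let ?g = "\<lambda>(p, q). (fst p - fst q) \<bullet> (snd p - snd q)"
  have "open {z :: ('a \<times> 'a) \<times> 'a \<times> 'a. ?g z < 0}"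
    by (intro open_Collect_less) (auto simp: case_prod_unfold intro!: continuous_intros)
  moreover have "((x, y), (a, b)) \<in> {z. ?g z < 0}" using neg by simp
  ultimately obtain A B where "open A" "open B" "((x, y), (a, b)) \<in> A \<times> B" "A \<times> B \<subseteq> {z. ?g z < 0}"
    by (rule open_prod_elim)
  then have AB: "open A" "open B" "(x, y) \<in> A" "(a, b) \<in> B" "A \<times> B \<subseteq> {z. ?g z < 0}" by auto
  obtain e where e: "e > 0" "ball (x, y) e \<subseteq> A" using AB openE by blast
  obtain d where d: "d > 0" "ball (a, b) d \<subseteq> B" using AB openE by blast
  have "\<forall>\<^sub>F n in sequentially. Tn n \<inter> ball (x, y) e = {}"
    using ab[OF d(1)]
  proof eventually_elim
    case (elim n)
    then obtain q where q: "q \<in> Tn n" "q \<in> B" using d(2) by (metis dist_commute mem_ball subsetD)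
    have "\<not> ?g (p, q) < 0" if "p \<in> Tn n" for p
      using cyclically_monotoneD2[OF Tn, of "fst p" "snd p" n "fst q" "snd q"] that q(1) by simp
    then show ?case using q(2) e(2) AB(5) by blast
  qed
  with e(1) show thesis by (rule that)
qed

lemma eventually_miss_compact:
  assumes K: "compact K"
    and miss: "\<And>p. p \<in> K \<Longrightarrow> \<exists>e>0. \<forall>\<^sub>F n in F. A n \<inter> ball p e = {}"
  shows "\<forall>\<^sub>F n in F. A n \<inter> K = {}"
proof -
  obtain e where e: "\<And>p. p \<in> K \<Longrightarrow> e p > 0" "\<And>p. p \<in> K \<Longrightarrow> \<forall>\<^sub>F n in F. A n \<inter> ball p (e p) = {}"
    using miss by metis
  have "K \<subseteq> (\<Union>p\<in>K. ball p (e p))" using e(1) by auto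
  then obtain G where G: "G \<subseteq> K" "finite G" "K \<subseteq> (\<Union>p\<in>G. ball p (e p))"
    using compactE_image[OF K, of K "\<lambda>p. ball p (e p)"] by auto
  have "\<forall>\<^sub>F n in F. \<forall>p\<in>G. A n \<inter> ball p (e p) = {}"
    using G e(2) by (intro eventually_ball_finite) auto
  then show ?thesis by eventually_elim (use G(3) in blast)
qed

lemma eventually_miss_compact_domain:
  fixes T :: "('a::euclidean_space \<times> 'a) set"
  assumes T: "maximal_cyclically_monotone T" "closed T" "S \<subseteq> T"
    and V: "open V" "V \<subseteq> closure (Domain S)"
    and Tn: "\<And>n. cyclically_monotone (Tn n)"
    and S: "\<And>p e. p \<in> S \<Longrightarrow> 0 < e \<Longrightarrow> \<forall>\<^sub>F n in sequentially. \<exists>q\<in>Tn n. dist q p < e"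
    and K: "compact K" "K \<subseteq> V \<times> UNIV" "T \<inter> K = {}"
  shows "\<forall>\<^sub>F n in sequentially. Tn n \<inter> K = {}"
proof (rule eventually_miss_compact[OF K(1)])
  fix p assume p: "p \<in> K"
  obtain x y where xy: "p = (x, y)" by (cases p)
  have "x \<in> V" "(x, y) \<notin> T" using p K xy by auto
  then obtain a b where ab: "(a, b) \<in> S" "(x - a) \<bullet> (y - b) < 0"
    using related_imp_mem[OF T V] not_less by metis
  then show "\<exists>e>0. \<forall>\<^sub>F n in sequentially. Tn n \<inter> ball p e = {}"
    unfolding xy using eventually_miss_ball[OF Tn S[OF ab(1)] ab(2)] by metis
qed

text \<open>The first coordinates are unrestricted, so the roles are exchanged: a value in the
  closed range is handled through the inverse mapping, boundary values included, and near a value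
  outside it \<open>Tn n\<close> eventually has no values at all.\<close>

lemma eventually_miss_compact_range:
  fixes T :: "('a::euclidean_space \<times> 'a) set"
  assumes T: "maximal_cyclically_monotone T" "closed T" "S \<subseteq> T"
    and R: "interior (Range T) \<noteq> {}" "interior (Range T) \<subseteq> closure (Range S)"
    and Tn: "\<And>n. cyclically_monotone (Tn n)"
      "\<forall>\<^sub>F n in sequentially. Range (Tn n) \<subseteq> closure (Range T)"
    and S: "\<And>p e. p \<in> S \<Longrightarrow> 0 < e \<Longrightarrow> \<forall>\<^sub>F n in sequentially. \<exists>q\<in>Tn n. dist q p < e"
    and K: "compact K" "T \<inter> K = {}"
  shows "\<forall>\<^sub>F n in sequentially. Tn n \<inter> K = {}"
proof (rule eventually_miss_compact[OF K(1)])
  fix p assume p: "p \<in> K"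
  obtain x y where xy: "p = (x, y)" by (cases p)
  have nT: "(x, y) \<notin> T" using p K xy by auto
  have conv: "maximal_cyclically_monotone (T\<inverse>)" "closed (T\<inverse>)"
  proof -
    have "T\<inverse> = prod.swap -` T" by auto
    then show "closed (T\<inverse>)" using T(2)
      by (auto intro!: continuous_closed_vimage simp: prod.swap_def intro!: continuous_intros)
  qed (rule maximal_cyclically_monotone_converse[OF T(1)])
  show "\<exists>e>0. \<forall>\<^sub>F n in sequentially. Tn n \<inter> ball p e = {}"
  proof (cases "y \<in> closure (Range T)")
    case True
    have "\<exists>a b. (a, b) \<in> S \<and> (x - a) \<bullet> (y - b) < 0"
    proof (rule ccontr)
      assume n: "\<not> ?thesis"
      have "(y, x) \<in> T\<inverse>"
      proof (rule related_imp_mem_closure[OF conv, of "S\<inverse>"])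
        show "0 \<le> (y - b) \<bullet> (x - a)" if "(b, a) \<in> S\<inverse>" for b a
          using n that by (force simp: inner_commute not_less)
      qed (use T(3) R True in auto)
      then show False using nT by simp
    qed
    then obtain a b where ab: "(a, b) \<in> S" "(x - a) \<bullet> (y - b) < 0" by blast
    then show ?thesis
      unfolding xy using eventually_miss_ball[OF Tn(1) S[OF ab(1)] ab(2)] by metis
  next
    case False
    have "open (- closure (Range T))" "y \<in> - closure (Range T)" using False by auto
    then obtain e where e: "e > 0" "ball y e \<subseteq> - closure (Range T)" by (rule openE)
    have "\<forall>\<^sub>F n in sequentially. Tn n \<inter> ball p e = {}"
      using Tn(2)
    proof eventually_elim
      case (elim n)
      have "q \<notin> ball p e" if "q \<in> Tn n" for q
      proof
        assume "q \<in> ball p e"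
        then have "snd q \<in> ball y e" using dist_snd_le[of p q] by (simp add: xy)
        moreover have "snd q \<in> closure (Range T)" using elim that by (metis Range.intros prod.collapse subsetD)
        ultimately show False using e(2) by blast
      qed
      then show ?case by blast
    qed
    with e(1) show ?thesis by blast
  qed
qed

section \<open>Fell, Hausdorff and uniform convergence\<close>

text \<open>Convergence is tested on the two kinds of generating sets and carried to all open sets
  by induction over the generated topology.\<close>

lemma limitin_fell_topology:
  assumes T: "closedin X T" "\<And>n. closedin X (Tn n)"
    and miss: "\<And>K. compactin X K \<Longrightarrow> T \<inter> K = {} \<Longrightarrow> \<forall>\<^sub>F n in F. Tn n \<inter> K = {}"
    and hit: "\<And>G. openin X G \<Longrightarrow> T \<inter> G \<noteq> {} \<Longrightarrow> \<forall>\<^sub>F n in F. Tn n \<inter> G \<noteq> {}"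
  shows "limitin (fell_topology X) Tn T F"
proof -
  let ?B = "{{F. closedin X F \<and> F \<inter> G \<noteq> {}} | G. openin X G} \<union>
      {{F. closedin X F \<and> F \<inter> K = {}} | K. compactin X K}"
  have "T \<in> U \<longrightarrow> (\<forall>\<^sub>F n in F. Tn n \<in> U)" if "generate_topology_on ?B U" for U
    using that
  proof induction
    case (Int a b)
    then show ?case by (auto intro: eventually_conj)
  next
    case (UN K)
    show ?case
    proof
      assume "T \<in> \<Union>K"
      then obtain k where k: "k \<in> K" "T \<in> k" by blast
      then have "\<forall>\<^sub>F n in F. Tn n \<in> k" using UN by blast
      then show "\<forall>\<^sub>F n in F. Tn n \<in> \<Union>K" by eventually_elim (use k in blast)
    qed
  next
    case (Basis s)
    then show ?case
    proof
      assume "s \<in> {{F. closedin X F \<and> F \<inter> G \<noteq> {}} | G. openin X G}"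
      then obtain G where G: "openin X G" "s = {F. closedin X F \<and> F \<inter> G \<noteq> {}}" by blast
      then show ?thesis using hit[OF G(1)] T(2) by simp
    next
      assume "s \<in> {{F. closedin X F \<and> F \<inter> K = {}} | K. compactin X K}"
      then obtain K where K: "compactin X K" "s = {F. closedin X F \<and> F \<inter> K = {}}" by blast
      then show ?thesis using miss[OF K(1)] T(2) by simp
    qed
  qed simp
  then have lim: "generate_topology_on ?B U \<Longrightarrow> T \<in> U \<Longrightarrow> \<forall>\<^sub>F n in F. Tn n \<in> U" for U
    by simp
  show ?thesis
    unfolding limitin_def topspace_fell_topology
  proof (intro conjI allI impI)
    fix U assume "openin (fell_topology X) U \<and> T \<in> U"
    then show "\<forall>\<^sub>F n in F. Tn n \<in> U"
      unfolding fell_topology_def openin_topology_generated_by_iff by (elim conjE lim)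
  qed (simp add: T(1))
qed

section \<open>Uniform and Hausdorff convergence\<close>

lemma tendsto_ennreal_0I:
  fixes f :: "'b \<Rightarrow> ennreal"
  assumes "\<And>e. 0 < e \<Longrightarrow> \<forall>\<^sub>F n in F. f n \<le> ennreal e"
  shows "(f \<longlongrightarrow> 0) F"
proof (rule order_tendstoI)
  fix a :: ennreal assume "0 < a"
  then obtain c where c: "0 < c" "c < a" using dense by blast
  then obtain e where e: "c = ennreal e" "0 \<le> e" by (cases c) auto
  then have "0 < e" using c by (auto simp: ennreal_less_zero_iff)
  from assms[OF this] show "\<forall>\<^sub>F n in F. f n < a"
    by eventually_elim (use c e in auto)
qed auto

lemma SUP_norm_tendsto_0I:
  fixes B :: "nat \<Rightarrow> 'a \<Rightarrow> 'b::real_normed_vector set"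
  assumes "\<And>e. 0 < e \<Longrightarrow> \<forall>\<^sub>F n in sequentially. \<forall>x\<in>A. \<forall>y\<in>B n x. norm (y - g x) < e"
  shows "(\<lambda>n. SUP x\<in>A. SUP y\<in>B n x. ennreal (norm (y - g x))) \<longlonglongrightarrow> 0"
proof (rule tendsto_ennreal_0I)
  fix e :: real assume "0 < e"
  from assms[OF this]
  show "\<forall>\<^sub>F n in sequentially. (SUP x\<in>A. SUP y\<in>B n x. ennreal (norm (y - g x))) \<le> ennreal e"
  proof eventually_elim
    case (elim n)
    then show ?case by (intro SUP_least ennreal_leI less_imp_le) blast
  qed
qed

lemma single_valued_atD:
  assumes "single_valued_at T x"
  shows "T `` {x} = {the_elem (T `` {x})}" and "(x, y) \<in> T \<longleftrightarrow> y = the_elem (T `` {x})"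
proof -
  obtain t where t: "T `` {x} = {t}"
    using assms unfolding single_valued_at_def by (auto elim!: is_singletonE)
  then show "T `` {x} = {the_elem (T `` {x})}" by simp
  have "(x, y) \<in> T \<longleftrightarrow> y \<in> T `` {x}" by blast
  then show "(x, y) \<in> T \<longleftrightarrow> y = the_elem (T `` {x})" by (simp add: t)
qed

lemma compact_Image:
  fixes T :: "('a::euclidean_space \<times> 'a) set"
  assumes "closed T" "compact K" "bounded (T `` K)"
  shows "compact (T `` K)"
proof -
  obtain M where M: "T `` K \<subseteq> cball 0 M" using assms(3) by (auto simp: bounded_iff subset_eq)
  have "T `` K = snd ` (T \<inter> K \<times> cball 0 M)" using M by force
  moreover have "compact (T \<inter> K \<times> cball 0 M)"
    using assms by (intro closed_Int_compact compact_Times) auto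
  ultimately show ?thesis by (auto intro!: compact_continuous_image continuous_intros)
qed

text \<open>Closed graph and bounded values make the selection of \<open>T\<close> continuous on
  \<open>K\<close>. The pairs over \<open>K\<close> with bounded value at distance at least
  \<open>e\<close> from the selection thus form a compact set that misses \<open>T\<close>.\<close>

lemma uniform_convergence_on_compact:
  fixes T :: "('a::euclidean_space \<times> 'a) set"
  assumes T: "closed T" "bounded (T `` K)"
    and K: "compact K" "K \<subseteq> V" "\<And>x. x \<in> K \<Longrightarrow> single_valued_at T x"
    and upper: "\<And>K. compact K \<Longrightarrow> K \<subseteq> V \<times> UNIV \<Longrightarrow> T \<inter> K = {} \<Longrightarrow> \<forall>\<^sub>F n in sequentially. Tn n \<inter> K = {}"
    and bd: "\<forall>\<^sub>F n in sequentially. Tn n `` K \<subseteq> cball 0 M"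
    and e: "e > 0"
  shows "\<forall>\<^sub>F n in sequentially. \<forall>x\<in>K. \<forall>y\<in>Tn n `` {x}. norm (y - the_elem (T `` {x})) < e"
proof -
  let ?\<tau> = "\<lambda>x. the_elem (T `` {x})"
  obtain M' where M': "T `` K \<subseteq> cball 0 M'" using T(2) by (auto simp: bounded_iff subset_eq)
  have mem: "(x, ?\<tau> x) \<in> T" if "x \<in> K" for x using single_valued_atD(2)[OF K(3)[OF that]] by simp
  have "continuous_on K ?\<tau>"
  proof (rule continuous_from_closed_graph[OF compact_cball])
    show "?\<tau> \<in> K \<rightarrow> cball 0 M'" using mem M' by blast
    have "(\<lambda>x. (x, ?\<tau> x)) ` K = T \<inter> K \<times> UNIV" using single_valued_atD(2)[OF K(3)] by auto
    moreover have "closed (T \<inter> K \<times> UNIV)"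
      by (intro closed_Int closed_Times closed_UNIV T(1) compact_imp_closed[OF K(1)])
    ultimately show "closed ((\<lambda>x. (x, ?\<tau> x)) ` K)" by simp
  qed
  then have "continuous_on (K \<times> cball 0 M) (\<lambda>p. ?\<tau> (fst p))"
    by (rule continuous_on_compose2) (auto intro: continuous_intros)
  then have cont: "continuous_on (K \<times> cball 0 M) (\<lambda>p. norm (snd p - ?\<tau> (fst p)))"
    by (intro continuous_on_norm continuous_on_diff continuous_on_snd continuous_on_id)
  define C where "C = {p \<in> K \<times> cball 0 M. e \<le> norm (snd p - ?\<tau> (fst p))}"
  have KM: "compact (K \<times> cball (0::'a) M)" using K(1) by (intro compact_Times compact_cball)
  have "closed C" unfolding C_def
    by (intro continuous_on_closed_Collect_le[OF continuous_on_const cont] compact_imp_closed KM)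
  moreover have C: "C = K \<times> cball 0 M \<inter> C" by (auto simp: C_def)
  ultimately have "compact C" using compact_Int_closed[OF KM] by metis
  moreover have "C \<subseteq> V \<times> UNIV" using K(2) by (auto simp: C_def)
  moreover have "T \<inter> C = {}" using single_valued_atD(2)[OF K(3)] e by (auto simp: C_def)
  ultimately have "\<forall>\<^sub>F n in sequentially. Tn n \<inter> C = {}" by (rule upper)
  with bd show ?thesis
  proof eventually_elim
    case (elim n)
    show ?case
    proof (intro ballI, rule ccontr)
      fix x y assume "x \<in> K" "y \<in> Tn n `` {x}" "\<not> norm (y - ?\<tau> x) < e"
      then have "(x, y) \<in> Tn n \<inter> C" using elim(1) by (auto simp: C_def)
      then show False using elim(2) by blast
    qed
  qed
qed

text \<open>One half excludes the compact set of pairs over \<open>K\<close> whose value is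
  \<open>e\<close>-far from \<open>T(K)\<close>; the other approximates a finite
  \<open>e / 2\<close>-net of the compact set \<open>T(K)\<close>.\<close>

lemma hausdorff_edist_tendsto_0:
  fixes T :: "('a::euclidean_space \<times> 'a) set"
  assumes T: "closed T" "bounded (T `` K)"
    and K: "compact K" "K \<subseteq> V"
    and upper: "\<And>K. compact K \<Longrightarrow> K \<subseteq> V \<times> UNIV \<Longrightarrow> T \<inter> K = {} \<Longrightarrow> \<forall>\<^sub>F n in sequentially. Tn n \<inter> K = {}"
    and bd: "\<forall>\<^sub>F n in sequentially. Tn n `` K \<subseteq> cball 0 M"
    and lower: "\<And>y e. y \<in> T `` K \<Longrightarrow> 0 < e \<Longrightarrow> \<forall>\<^sub>F n in sequentially. \<exists>w\<in>Tn n `` K. dist w y < e"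
  shows "(\<lambda>n. hausdorff_edist (Tn n `` K) (T `` K)) \<longlonglongrightarrow> 0"
proof (rule tendsto_ennreal_0I)
  fix e :: real assume e: "0 < e"
  define C where "C = K \<times> (cball 0 M - (\<Union>y\<in>T `` K. ball y e))"
  have "compact C" unfolding C_def using K(1) by (intro compact_Times compact_diff) auto
  moreover have "C \<subseteq> V \<times> UNIV" using K(2) by (auto simp: C_def)
  moreover have "T \<inter> C = {}" using e by (force simp: C_def)
  ultimately have 1: "\<forall>\<^sub>F n in sequentially. Tn n \<inter> C = {}" by (rule upper)
  have "compact (T `` K)" by (rule compact_Image[OF T(1) K(1) T(2)])
  moreover have "T `` K \<subseteq> (\<Union>y\<in>T `` K. ball y (e / 2))" using e by auto
  ultimately obtain G where G: "G \<subseteq> T `` K" "finite G" "T `` K \<subseteq> (\<Union>y\<in>G. ball y (e / 2))"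
    using compactE_image[of "T `` K" "T `` K" "\<lambda>y. ball y (e / 2)"] by auto
  have 2: "\<forall>\<^sub>F n in sequentially. \<forall>y\<in>G. \<exists>w\<in>Tn n `` K. dist w y < e / 2"
    using G e by (intro eventually_ball_finite ballI lower) auto
  have edist: "edist_set a B \<le> ennreal e" if "b \<in> B" "dist a b < e" for a :: 'a and b B
    unfolding edist_set_def using that by (intro INF_lower2[of b]) (auto intro!: ennreal_leI)
  show "\<forall>\<^sub>F n in sequentially. hausdorff_edist (Tn n `` K) (T `` K) \<le> ennreal e"
    using 1 2 bd
  proof eventually_elim
    case (elim n)
    have "edist_set w (T `` K) \<le> ennreal e" if w: "w \<in> Tn n `` K" for w
    proof -
      obtain x where x: "x \<in> K" "(x, w) \<in> Tn n" using w by blast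
      moreover have "w \<in> cball 0 M" using w elim(3) by blast
      ultimately obtain y where "y \<in> T `` K" "w \<in> ball y e" using elim(1) unfolding C_def by blast
      then show ?thesis by (intro edist) (auto simp: dist_commute)
    qed
    moreover have "edist_set y (Tn n `` K) \<le> ennreal e" if y: "y \<in> T `` K" for y
    proof -
      obtain z where z: "z \<in> G" "dist z y < e / 2" using y G(3) by auto
      obtain w where w: "w \<in> Tn n `` K" "dist w z < e / 2" using elim(2) z(1) by blast
      have "dist y w < e" using z(2) w(2) dist_triangle_half_r[of z y e w] by (simp add: dist_commute)
      then show ?thesis using w(1) by (intro edist)
    qed
    ultimately show ?case unfolding hausdorff_edist_def by (auto intro!: SUP_least)
  qed
qed

text \<open>Monotonicity against an approximant of \<open>(a, b)\<close>, divided by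
  \<open>norm (x k)\<close>, loses the contribution of \<open>a\<close> in the limit and leaves
  \<open>0 \<le> u \<bullet> (c - b)\<close>. Limits of values along a receding sequence thus
  maximise the direction \<open>u\<close>.\<close>

lemma recession_limit_is_maximal:
  fixes M :: "nat \<Rightarrow> ('a::euclidean_space \<times> 'a) set"
  assumes M: "\<And>k. cyclically_monotone (M k)"
    and xy: "\<And>k. (x k, y k) \<in> M k"
    and x: "filterlim (\<lambda>k. norm (x k)) at_top sequentially" "(\<lambda>k. x k /\<^sub>R norm (x k)) \<longlonglongrightarrow> u"
    and y: "y \<longlonglongrightarrow> c"
    and ab: "\<And>e. 0 < e \<Longrightarrow> \<forall>\<^sub>F k in sequentially. \<exists>q\<in>M k. dist q (a, b) < e"
  shows "b \<bullet> u \<le> c \<bullet> u"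
proof (rule field_le_epsilon)
  fix e :: real assume e: "0 < e"
  \<comment> \<open>The bound \<open>e\<close> controls the error from \<open>b'\<close> against a
    unit vector, the bound 1 keeps \<open>a'\<close> and \<open>b'\<close> within distance 1 of
    \<open>a\<close> and \<open>b\<close>.\<close>
  define d where "d = min e 1"
  have d: "0 < d" "d \<le> e" "d \<le> 1" using e by (auto simp: d_def)
  let ?g = "\<lambda>k. (x k /\<^sub>R norm (x k)) \<bullet> (y k - b) + e + (norm a + 1) * (norm (y k) + norm b + 1) * inverse (norm (x k))"
  have "\<forall>\<^sub>F k in sequentially. norm (x k) > 0" using x(1) by (rule filterlim_at_top_dense[THEN iffD1, rule_format])
  with ab[OF d(1)] have "\<forall>\<^sub>F k in sequentially. 0 \<le> ?g k"
  proof eventually_elim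
    case (elim k)
    then obtain a' b' where q: "(a', b') \<in> M k" "dist (a', b') (a, b) < d" by auto
    have da: "norm (a' - a) < d" "norm (b' - b) < d"
      using q(2) dist_fst_le[of "(a', b')" "(a, b)"] dist_snd_le[of "(a', b')" "(a, b)"] by (auto simp: dist_norm)
    let ?i = "inverse (norm (x k))"
    have "0 \<le> (x k - a') \<bullet> (y k - b')" by (rule cyclically_monotoneD2[OF M xy q(1)])
    then have "0 \<le> ?i * ((x k - a') \<bullet> (y k - b'))" by (intro mult_nonneg_nonneg) auto
    then have "0 \<le> (x k /\<^sub>R norm (x k)) \<bullet> (y k - b') - ?i * (a' \<bullet> (y k - b'))"
      by (simp add: inner_diff_left right_diff_distrib)
    moreover have "(x k /\<^sub>R norm (x k)) \<bullet> (y k - b') \<le> (x k /\<^sub>R norm (x k)) \<bullet> (y k - b) + e"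
    proof -
      have "(x k /\<^sub>R norm (x k)) \<bullet> (b - b') \<le> norm (x k /\<^sub>R norm (x k)) * norm (b - b')" by (rule norm_cauchy_schwarz)
      also have "\<dots> \<le> e" using elim(2) da(2) d(2) by (simp add: norm_minus_commute)
      finally show ?thesis by (simp add: inner_diff_right)
    qed
    moreover have "- (?i * (a' \<bullet> (y k - b'))) \<le> (norm a + 1) * (norm (y k) + norm b + 1) * ?i"
    proof -
      have "- (a' \<bullet> (y k - b')) \<le> norm a' * norm (y k - b')"
        using norm_cauchy_schwarz[of "- a'" "y k - b'"] by simp
      also have "\<dots> \<le> (norm a + 1) * (norm (y k) + norm b + 1)"
      proof (rule mult_mono)
        show "norm a' \<le> norm a + 1" using da(1) d(3) norm_triangle_sub[of a' a] by linarith
        have "norm b' \<le> norm b + 1" using da(2) d(3) norm_triangle_sub[of b' b] by linarith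
        then show "norm (y k - b') \<le> norm (y k) + norm b + 1" using norm_triangle_ineq4[of "y k" b'] by linarith
      qed (auto simp: add_nonneg_nonneg)
      finally have "- (a' \<bullet> (y k - b')) * ?i \<le> (norm a + 1) * (norm (y k) + norm b + 1) * ?i"
        by (intro mult_right_mono) auto
      then show ?thesis by (simp add: mult.commute)
    qed
    ultimately show ?case by linarith
  qed
  moreover have "(\<lambda>k. inverse (norm (x k))) \<longlonglongrightarrow> 0"
    using x(1) by (rule tendsto_inverse_0_at_top)
  then have "?g \<longlonglongrightarrow> u \<bullet> (c - b) + e + (norm a + 1) * (norm c + norm b + 1) * 0"
    by (intro tendsto_intros x(2) y)
  ultimately have "0 \<le> u \<bullet> (c - b) + e + (norm a + 1) * (norm c + norm b + 1) * 0"
    by (intro tendsto_lowerbound) auto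
  then show "b \<bullet> u \<le> c \<bullet> u + e" by (simp add: inner_diff_right inner_commute)
qed

text \<open>Counterexamples escaping to infinity recede, along a subsequence, in some direction
  \<open>u\<close>. The limits of their values under \<open>Tn\<close> and under \<open>T\<close>
  both maximise \<open>u\<close> over the closed range, so strict convexity identifies them although
  they stay at least \<open>e\<close> apart.\<close>

lemma uniform_convergence_at_infinity:
  fixes T :: "('a::euclidean_space \<times> 'a) set"
  assumes T: "cyclically_monotone T" "bounded (Range T)"
    and Tn: "\<And>n. cyclically_monotone (Tn n)"
      "\<forall>\<^sub>F n in sequentially. Range (Tn n) \<subseteq> closure (Range T)"
    and approx: "\<And>p e. p \<in> T \<Longrightarrow> 0 < e \<Longrightarrow> \<forall>\<^sub>F n in sequentially. \<exists>q\<in>Tn n. dist q p < e"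
    and E: "\<And>x. x \<in> E \<Longrightarrow> single_valued_at T x"
      "\<And>u. recedes_in_direction E u \<Longrightarrow> strictly_convex_in_direction (closure (Range T)) u"
    and e: "e > 0"
  obtains R where "\<forall>\<^sub>F n in sequentially. \<forall>x\<in>E. R \<le> norm x \<longrightarrow>
    (\<forall>y\<in>Tn n `` {x}. norm (y - the_elem (T `` {x})) < e)"
proof (rule ccontr)
  let ?\<tau> = "\<lambda>x. the_elem (T `` {x})" and ?C = "closure (Range T)"
  assume "\<not> thesis"
  then have neg: "\<not> (\<forall>\<^sub>F n in sequentially. \<forall>x\<in>E. R \<le> norm x \<longrightarrow> (\<forall>y\<in>Tn n `` {x}. norm (y - ?\<tau> x) < e))" for R
    using that by blast
  obtain N where N: "\<And>n. n \<ge> N \<Longrightarrow> Range (Tn n) \<subseteq> ?C" using Tn(2) by (auto simp: eventually_sequentially)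
  \<comment> \<open>The offset \<open>N\<close> brings the range inclusion into force, and
    \<open>real k + 1\<close> keeps the points away from 0, where normalisation would fail.\<close>
  have "\<exists>n x y. k + N \<le> n \<and> x \<in> E \<and> real k + 1 \<le> norm x \<and> (x, y) \<in> Tn n \<and> e \<le> norm (y - ?\<tau> x)" for k
  proof -
    have "\<exists>n\<ge>k + N. \<not> (\<forall>x\<in>E. real k + 1 \<le> norm x \<longrightarrow> (\<forall>y\<in>Tn n `` {x}. norm (y - ?\<tau> x) < e))"
      using neg[of "real k + 1"] unfolding eventually_sequentially by blast
    then show ?thesis unfolding not_less[symmetric] by blast
  qed
  then obtain n x y where nxy: "\<And>k. k + N \<le> n k" "\<And>k. x k \<in> E" "\<And>k. real k + 1 \<le> norm (x k)"
    "\<And>k. (x k, y k) \<in> Tn (n k)" "\<And>k. e \<le> norm (y k - ?\<tau> (x k))"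
    by metis
  have \<tau>T: "(x k, ?\<tau> (x k)) \<in> T" for k using single_valued_atD(2)[OF E(1)[OF nxy(2)]] by simp
  have "compact ?C" using T(2) by (simp add: compact_closure)
  then have "seq_compact (cball (0::'a) 1 \<times> ?C \<times> ?C)"
    unfolding compact_eq_seq_compact_metric[symmetric] by (intro compact_Times compact_cball)
  moreover have "(x k /\<^sub>R norm (x k), y k, ?\<tau> (x k)) \<in> cball 0 1 \<times> ?C \<times> ?C" for k
  proof -
    have "N \<le> n k" using nxy(1)[of k] by simp
    then have "y k \<in> ?C" using N Range.intros[OF nxy(4)[of k]] by (meson subsetD)
    moreover have "?\<tau> (x k) \<in> ?C" by (intro subsetD[OF closure_subset] Range.intros[OF \<tau>T])
    moreover have "norm (x k /\<^sub>R norm (x k)) \<le> 1" by (cases "x k = 0") auto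
    ultimately show ?thesis by (simp only: mem_Times_iff fst_conv snd_conv mem_cball_0)
  qed
  ultimately obtain l r where l: "l \<in> cball 0 1 \<times> ?C \<times> ?C" "strict_mono (r :: nat \<Rightarrow> nat)"
    "((\<lambda>k. (x k /\<^sub>R norm (x k), y k, ?\<tau> (x k))) \<circ> r) \<longlonglongrightarrow> l"
    using seq_compactE[of _ "\<lambda>k. (x k /\<^sub>R norm (x k), y k, ?\<tau> (x k))"] by (metis (no_types, lifting))
  obtain u c c' where ucc: "l = (u, c, c')" by (cases l)
  have lim: "(\<lambda>k. x (r k) /\<^sub>R norm (x (r k))) \<longlonglongrightarrow> u" "(\<lambda>k. y (r k)) \<longlonglongrightarrow> c" "(\<lambda>k. ?\<tau> (x (r k))) \<longlonglongrightarrow> c'"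
    using tendsto_fst[OF l(3)] tendsto_fst[OF tendsto_snd[OF l(3)]] tendsto_snd[OF tendsto_snd[OF l(3)]]
    unfolding ucc o_def fst_conv snd_conv .
  have nr: "k \<le> n (r k)" "real k \<le> norm (x (r k))" for k
    using nxy(1)[of "r k"] nxy(3)[of "r k"] seq_suble[OF l(2), of k] by linarith+
  have x_top: "filterlim (\<lambda>k. norm (x (r k))) at_top sequentially"
    using nr(2) by (intro filterlim_at_top_mono[OF filterlim_real_sequentially]) auto
  have n_top: "filterlim (\<lambda>k. n (r k)) at_top sequentially"
    using nr(1) by (intro filterlim_at_top_mono[OF filterlim_ident]) auto
  have "(\<lambda>k. norm (x (r k) /\<^sub>R norm (x (r k)))) \<longlonglongrightarrow> norm u" using lim(1) by (rule tendsto_norm)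
  moreover have "norm (x (r k) /\<^sub>R norm (x (r k))) = 1" for k
  proof -
    have "norm (x (r k)) \<noteq> 0" using nxy(3)[of "r k"] by linarith
    then show ?thesis by simp
  qed
  ultimately have "norm u = 1" by (simp add: LIMSEQ_const_iff)
  then have "recedes_in_direction E u"
    unfolding recedes_in_direction_def using x_top lim(1) nxy(2)
    by (intro conjI exI[of _ "\<lambda>k. x (r k)"]) auto
  then have sc: "strictly_convex_in_direction ?C u" by (rule E(2))
  have closure_le: "d \<bullet> u \<le> s" if "d \<in> ?C" "\<And>b. b \<in> Range T \<Longrightarrow> b \<bullet> u \<le> s" for d s
  proof -
    have "Range T \<subseteq> {b. u \<bullet> b \<le> s}" using that(2) by (auto simp: inner_commute)
    then have "?C \<subseteq> {b. u \<bullet> b \<le> s}" by (intro closure_minimal closed_halfspace_le)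
    then show ?thesis using that(1) by (auto simp: inner_commute)
  qed
  have "b \<bullet> u \<le> c \<bullet> u" if b: "b \<in> Range T" for b
  proof -
    obtain a where a: "(a, b) \<in> T" using b by blast
    have "\<forall>\<^sub>F k in sequentially. \<exists>q\<in>Tn (n (r k)). dist q (a, b) < d" if "0 < d" for d
      using eventually_compose_filterlim[OF approx[OF a that] n_top] .
    then show ?thesis
      using nxy(4) by (intro recession_limit_is_maximal[OF Tn(1) _ x_top lim(1,2)])
  qed
  then have "is_arg_max (\<lambda>c. c \<bullet> u) (\<lambda>c. c \<in> ?C) c"
    using closure_le[of _ "c \<bullet> u"] l(1) by (force simp: is_arg_max_def ucc)
  moreover have "b \<bullet> u \<le> c' \<bullet> u" if b: "b \<in> Range T" for b
  proof -
    obtain a where a: "(a, b) \<in> T" using b by blast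
    \<comment> \<open>For the limit \<open>c'\<close> the same argument runs with the constant
      sequence \<open>T\<close>.\<close>
    have "\<forall>\<^sub>F k in sequentially. \<exists>q\<in>T. dist q (a, b) < d" if "0 < d" for d
      using that a by (intro always_eventually) (auto intro!: bexI[of _ "(a, b)"])
    then show ?thesis
      using \<tau>T by (intro recession_limit_is_maximal[OF T(1) _ x_top lim(1,3)])
  qed
  then have "is_arg_max (\<lambda>c. c \<bullet> u) (\<lambda>c. c \<in> ?C) c'"
    using closure_le[of _ "c' \<bullet> u"] l(1) by (force simp: is_arg_max_def ucc)
  ultimately have "c = c'"
    using sc unfolding strictly_convex_in_direction_def is_singleton_def by (metis mem_Collect_eq singletonD)
  moreover have "(\<lambda>k. norm (y (r k) - ?\<tau> (x (r k)))) \<longlonglongrightarrow> norm (c - c')"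
    using lim by (intro tendsto_intros)
  then have "e \<le> norm (c - c')" by (rule LIMSEQ_le_const) (use nxy(5) in auto)
  ultimately show False using e by simp
qed

section \<open>Weak convergence of couplings\<close>

text \<open>A first non-zero digit at \<open>j\<close> contributes \<open>(1 / 4) ^ j\<close> in
  absolute value and the tail at most a third of that, so the sum is at least
  \<open>(2 / 3) * (1 / 4) ^ j\<close>. In base 2 the tail could cancel the leading digit.\<close>

lemma quaternary_digits_eq_0:
  fixes c :: "nat \<Rightarrow> real"
  assumes c: "\<And>m. c m \<in> {-1, 0, 1}" and sum: "\<bar>\<Sum>m. c m * (1 / 4) ^ m\<bar> < (1 / 2) * (1 / 4) ^ M" and "m \<le> M"
  shows "c m = 0"
proof (rule ccontr)
  assume m: "c m \<noteq> 0"
  define j where "j = (LEAST j. c j \<noteq> 0)"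
  have j: "c j \<noteq> 0" "j \<le> M" "\<And>i. i < j \<Longrightarrow> c i = 0"
  proof -
    show "c j \<noteq> 0" unfolding j_def using m by (rule LeastI)
    have "j \<le> m" unfolding j_def using m by (rule Least_le)
    then show "j \<le> M" using \<open>m \<le> M\<close> by simp
    show "c i = 0" if "i < j" for i using not_less_Least[of i "\<lambda>j. c j \<noteq> 0"] that unfolding j_def by blast
  qed
  have abs: "\<bar>c i\<bar> \<le> 1" for i using c[of i] by auto
  have geo: "summable (\<lambda>m. (1 / 4 :: real) ^ m)" by (rule summable_geometric) auto
  have bound: "norm (c m * (1 / 4) ^ m) \<le> (1 / 4) ^ m" for m
    using abs[of m] by (simp add: abs_mult)
  have summ: "summable (\<lambda>m. c m * (1 / 4) ^ m)"
    by (rule summable_comparison_test'[OF geo]) (use bound in auto)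
  let ?t = "\<Sum>n. c (n + Suc j) * (1 / 4) ^ (n + Suc j)"
  have "(\<Sum>i<Suc j. c i * (1 / 4) ^ i) = c j * (1 / 4) ^ j"
    using j(3) by simp
  then have split: "(\<Sum>m. c m * (1 / 4) ^ m) = ?t + c j * (1 / 4) ^ j"
    using suminf_split_initial_segment[OF summ, of "Suc j"] by simp
  have geoj: "(\<lambda>n. (1 / 4 :: real) ^ (n + Suc j)) sums ((1 / 4) ^ Suc j * (1 / (1 - 1 / 4)))"
    unfolding power_add mult.commute[of _ "(1 / 4) ^ Suc j"] by (intro sums_mult geometric_sums) auto
  have "norm ?t \<le> (\<Sum>n. (1 / 4 :: real) ^ (n + Suc j))"
    using bound sums_summable[OF geoj] by (intro norm_suminf_le) (auto simp del: power_Suc)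
  then have "\<bar>?t\<bar> \<le> (1 / 3) * (1 / 4) ^ j" using sums_unique[OF geoj] by simp
  moreover have "\<bar>c j * (1 / 4) ^ j\<bar> = (1 / 4) ^ j" using j(1) c[of j] by (auto simp: abs_mult)
  ultimately have "(2 / 3) * (1 / 4) ^ j \<le> \<bar>\<Sum>m. c m * (1 / 4) ^ m\<bar>" unfolding split by linarith
  moreover have "(1 / 4 :: real) ^ M \<le> (1 / 4) ^ j" using j(2) by (intro power_decreasing) auto
  moreover have "(0 :: real) < (1 / 4) ^ M" by simp
  ultimately show False using sum by linarith
qed

text \<open>A point is encoded by recording, in the digits of a real number, which balls of a countable family
  contain it. Points with the same leading digits are close, so the decoding is uniformly continuous.
  This reduces compactness of measures to Helly's theorem on the real line.\<close>

lemma bounded_set_real_code: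
  fixes B :: "'a::euclidean_space set"
  assumes "bounded B"
  obtains s :: "'a \<Rightarrow> real" and \<phi> :: "real \<Rightarrow> 'a"
  where "s \<in> borel_measurable borel" "\<And>x. 0 \<le> s x" "\<And>x. s x \<le> 2" "continuous_on UNIV \<phi>" "\<And>x. x \<in> B \<Longrightarrow> \<phi> (s x) = x"
proof -
  have "compact (closure B)" using assms by (simp add: compact_closure)
  then have "\<exists>k. finite k \<and> closure B \<subseteq> (\<Union>c\<in>k. ball c (inverse (real (Suc j))))" for j
    unfolding compact_eq_totally_bounded by (meson inverse_positive_iff_positive of_nat_0_less_iff zero_less_Suc)
  then obtain k where k: "\<And>j. finite (k j)" "\<And>j. closure B \<subseteq> (\<Union>c\<in>k j. ball c (inverse (real (Suc j))))"
    by metis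
  \<comment> \<open>The empty set keeps the family non-empty for empty \<open>B\<close> too, so that
    it can be enumerated.\<close>
  define \<A> where "\<A> = insert {} (\<Union>j. (\<lambda>c. ball c (inverse (real (Suc j)))) ` k j)"
  define A where "A = from_nat_into \<A>"
  have \<A>: "countable \<A>" "\<A> \<noteq> {}" unfolding \<A>_def using k(1) by (auto intro: countable_finite)
  then have rA: "range A = \<A>" unfolding A_def by (simp add: range_from_nat_into)
  have "open (A m)" for m
  proof -
    have "A m \<in> \<A>" using rA by blast
    then show ?thesis by (auto simp: \<A>_def)
  qed
  then have Am[measurable]: "A m \<in> sets borel" for m by simp
  define s where "s x = (\<Sum>m. indicator (A m) x * (1 / 4 :: real) ^ m)" for x
  have geo: "(\<lambda>m. (1 / 4 :: real) ^ m) sums (1 / (1 - 1 / 4))" by (rule geometric_sums) auto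
  have le: "indicator (A m) x * (1 / 4 :: real) ^ m \<le> (1 / 4) ^ m" for m x by (auto simp: indicator_def)
  have summ: "summable (\<lambda>m. indicator (A m) x * (1 / 4 :: real) ^ m)" for x
    by (rule summable_comparison_test'[OF sums_summable[OF geo]]) (auto simp: indicator_def)
  have meas: "s \<in> borel_measurable borel" unfolding s_def by measurable
  have s0: "0 \<le> s x" for x unfolding s_def by (intro suminf_nonneg summ) auto
  have s2: "s x \<le> 2" for x
    unfolding s_def using suminf_le[OF le summ sums_summable[OF geo], of x] sums_unique[OF geo] by simp
  \<comment> \<open>Finitely many balls of radius below \<open>e / 2\<close> cover \<open>B\<close>,
    with indices at most \<open>N\<close>. Codes that agree up to digit \<open>N\<close> put both
    points in a common ball.\<close>
  have close: "\<exists>d>0. \<forall>x\<in>B. \<forall>y\<in>B. \<bar>s x - s y\<bar> < d \<longrightarrow> dist x y < e" if e: "e > 0" for e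
  proof -
    obtain j where j: "inverse (real (Suc j)) < e / 2" using reals_Archimedean[of "e / 2"] e by auto
    have "\<exists>m. A m = ball c (inverse (real (Suc j)))" if "c \<in> k j" for c
    proof -
      have "ball c (inverse (real (Suc j))) \<in> \<A>" using that unfolding \<A>_def by blast
      then show ?thesis using rA by (metis imageE)
    qed
    then obtain i where i: "\<And>c. c \<in> k j \<Longrightarrow> A (i c) = ball c (inverse (real (Suc j)))" by metis
    define N where "N = Max (insert 0 (i ` k j))"
    have N: "i c \<le> N" if "c \<in> k j" for c unfolding N_def using k(1) that by (intro Max_ge) auto
    have "dist x y < e" if xy: "x \<in> B" "y \<in> B" "\<bar>s x - s y\<bar> < (1 / 2) * (1 / 4) ^ N" for x y
    proof -
      obtain c where c: "c \<in> k j" "x \<in> ball c (inverse (real (Suc j)))"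
        using k(2)[of j] xy(1) closure_subset by blast
      have "s x - s y = (\<Sum>m. (indicator (A m) x - indicator (A m) y) * (1 / 4) ^ m)"
        unfolding s_def using suminf_diff[OF summ summ, of x y] by (simp add: left_diff_distrib)
      then have "indicator (A (i c)) x - indicator (A (i c)) y = (0 :: real)"
        using xy(3) N[OF c(1)]
        by (intro quaternary_digits_eq_0[of "\<lambda>m. indicator (A m) x - indicator (A m) y" N]) (auto simp: indicator_def)
      then have "y \<in> A (i c)" using c by (auto simp: i indicator_def split: if_splits)
      then have "dist c y < e / 2" "dist c x < e / 2" using c j i by auto
      then show ?thesis using dist_triangle_half_r by blast
    qed
    then show ?thesis by (intro exI[of _ "(1 / 2) * (1 / 4) ^ N"]) auto
  qed
  have inj: "inj_on s B"
  proof (rule inj_onI, rule ccontr)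
    fix x y assume xy: "x \<in> B" "y \<in> B" "s x = s y" "x \<noteq> y"
    then obtain d where "d > 0" "\<forall>x'\<in>B. \<forall>y'\<in>B. \<bar>s x' - s y'\<bar> < d \<longrightarrow> dist x' y' < dist x y"
      using close[of "dist x y"] by auto
    then show False using xy by force
  qed
  have "uniformly_continuous_on (s ` B) (inv_into B s)"
    unfolding uniformly_continuous_on_def
  proof (intro allI impI)
    fix e :: real assume "e > 0"
    then obtain d where d: "d > 0" "\<And>x y. x \<in> B \<Longrightarrow> y \<in> B \<Longrightarrow> \<bar>s x - s y\<bar> < d \<Longrightarrow> dist x y < e"
      using close by metis
    then show "\<exists>d>0. \<forall>t\<in>s ` B. \<forall>t'\<in>s ` B. dist t' t < d \<longrightarrow> dist (inv_into B s t') (inv_into B s t) < e"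
      using inj by (intro exI[of _ d]) (auto simp: dist_real_def)
  qed
  then obtain g where g: "uniformly_continuous_on (closure (s ` B)) g" "\<And>t. t \<in> s ` B \<Longrightarrow> inv_into B s t = g t"
    by (rule uniformly_continuous_on_extension_on_closure) blast
  obtain \<phi> where \<phi>: "continuous_on UNIV \<phi>" "\<And>t. t \<in> closure (s ` B) \<Longrightarrow> \<phi> t = g t"
    using Tietze_unbounded[OF uniformly_continuous_imp_continuous[OF g(1)], of UNIV] by auto
  have "\<phi> (s x) = x" if "x \<in> B" for x
  proof -
    have "s x \<in> s ` B" using that by blast
    then have "\<phi> (s x) = inv_into B s (s x)" using \<phi>(2) g(2) closure_subset by (metis subsetD)
    then show ?thesis using inj that by simp
  qed
  with meas s0 s2 \<phi>(1) show thesis by (rule that)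
qed

text \<open>A continuous function between the indicators of the balls of radius \<open>R\<close> and
  \<open>R + 1\<close>. It lets the mass of balls pass through weak limits and truncates test
  functions to bounded support.\<close>

definition cutoff :: "real \<Rightarrow> 'a::real_normed_vector \<Rightarrow> real" where
  "cutoff R x = max 0 (min 1 (R + 1 - norm x))"

lemma cutoff_bounds: "0 \<le> cutoff R x" "cutoff R x \<le> 1"
  by (auto simp: cutoff_def)

lemma cutoff_eq_1: "norm x \<le> R \<Longrightarrow> cutoff R x = 1"
  by (auto simp: cutoff_def)

lemma cutoff_eq_0: "R + 1 \<le> norm x \<Longrightarrow> cutoff R x = 0"
  by (auto simp: cutoff_def)

lemma abs_cutoff_le_1 [simp]: "\<bar>cutoff R x\<bar> \<le> 1"
  using cutoff_bounds[of R x] by simp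

lemma continuous_on_cutoff [continuous_intros]: "continuous_on S (cutoff R)"
  unfolding cutoff_def by (intro continuous_intros)

section \<open>Tightness and weak compactness\<close>

lemma borel_prob_measureD:
  assumes "borel_prob_measure M"
  shows "prob_space M" "sets M = sets borel" "space M = UNIV"
  using assms sets_eq_imp_space_eq[of M borel] by (auto simp: borel_prob_measure_def)

lemma integrable_bounded_continuous:
  fixes f :: "'a::topological_space \<Rightarrow> real"
  assumes "borel_prob_measure M" "continuous_on UNIV f" "\<And>x. \<bar>f x\<bar> \<le> B"
  shows "integrable M f"
proof -
  interpret prob_space M using assms by (simp add: borel_prob_measureD)
  have "f \<in> borel_measurable M"
    using borel_measurable_continuous_onI[OF assms(2)] borel_prob_measureD(2)[OF assms(1)] measurable_cong_sets by blast
  then show ?thesis using assms(3) by (intro integrable_const_bound[of _ B]) auto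
qed

lemma cutoff_integrable:
  assumes "borel_prob_measure M"
  shows "integrable M (cutoff R)"
  using cutoff_bounds[of R] by (intro integrable_bounded_continuous[OF assms, of _ 1] continuous_intros) simp

lemma measure_le_integral_cutoff:
  fixes M :: "'a::euclidean_space measure"
  assumes M: "borel_prob_measure M"
  shows "measure M (cball 0 R) \<le> integral\<^sup>L M (cutoff R)"
proof -
  interpret prob_space M using M by (simp add: borel_prob_measureD)
  have "cball 0 R \<in> sets M" using borel_prob_measureD(2)[OF M] by simp
  then have "measure M (cball 0 R) = integral\<^sup>L M (indicator (cball 0 R))" by simp
  also have "\<dots> \<le> integral\<^sup>L M (cutoff R)"
  proof (intro integral_mono cutoff_integrable M)
    show "indicator (cball 0 R) x \<le> cutoff R x" for x :: 'a
      using cutoff_bounds(1)[of R x] cutoff_eq_1[of x R] by (auto simp: indicator_def)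
  qed (use \<open>cball 0 R \<in> sets M\<close> emeasure_finite in \<open>auto simp: less_top[symmetric]\<close>)
  finally show ?thesis .
qed

lemma integral_cutoff_le_measure:
  fixes M :: "'a::euclidean_space measure"
  assumes M: "borel_prob_measure M"
  shows "integral\<^sup>L M (cutoff R) \<le> measure M (cball 0 (R + 1))"
proof -
  interpret prob_space M using M by (simp add: borel_prob_measureD)
  have S: "cball 0 (R + 1) \<in> sets M" using borel_prob_measureD(2)[OF M] by simp
  have "integral\<^sup>L M (cutoff R) \<le> integral\<^sup>L M (indicator (cball 0 (R + 1)))"
  proof (intro integral_mono cutoff_integrable M)
    show "cutoff R x \<le> indicator (cball 0 (R + 1)) x" for x :: 'a
      using cutoff_bounds(2)[of R x] cutoff_eq_0[of R x] by (auto simp: indicator_def)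
  qed (use S emeasure_finite in \<open>auto simp: less_top[symmetric]\<close>)
  also have "\<dots> = measure M (cball 0 (R + 1))" using S by simp
  finally show ?thesis .
qed

lemma integral_minus_cutoff_bound:
  fixes M :: "'a::euclidean_space measure" and f :: "'a \<Rightarrow> real"
  assumes M: "borel_prob_measure M" and f: "continuous_on UNIV f" "\<And>x. \<bar>f x\<bar> \<le> B"
    and e: "1 - e \<le> integral\<^sup>L M (cutoff R)"
  shows "\<bar>integral\<^sup>L M f - (\<integral>x. f x * cutoff R x \<partial>M)\<bar> \<le> B * e"
proof -
  interpret prob_space M using M by (simp add: borel_prob_measureD)
  have B: "0 \<le> B" using f(2)[of 0] by linarith
  have int: "integrable M f" "integrable M (cutoff R)"
    by (rule integrable_bounded_continuous[OF M f], rule cutoff_integrable[OF M])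
  have bd: "\<bar>f x * cutoff R x\<bar> \<le> B" for x
    using mult_mono[OF f(2)[of x], of "cutoff R x" 1] cutoff_bounds[of R x] B by (simp add: abs_mult)
  then have int2: "integrable M (\<lambda>x. f x * cutoff R x)"
    by (intro integrable_bounded_continuous[OF M] continuous_intros f)
  have "\<bar>integral\<^sup>L M f - (\<integral>x. f x * cutoff R x \<partial>M)\<bar> = \<bar>\<integral>x. f x - f x * cutoff R x \<partial>M\<bar>"
    using int int2 by simp
  also have "\<dots> \<le> (\<integral>x. \<bar>f x - f x * cutoff R x\<bar> \<partial>M)"
    using integral_norm_bound[of M "\<lambda>x. f x - f x * cutoff R x"] by simp
  also have "\<dots> \<le> (\<integral>x. B * (1 - cutoff R x) \<partial>M)"
  proof (intro integral_mono)
    fix x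
    have "\<bar>f x - f x * cutoff R x\<bar> = \<bar>f x\<bar> * \<bar>1 - cutoff R x\<bar>"
      unfolding abs_mult[symmetric] by (simp add: right_diff_distrib)
    also have "\<dots> \<le> B * (1 - cutoff R x)"
      using f(2)[of x] cutoff_bounds(2)[of R x] by (auto intro!: mult_mono)
    finally show "\<bar>f x - f x * cutoff R x\<bar> \<le> B * (1 - cutoff R x)" .
  qed (use int int2 in auto)
  also have "\<dots> = B * (1 - integral\<^sup>L M (cutoff R))" using int by (simp add: prob_space)
  also have "\<dots> \<le> B * e" using B e by (intro mult_left_mono) auto
  finally show ?thesis .
qed

text \<open>Sequential Prokhorov theorem. \<open>\<psi>\<close> squeezes the space into the unit
  ball, \<open>s\<close> codes the ball on the line, Helly's theorem gives a limit
  \<open>N0\<close>, and \<open>\<kappa> \<circ> \<phi>\<close> decodes it. The difficulty is that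
  codes may decode outside the open ball, where \<open>\<kappa>\<close> does not invert
  \<open>\<psi>\<close>; tightness shows that \<open>N0\<close> gives them no mass.\<close>

lemma tight_imp_weakly_convergent_subsequence:
  fixes M :: "nat \<Rightarrow> 'a::euclidean_space measure"
  assumes M: "\<And>n. borel_prob_measure (M n)"
    and tight: "\<And>e. 0 < e \<Longrightarrow> \<exists>R. \<forall>\<^sub>F n in sequentially. 1 - e \<le> measure (M n) (cball 0 R)"
  obtains r N where "strict_mono (r :: nat \<Rightarrow> nat)" "borel_prob_measure N" "weak_conv_to (\<lambda>n. M (r n)) N"
proof -
  define \<psi> :: "'a \<Rightarrow> 'a" where "\<psi> x = x /\<^sub>R (1 + norm x)" for x
  define \<kappa> :: "'a \<Rightarrow> 'a" where "\<kappa> y = y /\<^sub>R (1 - norm y)" for y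
  have pos: "1 + norm x > 0" for x :: 'a using norm_ge_zero[of x] by linarith
  have norm_\<psi>: "norm (\<psi> x) = norm x / (1 + norm x)" for x
    using pos[of x] by (simp add: \<psi>_def field_simps)
  then have \<psi>_ball: "\<psi> x \<in> ball 0 1" for x using pos[of x] by (simp add: field_simps)
  have \<kappa>\<psi>: "\<kappa> (\<psi> x) = x" for x
  proof -
    have "1 - norm (\<psi> x) = inverse (1 + norm x)" using pos[of x] by (simp add: norm_\<psi> field_simps)
    then show ?thesis using pos[of x] unfolding \<kappa>_def by (simp add: \<psi>_def)
  qed
  have \<psi>_cont: "continuous_on UNIV \<psi>"
    unfolding \<psi>_def using pos by (intro continuous_intros) (metis less_irrefl)
  obtain s :: "'a \<Rightarrow> real" and \<phi> :: "real \<Rightarrow> 'a" where s: "s \<in> borel_measurable borel" "\<And>x. 0 \<le> s x" "\<And>x. s x \<le> 2"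
    and \<phi>: "continuous_on UNIV \<phi>" and \<phi>s: "\<And>x. x \<in> ball 0 1 \<Longrightarrow> \<phi> (s x) = x"
    using bounded_set_real_code[OF bounded_ball[of "0::'a" 1]] by metis
  have [measurable]: "\<psi> \<in> borel_measurable borel" by (rule borel_measurable_continuous_onI[OF \<psi>_cont])
  have [measurable]: "\<phi> \<in> borel_measurable borel" by (rule borel_measurable_continuous_onI[OF \<phi>])
  note s(1)[measurable]
  have \<kappa>_meas[measurable]: "\<kappa> \<in> borel_measurable borel" unfolding \<kappa>_def by measurable
  have M_meas: "f \<in> measurable (M n) N \<longleftrightarrow> f \<in> measurable borel N" for f n and N :: "'c measure"
    using borel_prob_measureD(2)[OF M] measurable_cong_sets by blast
  define \<nu> where "\<nu> n = distr (M n) borel (\<lambda>x. s (\<psi> x))" for n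
  have meas: "(\<lambda>x. s (\<psi> x)) \<in> measurable (M n) borel" for n unfolding M_meas by measurable
  have \<nu>: "real_distribution (\<nu> n)" for n
  proof -
    interpret M: prob_space "M n" using M by (rule borel_prob_measureD)
    have "prob_space (\<nu> n)" unfolding \<nu>_def by (rule M.prob_space_distr[OF meas])
    then show ?thesis unfolding real_distribution_def real_distribution_axioms_def by (simp add: \<nu>_def)
  qed
  have "tight \<nu>"
    unfolding tight_def
  proof (intro conjI allI impI)
    fix e :: real assume e: "0 < e"
    \<comment> \<open>The interval is open on the left and \<open>s\<close> may take the value 0,
      hence the left end -1.\<close>
    have "measure (\<nu> n) {-1<..2} = 1" for n
    proof -
      interpret M: prob_space "M n" using M by (rule borel_prob_measureD)
      have "-1 < s (\<psi> x)" for x using s(2)[of "\<psi> x"] by linarith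
      then have "(\<lambda>x. s (\<psi> x)) -` {-1<..2} \<inter> space (M n) = space (M n)" using s(3) by auto
      then show ?thesis unfolding \<nu>_def by (subst measure_distr[OF meas]) (auto simp: M.prob_space)
    qed
    then show "\<exists>a b. a < b \<and> (\<forall>n. 1 - e < measure (\<nu> n) {a<..b})"
      using e by (intro exI[of _ "-1"] exI[of _ 2]) auto
  qed (rule \<nu>)
  then obtain r N0 where r: "strict_mono (r :: nat \<Rightarrow> nat)" and N0: "real_distribution N0"
    and conv: "weak_conv_m (\<nu> \<circ> id \<circ> r) N0"
    using tight_imp_convergent_subsubsequence[of \<nu> id] by (auto simp: strict_mono_id)
  interpret N0: real_distribution N0 by (rule N0)
  define N where "N = distr N0 borel (\<lambda>t. \<kappa> (\<phi> t))"
  have N0_meas: "f \<in> measurable N0 L \<longleftrightarrow> f \<in> measurable borel L" for f and L :: "'c measure"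
    using N0.events_eq_borel measurable_cong_sets by blast
  have \<kappa>\<phi>: "(\<lambda>t. \<kappa> (\<phi> t)) \<in> measurable N0 borel" unfolding N0_meas by measurable
  have N: "borel_prob_measure N"
    unfolding borel_prob_measure_def N_def using N0.prob_space_distr[OF \<kappa>\<phi>] by simp
  have transfer: "(\<lambda>n. integral\<^sup>L (M (r n)) f) \<longlonglongrightarrow> (\<integral>t. (if norm (\<phi> t) < 1 then f (\<kappa> (\<phi> t)) else 0) \<partial>N0)"
    if f: "continuous_on UNIV f" "\<And>x. \<bar>f x\<bar> \<le> B" "\<And>x. R \<le> norm x \<Longrightarrow> f x = 0" for f :: "'a \<Rightarrow> real" and B R
  proof -
    define F where "F y = (if norm y < 1 then f (\<kappa> y) else 0)" for y
    \<comment> \<open>The image under \<open>\<psi>\<close> of the sphere of radius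
      \<open>\<bar>R\<bar>\<close> has radius \<open>R'\<close>. Beyond it \<open>F\<close>
      vanishes, so the extension by 0 is continuous across the unit sphere; bounded support of
      \<open>f\<close> is essential here.\<close>
    define R' where "R' = \<bar>R\<bar> / (1 + \<bar>R\<bar>)"
    have R': "R' < 1" unfolding R'_def by (simp add: field_simps)
    have F0: "F y = 0" if "R' < norm y" for y
    proof (cases "norm y < 1")
      case True
      have "\<bar>R\<bar> < norm y * (1 + \<bar>R\<bar>)" using that unfolding R'_def by (simp add: divide_less_eq)
      then have "\<bar>R\<bar> * (1 - norm y) < norm y" by (simp add: algebra_simps)
      then have "\<bar>R\<bar> < norm (\<kappa> y)" using True unfolding \<kappa>_def by (simp add: field_simps)
      then show ?thesis using f(3)[of "\<kappa> y"] by (simp add: F_def)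
    qed (simp add: F_def)
    have "continuous_on (ball 0 1 \<union> {y. R' < norm y}) F"
    proof (rule continuous_on_open_Un)
      have "continuous_on (ball 0 1) \<kappa>" unfolding \<kappa>_def by (intro continuous_intros) auto
      then have "continuous_on (ball 0 1) (\<lambda>y. f (\<kappa> y))"
        by (rule continuous_on_compose2[OF f(1)]) auto
      then show "continuous_on (ball 0 1) F" by (rule continuous_on_eq) (auto simp: F_def)
      show "continuous_on {y. R' < norm y} F"
        by (rule continuous_on_eq[OF continuous_on_const[of _ 0]]) (simp add: F0)
    qed (auto intro!: open_Collect_less continuous_intros)
    moreover have "ball 0 1 \<union> {y. R' < norm y} = (UNIV :: 'a set)"
    proof -
      have "y \<in> ball 0 1 \<union> {y. R' < norm y}" for y :: 'a
      proof (cases "norm y < 1")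
        case False
        then have "R' < norm y" using R' by linarith
        then show ?thesis by simp
      qed simp
      then show ?thesis by blast
    qed
    ultimately have "continuous_on UNIV F" by simp
    then have cont: "continuous_on UNIV (\<lambda>t. F (\<phi> t))" by (rule continuous_on_compose2[OF _ \<phi>]) auto
    have B: "0 \<le> B" using f(2)[of 0] by linarith
    have FB: "\<bar>F y\<bar> \<le> B" for y using f(2) B by (auto simp: F_def)
    have "(\<lambda>n. integral\<^sup>L ((\<nu> \<circ> id \<circ> r) n) (\<lambda>t. F (\<phi> t))) \<longlonglongrightarrow> (\<integral>t. F (\<phi> t) \<partial>N0)"
      using \<nu> N0 conv cont FB
      by (intro weak_conv_imp_integral_bdd_continuous_conv[where B = B]) (auto simp: continuous_on_eq_continuous_at o_def)
    moreover have "integral\<^sup>L ((\<nu> \<circ> id \<circ> r) n) (\<lambda>t. F (\<phi> t)) = integral\<^sup>L (M (r n)) f" for n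
    proof -
      have "integral\<^sup>L (\<nu> (r n)) (\<lambda>t. F (\<phi> t)) = (\<integral>x. F (\<phi> (s (\<psi> x))) \<partial>M (r n))"
        unfolding \<nu>_def by (rule integral_distr[OF meas]) (rule borel_measurable_continuous_onI[OF cont])
      also have "\<dots> = integral\<^sup>L (M (r n)) f"
        using \<psi>_ball by (intro Bochner_Integration.integral_cong) (auto simp: \<phi>s F_def \<kappa>\<psi>)
      finally show ?thesis by simp
    qed
    ultimately show ?thesis by (simp add: F_def)
  qed
  have ball_N0: "{t. norm (\<phi> t) < 1} \<in> sets N0"
    unfolding N0.events_eq_borel by measurable
  \<comment> \<open>No mass escapes to infinity: the pulled-back cutoff has integral at least
    \<open>1 - e\<close> and vanishes unless the code decodes into the open ball.\<close>
  have "measure N0 {t. norm (\<phi> t) < 1} = 1"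
  proof (rule antisym[OF N0.prob_le_1], rule field_le_epsilon)
    fix e :: real assume "0 < e"
    then obtain R where R: "\<forall>\<^sub>F n in sequentially. 1 - e \<le> measure (M n) (cball 0 R)" using tight by blast
    let ?g = "\<lambda>t. if norm (\<phi> t) < 1 then cutoff R (\<kappa> (\<phi> t)) else 0"
    have "(\<lambda>n. integral\<^sup>L (M (r n)) (cutoff R)) \<longlonglongrightarrow> integral\<^sup>L N0 ?g"
      by (rule transfer[of _ 1 "R + 1"]) (auto intro: continuous_intros cutoff_eq_0)
    moreover have "\<forall>\<^sub>F n in sequentially. 1 - e \<le> integral\<^sup>L (M (r n)) (cutoff R)"
      using eventually_subseq[OF r R]
      by eventually_elim (use measure_le_integral_cutoff[OF M] order_trans in blast)
    ultimately have "1 - e \<le> integral\<^sup>L N0 ?g" by (intro tendsto_lowerbound) auto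
    also have "\<dots> \<le> integral\<^sup>L N0 (indicator {t. norm (\<phi> t) < 1})"
    proof (rule integral_mono)
      have [measurable]: "cutoff R \<in> borel_measurable (borel :: 'a measure)"
        by (intro borel_measurable_continuous_onI continuous_intros)
      have "?g \<in> borel_measurable N0" unfolding N0_meas by measurable
      then show "integrable N0 ?g" by (intro N0.integrable_const_bound[of _ 1]) auto
      show "integrable N0 (indicator {t. norm (\<phi> t) < 1} :: real \<Rightarrow> real)"
        using ball_N0 N0.emeasure_finite by (auto simp: less_top[symmetric])
    qed (auto simp: cutoff_bounds)
    also have "\<dots> = measure N0 {t. norm (\<phi> t) < 1}" using ball_N0 by simp
    finally show "1 \<le> measure N0 {t. norm (\<phi> t) < 1} + e" by simp
  qed
  then have AE: "AE t in N0. norm (\<phi> t) < 1"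
    using N0.prob_Collect_eq_1[of "\<lambda>t. norm (\<phi> t) < 1"] ball_N0 by simp
  have compact_supp: "(\<lambda>n. integral\<^sup>L (M (r n)) f) \<longlonglongrightarrow> integral\<^sup>L N f"
    if f: "continuous_on UNIV f" "\<And>x. \<bar>f x\<bar> \<le> B" "\<And>x. R \<le> norm x \<Longrightarrow> f x = 0" for f :: "'a \<Rightarrow> real" and B R
  proof -
    have [measurable]: "f \<in> borel_measurable borel" using f(1) by (rule borel_measurable_continuous_onI)
    have "(\<integral>t. (if norm (\<phi> t) < 1 then f (\<kappa> (\<phi> t)) else 0) \<partial>N0) = (\<integral>t. f (\<kappa> (\<phi> t)) \<partial>N0)"
    proof (rule integral_cong_AE)
      show "AE t in N0. (if norm (\<phi> t) < 1 then f (\<kappa> (\<phi> t)) else 0) = f (\<kappa> (\<phi> t))" using AE by auto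
    qed (unfold N0_meas, measurable)
    also have "\<dots> = integral\<^sup>L N f" unfolding N_def by (rule integral_distr[OF \<kappa>\<phi>, symmetric]) simp
    finally show ?thesis using transfer[OF f] by simp
  qed
  have "weak_conv_to (\<lambda>n. M (r n)) N"
    unfolding weak_conv_to_def
  proof (intro allI impI)
    fix f :: "'a \<Rightarrow> real" assume f: "continuous_on UNIV f \<and> bounded (range f)"
    then obtain B where B: "B > 0" "\<And>x. \<bar>f x\<bar> \<le> B" by (auto simp: bounded_pos)
    show "(\<lambda>n. integral\<^sup>L (M (r n)) f) \<longlonglongrightarrow> integral\<^sup>L N f"
    proof (rule LIMSEQ_I)
      fix e :: real assume e: "0 < e"
      \<comment> \<open>Truncation of \<open>f\<close> costs at most \<open>B * d = e / 4\<close>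
        for \<open>M (r n)\<close> and for \<open>N\<close>; with \<open>e / 4\<close> for the
        truncated integrals the total stays below \<open>e\<close>.\<close>
      define d where "d = e / (4 * B)"
      have d: "0 < d" "B * d = e / 4" using e B(1) by (auto simp: d_def)
      obtain R where R: "\<forall>\<^sub>F n in sequentially. 1 - d \<le> measure (M n) (cball 0 R)" using tight d(1) by blast
      have 1: "\<forall>\<^sub>F n in sequentially. 1 - d \<le> integral\<^sup>L (M (r n)) (cutoff R)"
        using eventually_subseq[OF r R]
        by eventually_elim (use measure_le_integral_cutoff[OF M] order_trans in blast)
      have "(\<lambda>n. integral\<^sup>L (M (r n)) (cutoff R)) \<longlonglongrightarrow> integral\<^sup>L N (cutoff R)"
        by (rule compact_supp[of _ 1 "R + 1"]) (auto intro: continuous_intros cutoff_eq_0)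
      then have 2: "1 - d \<le> integral\<^sup>L N (cutoff R)" using 1 by (intro tendsto_lowerbound) auto
      let ?g = "\<lambda>x. f x * cutoff R x"
      have "\<bar>?g x\<bar> \<le> B" for x
        using mult_mono[OF B(2)[of x], of "cutoff R x" 1] cutoff_bounds[of R x] B(1) by (simp add: abs_mult)
      then have "(\<lambda>n. integral\<^sup>L (M (r n)) ?g) \<longlonglongrightarrow> integral\<^sup>L N ?g"
        using f by (intro compact_supp[of _ B "R + 1"]) (auto intro!: continuous_intros simp: cutoff_eq_0)
      then have 3: "\<forall>\<^sub>F n in sequentially. dist (integral\<^sup>L (M (r n)) ?g) (integral\<^sup>L N ?g) < e / 4"
        using e by (intro tendstoD) auto
      have "\<forall>\<^sub>F n in sequentially. norm (integral\<^sup>L (M (r n)) f - integral\<^sup>L N f) < e"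
        using 1 3
      proof eventually_elim
        case (elim n)
        have "\<bar>integral\<^sup>L (M (r n)) f - integral\<^sup>L (M (r n)) ?g\<bar> \<le> e / 4"
          using integral_minus_cutoff_bound[OF M _ B(2) elim(1)] f d(2) by simp
        moreover have "\<bar>integral\<^sup>L N f - integral\<^sup>L N ?g\<bar> \<le> e / 4"
          using integral_minus_cutoff_bound[OF N _ B(2) 2] f d(2) by simp
        ultimately show ?case using elim(2) e unfolding dist_real_def real_norm_def by linarith
      qed
      then show "\<exists>no. \<forall>n\<ge>no. norm (integral\<^sup>L (M (r n)) f - integral\<^sup>L N f) < e"
        by (simp add: eventually_sequentially)
    qed
  qed
  with r N show thesis by (rule that)
qed

text \<open>A large ball carries more than \<open>1 - e\<close> of the limit. The cutoff transports
  this to \<open>M n\<close> at the price of one unit of radius.\<close>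

lemma weak_conv_imp_tight:
  fixes M :: "nat \<Rightarrow> 'a::euclidean_space measure"
  assumes M: "\<And>n. borel_prob_measure (M n)" and L: "borel_prob_measure L" and conv: "weak_conv_to M L" and e: "0 < e"
  obtains R where "\<forall>\<^sub>F n in sequentially. 1 - e \<le> measure (M n) (cball 0 R)"
proof -
  interpret L: prob_space L using L by (rule borel_prob_measureD)
  have "(\<lambda>k. measure L (cball 0 (real k))) \<longlonglongrightarrow> measure L (\<Union>k. cball 0 (real k))"
  proof (rule L.finite_Lim_measure_incseq)
    show "range (\<lambda>k. cball 0 (real k)) \<subseteq> sets L"
      unfolding borel_prob_measureD(2)[OF L] by auto
    show "incseq (\<lambda>k. cball (0 :: 'a) (real k))"
      unfolding incseq_def by (intro allI impI subset_cball) simp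
  qed
  moreover have "(\<Union>k. cball 0 (real k)) = space L"
    using real_arch_simple borel_prob_measureD(3)[OF L] by (auto simp: set_eq_iff)
  ultimately have "(\<lambda>k. measure L (cball 0 (real k))) \<longlonglongrightarrow> 1" by (simp add: L.prob_space)
  then have "\<forall>\<^sub>F k in sequentially. 1 - e < measure L (cball 0 (real k))" using e by (intro order_tendstoD) auto
  then obtain k :: nat where k: "1 - e < measure L (cball 0 (real k))" by (auto simp: eventually_sequentially)
  have "(\<lambda>n. integral\<^sup>L (M n) (cutoff (real k))) \<longlonglongrightarrow> integral\<^sup>L L (cutoff (real k))"
  proof -
    have "continuous_on UNIV (cutoff (real k) :: 'a \<Rightarrow> real)" by (intro continuous_intros)
    moreover have "bounded (range (cutoff (real k) :: 'a \<Rightarrow> real))" by (rule boundedI[of _ 1]) auto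
    ultimately show ?thesis using conv unfolding weak_conv_to_def by blast
  qed
  moreover have "1 - e < integral\<^sup>L L (cutoff (real k))" using k measure_le_integral_cutoff[OF L, of "real k"] by linarith
  ultimately have "\<forall>\<^sub>F n in sequentially. 1 - e < integral\<^sup>L (M n) (cutoff (real k))" by (rule order_tendstoD)
  then have "\<forall>\<^sub>F n in sequentially. 1 - e \<le> measure (M n) (cball 0 (real k + 1))"
    by eventually_elim (use integral_cutoff_le_measure[OF M, of _ "real k"] in \<open>auto intro: order_trans less_imp_le\<close>)
  then show thesis by (rule that)
qed

text \<open>Integrals of continuous functions decreasing to the indicator determine the mass of
  closed sets, which form an intersection-stable generator.\<close>

lemma borel_prob_measure_eqI:
  fixes L1 L2 :: "'a::metric_space measure"
  assumes L: "borel_prob_measure L1" "borel_prob_measure L2"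
    and eq: "\<And>f :: 'a \<Rightarrow> real. continuous_on UNIV f \<Longrightarrow> bounded (range f) \<Longrightarrow> integral\<^sup>L L1 f = integral\<^sup>L L2 f"
  shows "L1 = L2"
proof (rule measure_eqI_generator_eq[where E = "Collect closed" and \<Omega> = UNIV and A = "\<lambda>_. UNIV"])
  interpret L1: prob_space L1 using L(1) by (rule borel_prob_measureD)
  interpret L2: prob_space L2 using L(2) by (rule borel_prob_measureD)
  show "sets L1 = sigma_sets UNIV (Collect closed)" "sets L2 = sigma_sets UNIV (Collect closed)"
    using L by (auto simp: borel_prob_measureD borel_eq_closed)
  show "emeasure L1 C = emeasure L2 C" if "C \<in> Collect closed" for C :: "'a set"
  \<comment> \<open>For empty \<open>C\<close> the value \<open>infdist x C\<close> is 0, so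
    \<open>f k\<close> would be constantly 1 instead of tending to the indicator.\<close>
  proof (cases "C = {}")
    case False
    have C: "closed C" using that by simp
    define f where "f k x = max 0 (1 - real k * infdist x C)" for k :: nat and x
    have cont: "continuous_on UNIV (f k)" for k
      unfolding f_def by (intro continuous_intros)
    have bd: "\<bar>f k x\<bar> \<le> 1" for k x unfolding f_def by (auto simp: infdist_nonneg)
    have lim: "(\<lambda>k. f k x) \<longlonglongrightarrow> indicator C x" for x
    proof (cases "x \<in> C")
      case True
      then show ?thesis by (simp add: f_def)
    next
      case out: False
      have "infdist x C \<noteq> 0" using in_closed_iff_infdist_zero[OF C False] out by simp
      then have "infdist x C > 0" using infdist_nonneg[of x C] by linarith
      then obtain N :: nat where N: "1 < real N * infdist x C" using ex_less_of_nat_mult by blast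
      have "f k x = indicator C x" if "N \<le> k" for k
      proof -
        have "real N * infdist x C \<le> real k * infdist x C" using that by (intro mult_right_mono) (auto simp: infdist_nonneg)
        then show ?thesis using N out by (auto simp: f_def)
      qed
      then show ?thesis by (intro tendsto_eventually) (auto simp: eventually_sequentially)
    qed
    have conv: "(\<lambda>k. integral\<^sup>L L (f k)) \<longlonglongrightarrow> measure L C" if L: "borel_prob_measure L" for L
    proof -
      interpret prob_space L using L by (rule borel_prob_measureD)
      have CL: "C \<in> sets L" using C borel_prob_measureD(2)[OF L] by simp
      have "(\<lambda>k. integral\<^sup>L L (f k)) \<longlonglongrightarrow> integral\<^sup>L L (indicator C)"
      proof (rule integral_dominated_convergence[where w = "\<lambda>_. 1"])
        show "f k \<in> borel_measurable L" for k
          using integrable_bounded_continuous[OF L cont bd] by auto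
      qed (use CL lim bd in auto)
      then show ?thesis using CL by simp
    qed
    have "integral\<^sup>L L1 (f k) = integral\<^sup>L L2 (f k)" for k
      by (intro eq cont boundedI[of _ 1]) (use bd in auto)
    then have "measure L1 C = measure L2 C"
      using conv[OF L(1)] conv[OF L(2)] LIMSEQ_unique by auto
    then show ?thesis by (simp add: L1.emeasure_eq_measure L2.emeasure_eq_measure)
  qed simp
next
  show "emeasure L1 UNIV \<noteq> \<infinity>"
    using L(1) by (simp add: borel_prob_measureD(1) finite_measure.emeasure_finite prob_space.finite_measure)
qed (auto simp: Int_stable_def closed_Int)

text \<open>The tent function is non-zero exactly on the ball, so its integral detects whether the
  ball is charged, and it is an admissible test function.\<close>

lemma eventually_ball_emeasure_pos:
  fixes L :: "'a::metric_space measure"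
  assumes M: "\<And>n. borel_prob_measure (M n)" and L: "borel_prob_measure L" and conv: "weak_conv_to M L"
    and pos: "emeasure L (ball p e) > 0"
  shows "\<forall>\<^sub>F n in sequentially. emeasure (M n) (ball p e) > 0"
proof -
  define f where "f z = max 0 (e - dist p z)" for z
  have cont: "continuous_on UNIV f" unfolding f_def by (intro continuous_intros)
  have bd: "\<bar>f z\<bar> \<le> \<bar>e\<bar>" for z unfolding f_def using zero_le_dist[of p z] by linarith
  have nn: "0 \<le> f z" for z by (simp add: f_def)
  have f_pos: "f z \<noteq> 0 \<longleftrightarrow> z \<in> ball p e" for z by (auto simp: f_def)
  have iff: "integral\<^sup>L N f = 0 \<longleftrightarrow> emeasure N (ball p e) = 0" if N: "borel_prob_measure N" for N
  proof -
    have "integral\<^sup>L N f = 0 \<longleftrightarrow> (AE z in N. f z = 0)"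
      using integrable_bounded_continuous[OF N cont bd] nn by (intro integral_nonneg_eq_0_iff_AE) auto
    also have "\<dots> \<longleftrightarrow> (AE z in N. z \<notin> ball p e)" unfolding f_pos[symmetric] by simp
    also have "\<dots> \<longleftrightarrow> emeasure N (ball p e) = 0"
    proof (rule AE_iff_measurable)
      show "ball p e \<in> sets N" unfolding borel_prob_measureD(2)[OF N] by (rule borel_open[OF open_ball])
      show "{z \<in> space N. \<not> z \<notin> ball p e} = ball p e" using borel_prob_measureD(3)[OF N] by auto
    qed
    finally show ?thesis .
  qed
  have "integral\<^sup>L L f \<ge> 0" using nn by (intro integral_nonneg_AE) auto
  then have "0 < integral\<^sup>L L f" using iff[OF L] pos by (simp add: less_le)
  moreover have "bounded (range f)" using bd by (intro boundedI[of _ "\<bar>e\<bar>"]) auto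
  then have "(\<lambda>n. integral\<^sup>L (M n) f) \<longlonglongrightarrow> integral\<^sup>L L f"
    using conv cont unfolding weak_conv_to_def by blast
  ultimately have "\<forall>\<^sub>F n in sequentially. 0 < integral\<^sup>L (M n) f" by (intro order_tendstoD) auto
  then show ?thesis
  proof eventually_elim
    case (elim n)
    then show ?case using iff[OF M, of n] by (auto simp: zero_less_iff_neq_zero)
  qed
qed

text \<open>Otherwise open null sets cover \<open>G\<close>; by Lindelof countably many suffice, so
  \<open>G\<close> would be null.\<close>

lemma spt_meets_open:
  fixes M :: "'a::second_countable_topology measure"
  assumes M: "sets M = sets borel" and G: "open G" "emeasure M G > 0"
  shows "\<exists>x\<in>G. x \<in> spt M"
proof (rule ccontr)
  assume "\<not> ?thesis"
  define \<U> where "\<U> = {U. open U \<and> emeasure M U = 0}"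
  have "x \<in> \<Union>\<U>" if "x \<in> G" for x
    using \<open>\<not> (\<exists>x\<in>G. x \<in> spt M)\<close> that unfolding spt_def \<U>_def by (auto simp: zero_less_iff_neq_zero)
  moreover obtain \<V> where \<V>: "\<V> \<subseteq> \<U>" "countable \<V>" "\<Union>\<V> = \<Union>\<U>"
    using Lindelof[of \<U>] unfolding \<U>_def by (metis (no_types, lifting) mem_Collect_eq)
  ultimately have "G \<subseteq> \<Union>\<V>" by blast
  moreover have "\<Union>\<V> \<in> null_sets M"
  proof -
    have "U \<in> null_sets M" if "U \<in> \<V>" for U
      using that \<V>(1) M by (auto simp: \<U>_def null_sets_def)
    then have "(\<Union>U\<in>\<V>. U) \<in> null_sets M" by (intro null_sets_UN' \<V>(2))
    then show ?thesis by simp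
  qed
  ultimately have "emeasure M G = 0"
    by (metis emeasure_eq_0 null_setsD1 null_setsD2)
  then show False using G(2) by simp
qed

lemma spt_limit_approximation:
  fixes L :: "'a::{metric_space, second_countable_topology} measure"
  assumes M: "\<And>n. borel_prob_measure (M n)" and L: "borel_prob_measure L" and conv: "weak_conv_to M L"
    and p: "p \<in> spt L" "0 < e"
  shows "\<forall>\<^sub>F n in sequentially. \<exists>q\<in>spt (M n). dist q p < e"
proof -
  have "emeasure L (ball p e) > 0" using p unfolding spt_def by simp
  from eventually_ball_emeasure_pos[OF M L conv this] show ?thesis
  proof eventually_elim
    case (elim n)
    then obtain q where "q \<in> ball p e" "q \<in> spt (M n)"
      using spt_meets_open[OF borel_prob_measureD(2)[OF M] open_ball] by blast
    then show ?case by (auto simp: dist_commute)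
  qed
qed

section \<open>Supports, margins and limits of couplings\<close>

lemma couplingsD:
  assumes "\<rho> \<in> couplings P Q"
  shows "borel_prob_measure \<rho>" "distr \<rho> borel fst = P" "distr \<rho> borel snd = Q"
  using assms by (auto simp: couplings_def)

lemma measurable_borel_prob_measure_fst_snd:
  fixes \<rho> :: "('a::second_countable_topology \<times> 'b::second_countable_topology) measure"
  assumes "borel_prob_measure \<rho>"
  shows "fst \<in> measurable \<rho> borel" "snd \<in> measurable \<rho> borel"
proof -
  have "(fst :: 'a \<times> 'b \<Rightarrow> 'a) \<in> borel_measurable borel" "(snd :: 'a \<times> 'b \<Rightarrow> 'b) \<in> borel_measurable borel"
    by (auto intro!: borel_measurable_continuous_onI continuous_intros)
  then show "fst \<in> measurable \<rho> borel" "snd \<in> measurable \<rho> borel"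
    using borel_prob_measureD(2)[OF assms] measurable_cong_sets by blast+
qed

text \<open>A charged ball of the first margin is a charged open cylinder for the coupling and so
  meets its support. The closure cannot be dropped in general, since projections of closed sets need
  not be closed.\<close>

lemma spt_subset_closure_Domain:
  fixes \<rho> :: "('a::{metric_space, second_countable_topology} \<times> 'b::second_countable_topology) measure"
  assumes \<rho>: "\<rho> \<in> couplings P Q"
  shows "spt P \<subseteq> closure (Domain (spt \<rho>))"
proof
  fix a assume a: "a \<in> spt P"
  note b = couplingsD(1)[OF \<rho>]
  have "\<exists>y\<in>Domain (spt \<rho>). dist y a < e" if "0 < e" for e
  proof -
    have "0 < emeasure P (ball a e)" using a that unfolding spt_def by simp
    also have "emeasure P (ball a e) = emeasure \<rho> (fst -` ball a e)"
      unfolding couplingsD(2)[OF \<rho>, symmetric]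
      by (subst emeasure_distr[OF measurable_borel_prob_measure_fst_snd(1)[OF b]])
        (auto simp: borel_prob_measureD(3)[OF b])
    finally obtain p where "p \<in> fst -` ball a e" "p \<in> spt \<rho>"
      using spt_meets_open[OF borel_prob_measureD(2)[OF b] open_vimage_fst[OF open_ball]] by blast
    then have "dist (fst p) a < e" "(fst p, snd p) \<in> spt \<rho>" by (auto simp: dist_commute)
    then show ?thesis by blast
  qed
  then show "a \<in> closure (Domain (spt \<rho>))" by (simp add: closure_approachable)
qed

text \<open>The finitely many pairs of a cycle are approximated simultaneously by pairs in one
  \<open>spt (M n)\<close>, and the cycle inequality is closed under limits.\<close>

lemma cyclically_monotone_spt_limit:
  fixes L :: "('a::euclidean_space \<times> 'a) measure"
  assumes M: "\<And>n. borel_prob_measure (M n)" and L: "borel_prob_measure L" and conv: "weak_conv_to M L"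
    and cyc: "\<And>n. cyclically_monotone (spt (M n))"
  shows "cyclically_monotone (spt L)"
  unfolding cyclically_monotone_def
proof (intro allI impI)
  fix m :: nat and x y :: "nat \<Rightarrow> 'a"
  assume m: "1 \<le> m" and xy: "\<forall>i<m. (x i, y i) \<in> spt L"
  have "\<exists>n. \<forall>i\<in>{..<m}. \<exists>q\<in>spt (M n). dist q (x i, y i) < inverse (real (Suc k))" for k
  proof -
    have "\<forall>\<^sub>F n in sequentially. \<forall>i\<in>{..<m}. \<exists>q\<in>spt (M n). dist q (x i, y i) < inverse (real (Suc k))"
      using xy by (intro eventually_ball_finite ballI spt_limit_approximation[OF M L conv]) auto
    then show ?thesis by (rule eventually_happens'[rotated]) simp
  qed
  then obtain n where "\<And>k. \<forall>i\<in>{..<m}. \<exists>q\<in>spt (M (n k)). dist q (x i, y i) < inverse (real (Suc k))"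
    by metis
  then have "\<forall>k. \<forall>i\<in>{..<m}. \<exists>q. q \<in> spt (M (n k)) \<and> dist q (x i, y i) < inverse (real (Suc k))" by blast
  then have "\<forall>k. \<exists>q. \<forall>i\<in>{..<m}. q i \<in> spt (M (n k)) \<and> dist (q i) (x i, y i) < inverse (real (Suc k))"
    unfolding bchoice_iff .
  then obtain q where q: "\<And>k i. i < m \<Longrightarrow> q k i \<in> spt (M (n k))"
    "\<And>k i. i < m \<Longrightarrow> dist (q k i) (x i, y i) < inverse (real (Suc k))"
    unfolding choice_iff by auto
  have lim: "(\<lambda>k. q k i) \<longlonglongrightarrow> (x i, y i)" if "i < m" for i
  proof (rule metric_tendsto_imp_tendsto[OF LIMSEQ_inverse_real_of_nat])
    show "\<forall>\<^sub>F k in sequentially. dist (q k i) (x i, y i) \<le> dist (inverse (real (Suc k))) 0"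
      using q(2)[OF that] by (intro always_eventually allI) (simp add: less_imp_le)
  qed
  have lx: "(\<lambda>k. fst (q k i)) \<longlonglongrightarrow> x i" and ly: "(\<lambda>k. snd (q k i)) \<longlonglongrightarrow> y i" if "i < m" for i
    using tendsto_fst[OF lim[OF that]] tendsto_snd[OF lim[OF that]] by auto
  have "(\<Sum>i<m. fst (q k i) \<bullet> snd (q k (Suc i mod m))) \<le> (\<Sum>i<m. fst (q k i) \<bullet> snd (q k i))" for k
    using cyc[of "n k", unfolded cyclically_monotone_def, rule_format, OF m, of "\<lambda>i. fst (q k i)" "\<lambda>i. snd (q k i)"] q(1)
    by simp
  moreover have "(\<lambda>k. \<Sum>i<m. fst (q k i) \<bullet> snd (q k (Suc i mod m))) \<longlonglongrightarrow> (\<Sum>i<m. x i \<bullet> y (Suc i mod m))"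
    using m by (intro tendsto_sum tendsto_inner lx ly) auto
  moreover have "(\<lambda>k. \<Sum>i<m. fst (q k i) \<bullet> snd (q k i)) \<longlonglongrightarrow> (\<Sum>i<m. x i \<bullet> y i)"
    by (intro tendsto_sum tendsto_inner lx ly) auto
  ultimately show "(\<Sum>i<m. x i \<bullet> y (Suc i mod m)) \<le> (\<Sum>i<m. x i \<bullet> y i)"
    by (intro LIMSEQ_le) auto
qed

lemma weak_conv_to_margin:
  fixes L :: "'a::topological_space measure" and g :: "'a \<Rightarrow> 'b::metric_space"
  assumes M: "\<And>n. borel_prob_measure (M n)" and L: "borel_prob_measure L" and conv: "weak_conv_to M L"
    and g: "continuous_on UNIV g" and "borel_prob_measure P"
    and P: "weak_conv_to (\<lambda>n. distr (M n) borel g) P"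
  shows "distr L borel g = P"
proof (rule borel_prob_measure_eqI)
  have meas: "g \<in> measurable N borel" if N: "borel_prob_measure N" for N
    using borel_measurable_continuous_onI[OF g] borel_prob_measureD(2)[OF N] measurable_cong_sets by blast
  show "borel_prob_measure (distr L borel g)"
    using prob_space.prob_space_distr[OF borel_prob_measureD(1)[OF L] meas[OF L]] by (simp add: borel_prob_measure_def)
  fix f :: "'b \<Rightarrow> real" assume f: "continuous_on UNIV f" "bounded (range f)"
  have distr: "integral\<^sup>L (distr N borel g) f = (\<integral>x. f (g x) \<partial>N)" if "borel_prob_measure N" for N
    using f(1) by (intro integral_distr meas that borel_measurable_continuous_onI)
  have "continuous_on UNIV (\<lambda>x. f (g x))" using f(1) g by (rule continuous_on_compose2) auto
  moreover have "bounded (range (\<lambda>x. f (g x)))" using f(2) by (rule bounded_subset) auto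
  ultimately have "(\<lambda>n. \<integral>x. f (g x) \<partial>M n) \<longlonglongrightarrow> (\<integral>x. f (g x) \<partial>L)"
    using conv unfolding weak_conv_to_def by blast
  moreover have "(\<lambda>n. \<integral>x. f (g x) \<partial>M n) \<longlonglongrightarrow> integral\<^sup>L P f"
  proof -
    have "(\<lambda>n. integral\<^sup>L (distr (M n) borel g) f) \<longlonglongrightarrow> integral\<^sup>L P f"
      using P f unfolding weak_conv_to_def by blast
    then show ?thesis by (simp add: distr[OF M])
  qed
  ultimately show "integral\<^sup>L (distr L borel g) f = integral\<^sup>L P f"
    unfolding distr[OF L] by (rule LIMSEQ_unique)
qed fact

lemma coupling_measure_cball_ge:
  fixes \<rho> :: "('a::euclidean_space \<times> 'b::euclidean_space) measure"
  assumes \<rho>: "\<rho> \<in> couplings P Q" and "1 - d \<le> measure P (cball 0 R)" "1 - e \<le> measure Q (cball 0 S)"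
  shows "1 - (d + e) \<le> measure \<rho> (cball 0 (R + S))"
proof -
  note b = couplingsD(1)[OF \<rho>]
  interpret prob_space \<rho> using b by (rule borel_prob_measureD)
  note fs = measurable_borel_prob_measure_fst_snd[OF b]
  let ?A = "fst -` cball (0 :: 'a) R" and ?B = "snd -` cball (0 :: 'b) S"
  have A: "?A \<in> events" "measure P (cball 0 R) = prob ?A"
    using measurable_sets[OF fs(1), of "cball 0 R"] measure_distr[OF fs(1), of "cball 0 R"]
    by (auto simp: couplingsD(2)[OF \<rho>] borel_prob_measureD(3)[OF b])
  have B: "?B \<in> events" "measure Q (cball 0 S) = prob ?B"
    using measurable_sets[OF fs(2), of "cball 0 S"] measure_distr[OF fs(2), of "cball 0 S"]
    by (auto simp: couplingsD(3)[OF \<rho>] borel_prob_measureD(3)[OF b])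
  have "prob (?A \<union> ?B) = prob ?A + prob ?B - prob (?A \<inter> ?B)"
    using A(1) B(1) by (intro measure_Un3) (simp_all add: fmeasurable_eq_sets)
  then have "prob ?A + prob ?B - 1 \<le> prob (?A \<inter> ?B)" using prob_le_1[of "?A \<union> ?B"] by linarith
  also have "\<dots> \<le> prob (cball 0 (R + S))"
  proof (rule finite_measure_mono)
    show "?A \<inter> ?B \<subseteq> cball 0 (R + S)"
      using norm_Pair_le by (fastforce intro: order_trans)
    show "cball 0 (R + S) \<in> events" using borel_prob_measureD(2)[OF b] by simp
  qed
  finally show ?thesis using assms(2,3) A(2) B(2) by linarith
qed

lemma weak_conv_to_unique_coupling:
  fixes P Q :: "'a::euclidean_space measure"
  assumes P: "borel_prob_measure P" "\<And>n. borel_prob_measure (Pn n)" "weak_conv_to Pn P"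
    and Q: "borel_prob_measure Q" "\<And>n. borel_prob_measure (Qn n)" "weak_conv_to Qn Q"
    and \<rho>: "\<And>n. \<rho> n \<in> couplings (Pn n) (Qn n)" "\<And>n. cyclically_monotone (spt (\<rho> n))"
    and unique: "{\<sigma> \<in> couplings P Q. cyclically_monotone (spt \<sigma>)} = {\<pi>}"
  shows "weak_conv_to \<rho> \<pi>"
proof (rule ccontr)
  assume "\<not> weak_conv_to \<rho> \<pi>"
  then obtain f :: "'a \<times> 'a \<Rightarrow> real" where f: "continuous_on UNIV f" "bounded (range f)"
    "\<not> (\<lambda>n. integral\<^sup>L (\<rho> n) f) \<longlonglongrightarrow> integral\<^sup>L \<pi> f"
    by (auto simp: weak_conv_to_def)
  then obtain e where e: "e > 0" "\<And>N. \<exists>n\<ge>N. e \<le> dist (integral\<^sup>L (\<rho> n) f) (integral\<^sup>L \<pi> f)"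
    unfolding lim_sequentially by (meson not_less)
  then have "infinite {n. e \<le> dist (integral\<^sup>L (\<rho> n) f) (integral\<^sup>L \<pi> f)}"
    unfolding infinite_nat_iff_unbounded_le by auto
  then obtain s where s: "strict_mono (s :: nat \<Rightarrow> nat)" "\<And>n. e \<le> dist (integral\<^sup>L (\<rho> (s n)) f) (integral\<^sup>L \<pi> f)"
    using infinite_enumerate by blast
  note b = couplingsD(1)[OF \<rho>(1)]
  obtain r N where r: "strict_mono (r :: nat \<Rightarrow> nat)" and N: "borel_prob_measure N" and conv: "weak_conv_to (\<lambda>n. \<rho> (s (r n))) N"
  proof (rule tight_imp_weakly_convergent_subsequence[of "\<lambda>n. \<rho> (s n)"])
    fix e :: real assume "0 < e"
    \<comment> \<open>Tightness of the couplings comes from the margins, each of which may lose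
      \<open>e / 2\<close>.\<close>
    then have e2: "0 < e / 2" by simp
    obtain R where R: "\<forall>\<^sub>F n in sequentially. 1 - e / 2 \<le> measure (Pn n) (cball 0 R)"
      using weak_conv_imp_tight[OF P(2,1,3) e2] by metis
    obtain S where S: "\<forall>\<^sub>F n in sequentially. 1 - e / 2 \<le> measure (Qn n) (cball 0 S)"
      using weak_conv_imp_tight[OF Q(2,1,3) e2] by metis
    have "\<forall>\<^sub>F n in sequentially. 1 - e \<le> measure (\<rho> n) (cball 0 (R + S))"
      using R S by eventually_elim (use coupling_measure_cball_ge[OF \<rho>(1), of "e / 2" _ R "e / 2" S] in auto)
    then have "\<forall>\<^sub>F n in sequentially. 1 - e \<le> measure (\<rho> (s n)) (cball 0 (R + S))"
      by (rule eventually_subseq[OF s(1)])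
    then show "\<exists>R. \<forall>\<^sub>F n in sequentially. 1 - e \<le> measure (\<rho> (s n)) (cball 0 R)" by blast
  qed (use b in auto)
  have sub: "weak_conv_to (\<lambda>n. X (s (r n))) Y" if "weak_conv_to X Y" for X and Y :: "'a measure"
    using that LIMSEQ_subseq_LIMSEQ[OF _ strict_mono_o[OF s(1) r]] unfolding weak_conv_to_def o_def by fast
  have "distr N borel fst = P"
    using sub[OF P(3)] by (intro weak_conv_to_margin[OF b N conv _ P(1)] continuous_intros) (simp add: couplingsD(2)[OF \<rho>(1)])
  moreover have "distr N borel snd = Q"
    using sub[OF Q(3)] by (intro weak_conv_to_margin[OF b N conv _ Q(1)] continuous_intros) (simp add: couplingsD(3)[OF \<rho>(1)])
  moreover have "cyclically_monotone (spt N)"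
    by (rule cyclically_monotone_spt_limit[OF b N conv \<rho>(2)])
  ultimately have "N \<in> {\<sigma> \<in> couplings P Q. cyclically_monotone (spt \<sigma>)}" using N by (simp add: couplings_def)
  then have "N = \<pi>" using unique by blast
  then have "(\<lambda>n. integral\<^sup>L (\<rho> (s (r n))) f) \<longlonglongrightarrow> integral\<^sup>L \<pi> f" using conv f(1,2) by (simp add: weak_conv_to_def)
  then have "\<forall>\<^sub>F n in sequentially. dist (integral\<^sup>L (\<rho> (s (r n))) f) (integral\<^sup>L \<pi> f) < e" using e(1) by (rule tendstoD)
  then show False using s(2) by (auto simp: eventually_sequentially not_less[symmetric])
qed

section \<open>Convergence of transport plans\<close>

theorem theorem1p1:
  fixes P Q :: "(real ^ 'd) measure"
    and Pn Qn :: "nat \<Rightarrow> (real ^ 'd) measure"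
    and \<pi> :: "((real ^ 'd) \<times> (real ^ 'd)) measure"
    and \<pi>n :: "nat \<Rightarrow> ((real ^ 'd) \<times> (real ^ 'd)) measure"
    and T :: "((real ^ 'd) \<times> (real ^ 'd)) set"
    and Tn :: "nat \<Rightarrow> ((real ^ 'd) \<times> (real ^ 'd)) set"
    and V :: "(real ^ 'd) set"
  assumes "borel_prob_measure P" and "borel_prob_measure Q"
    and "\<And>n. borel_prob_measure (Pn n)" and "\<And>n. borel_prob_measure (Qn n)"
    and "weak_conv_to Pn P" and "weak_conv_to Qn Q"
    and "\<And>n. \<pi>n n \<in> couplings (Pn n) (Qn n)" and "\<pi> \<in> couplings P Q"
    and "\<And>n. closed (Tn n)" and "\<And>n. maximal_cyclically_monotone (Tn n)"
    and "closed T" and "maximal_cyclically_monotone T"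
    and "\<And>n. spt (\<pi>n n) \<subseteq> Tn n" and "spt \<pi> \<subseteq> T"
    and "{\<rho> \<in> couplings P Q. cyclically_monotone (spt \<rho>)} = {\<pi>}"
    and "V = interior (spt P)" and "V \<noteq> {}"
  shows
   "(\<comment> \<open>(a)\<close>
      weak_conv_to \<pi>n \<pi> \<and>
      V \<subseteq> Domain T \<and>
      limitin (fell_topology (top_of_set (V \<times> UNIV)))
        (\<lambda>n. Tn n \<inter> (V \<times> UNIV)) (T \<inter> (V \<times> UNIV)) sequentially \<and>
      (\<forall>K. compact K \<and> K \<subseteq> V \<times> UNIV \<and> T \<inter> K = {} \<longrightarrow>
        (\<forall>\<^sub>F n in sequentially. Tn n \<inter> K = {})) \<and>
      (\<forall>G. open G \<and> G \<subseteq> V \<times> UNIV \<and> T \<inter> G \<noteq> {} \<longrightarrow>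
        (\<forall>\<^sub>F n in sequentially. Tn n \<inter> G \<noteq> {})))
    \<and>
    (\<comment> \<open>(b)\<close>
      (\<forall>K. compact K \<and> K \<subseteq> V \<longrightarrow>
        (\<forall>\<^sub>F n in sequentially. K \<subseteq> interior (Domain (Tn n)) \<and> compact (Tn n `` K)) \<and>
        ((\<forall>x\<in>frontier K. single_valued_at T x) \<longrightarrow>
          (\<lambda>n. hausdorff_edist (Tn n `` K) (T `` K)) \<longlonglongrightarrow> 0) \<and>
        ((\<forall>x\<in>K. single_valued_at T x) \<longrightarrow>
          (\<lambda>n. SUP x\<in>K. SUP y\<in>Tn n `` {x}. ennreal (norm (y - the_elem (T `` {x})))) \<longlonglongrightarrow> 0)) \<and>
      (\<forall>W. W \<in> sets borel \<and> W \<subseteq> V \<and> (\<forall>x\<in>W. single_valued_at T x) \<and> measure P W = 1 \<longrightarrow>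
        (AE x in P. (\<forall>\<^sub>F n in sequentially. Tn n `` {x} \<noteq> {}) \<and>
          (\<lambda>n. SUP y\<in>Tn n `` {x}. ennreal (norm (y - the_elem (T `` {x})))) \<longlonglongrightarrow> 0)))
    \<and>
    (bounded (Range T) \<and>
     (\<exists>U. open U \<and> U \<subseteq> spt P \<and> T `` U \<subseteq> interior (Range T) \<and> Range T \<subseteq> closure (T `` U)) \<and>
     (\<forall>\<^sub>F n in sequentially. Range (Tn n) \<subseteq> closure (Range T))
     \<longrightarrow>
      (\<comment> \<open>(c)\<close>
        Domain T = UNIV \<and>
        (\<forall>\<^sub>F n in sequentially. Domain (Tn n) = UNIV) \<and>
        limitin (fell_topology euclidean) Tn T sequentially)
      \<and>
      (\<comment> \<open>(d)\<close>
        convex (closure (Range T)) \<and>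
        (\<forall>E. (\<forall>x\<in>closure E. single_valued_at T x) \<and>
             (\<forall>u. recedes_in_direction E u \<longrightarrow>
               strictly_convex_in_direction (closure (Range T)) u) \<longrightarrow>
          (\<lambda>n. SUP x\<in>E. SUP y\<in>Tn n `` {x}. ennreal (norm (y - the_elem (T `` {x})))) \<longlonglongrightarrow> 0)))"
proof -
  note \<pi>n = assms(7) and \<pi> = assms(8)
  note Tn = assms(10) and Tn_closed = assms(9) and T = assms(12,11)
  have cyc: "cyclically_monotone T" "\<And>n. cyclically_monotone (Tn n)"
    using T(1) Tn by (auto simp: maximal_cyclically_monotone_def)

  \<comment> \<open>Weak convergence and approximation of the support\<close>
  have weak: "weak_conv_to \<pi>n \<pi>"
    using cyclically_monotone_subset[OF cyc(2) assms(13)]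
    by (intro weak_conv_to_unique_coupling[OF assms(1,3,5) assms(2,4,6) \<pi>n _ assms(15)])
  note ST = assms(14)
  have V: "open V" "V \<subseteq> closure (Domain (spt \<pi>))"
    using spt_subset_closure_Domain[OF \<pi>] interior_subset[of "spt P"] by (auto simp: assms(16))
  have S_approx: "\<forall>\<^sub>F n in sequentially. \<exists>q\<in>Tn n. dist q p < e" if "p \<in> spt \<pi>" "0 < e" for p e
    using spt_limit_approximation[OF couplingsD(1)[OF \<pi>n] couplingsD(1)[OF \<pi>] weak that]
    by eventually_elim (use assms(13) in blast)
  \<comment> \<open>Makes the uniform bounds applicable to the constant sequence \<open>T\<close>,
    that is, to \<open>T\<close> itself.\<close>
  have T_approx: "\<forall>\<^sub>F n :: nat in sequentially. \<exists>q\<in>T. dist q p < e" if "p \<in> spt \<pi>" "0 < e" for p e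
    using that ST by (intro always_eventually allI bexI[of _ p]) auto

  \<comment> \<open>Part (a): exclusion, local bounds and Fell convergence over
    \<open>V\<close>\<close>
  have miss: "\<forall>\<^sub>F n in sequentially. Tn n \<inter> K = {}" if "compact K" "K \<subseteq> V \<times> UNIV" "T \<inter> K = {}" for K
    by (rule eventually_miss_compact_domain[OF T ST V cyc(2) S_approx that])
  have bound: "\<exists>M. \<forall>\<^sub>F n in sequentially. K \<subseteq> interior (Domain (Tn n)) \<and> Tn n `` K \<subseteq> cball 0 M"
    if K: "compact K" "K \<subseteq> V" for K
  proof -
    obtain M where "\<forall>\<^sub>F n in sequentially. K \<subseteq> interior (Domain (Tn n)) \<and> Tn n `` K \<subseteq> cball 0 M"
      by (rule uniform_bound_compact[OF V Tn S_approx K])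
    then show ?thesis by (rule exI)
  qed
  have boundT: "K \<subseteq> interior (Domain T) \<and> bounded (T `` K)" if K: "compact K" "K \<subseteq> V" for K
  proof -
    obtain M where "\<forall>\<^sub>F n :: nat in sequentially. K \<subseteq> interior (Domain T) \<and> T `` K \<subseteq> cball 0 M"
      by (rule uniform_bound_compact[OF V T(1) T_approx K])
    then show ?thesis by (auto intro: bounded_subset[OF bounded_cball])
  qed
  have VD: "V \<subseteq> Domain T"
  proof
    fix x assume "x \<in> V"
    then have "{x} \<subseteq> interior (Domain T)" using boundT[of "{x}"] by simp
    then show "x \<in> Domain T" using interior_subset by blast
  qed
  have approx: "\<forall>\<^sub>F n in sequentially. \<exists>q\<in>Tn n. dist q p < e" if pT: "p \<in> T" and pV: "fst p \<in> V" and e: "0 < e" for p e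
  proof -
    have p: "(fst p, snd p) \<in> T" using pT by simp
    obtain r M where "0 < r" "\<forall>\<^sub>F n in sequentially. ball (fst p) r \<subseteq> Domain (Tn n) \<and> Tn n `` ball (fst p) r \<subseteq> cball 0 M"
      by (rule uniform_local_bound[OF V Tn S_approx pV])
    from approximation_from_upper_limit[OF cyc(1) p V(1) pV Tn miss this e]
    show ?thesis unfolding prod.collapse .
  qed
  have hit: "\<forall>\<^sub>F n in sequentially. Tn n \<inter> G \<noteq> {}" if G: "open G" "T \<inter> G \<noteq> {}"
    and near: "\<And>p e. p \<in> T \<inter> G \<Longrightarrow> 0 < e \<Longrightarrow> \<forall>\<^sub>F n in sequentially. \<exists>q\<in>Tn n. dist q p < e" for G
  proof -
    obtain p where p: "p \<in> T \<inter> G" using G by blast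
    then obtain e where e: "e > 0" "ball p e \<subseteq> G" using G(1) openE by blast
    from near[OF p e(1)] show ?thesis
    proof eventually_elim
      case (elim n)
      then obtain q where "q \<in> Tn n" "q \<in> ball p e" by (auto simp: dist_commute)
      then show ?case using e(2) by blast
    qed
  qed
  have hitV: "\<forall>\<^sub>F n in sequentially. Tn n \<inter> G \<noteq> {}" if "open G" "G \<subseteq> V \<times> UNIV" "T \<inter> G \<noteq> {}" for G
    using that by (intro hit approx) auto
  have fellV: "limitin (fell_topology (top_of_set (V \<times> UNIV)))
      (\<lambda>n. Tn n \<inter> (V \<times> UNIV)) (T \<inter> (V \<times> UNIV)) sequentially"
  proof (rule limitin_fell_topology)
    show "closedin (top_of_set (V \<times> UNIV)) (T \<inter> V \<times> UNIV)"
      "closedin (top_of_set (V \<times> UNIV)) (Tn n \<inter> V \<times> UNIV)" for n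
      using closedin_closed_Int[OF T(2), of "V \<times> UNIV"] closedin_closed_Int[OF Tn_closed, of "V \<times> UNIV" n]
      by (simp_all only: Int_commute)
    show "\<forall>\<^sub>F n in sequentially. Tn n \<inter> V \<times> UNIV \<inter> K = {}"
      if "compactin (top_of_set (V \<times> UNIV)) K" "T \<inter> V \<times> UNIV \<inter> K = {}" for K
    proof -
      have K: "compact K" "K \<subseteq> V \<times> UNIV" using that(1) by (auto simp: compactin_subtopology)
      then have "T \<inter> K = {}" using that(2) by blast
      from miss[OF K this] show ?thesis by eventually_elim blast
    qed
    show "\<forall>\<^sub>F n in sequentially. Tn n \<inter> V \<times> UNIV \<inter> G \<noteq> {}"
      if "openin (top_of_set (V \<times> UNIV)) G" "T \<inter> V \<times> UNIV \<inter> G \<noteq> {}" for G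
    proof -
      have "open (V \<times> (UNIV :: (real ^ 'd) set))" using V(1) by (intro open_Times open_UNIV)
      then have G: "open G" "G \<subseteq> V \<times> UNIV" using that(1) by (auto simp: openin_open_eq)
      then have "T \<inter> G \<noteq> {}" using that(2) by blast
      from hitV[OF G this] show ?thesis by eventually_elim (use G(2) in blast)
    qed
  qed

  \<comment> \<open>Part (b): images of compact sets and single-valued points\<close>
  have uniform: "\<forall>\<^sub>F n in sequentially. \<forall>x\<in>K. \<forall>y\<in>Tn n `` {x}. norm (y - the_elem (T `` {x})) < e"
    if K: "compact K" "K \<subseteq> V" and sv: "\<And>x. x \<in> K \<Longrightarrow> single_valued_at T x" and e: "0 < e" for K e
  proof -
    obtain M where "\<forall>\<^sub>F n in sequentially. K \<subseteq> interior (Domain (Tn n)) \<and> Tn n `` K \<subseteq> cball 0 M"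
      using bound[OF K] by blast
    then have "\<forall>\<^sub>F n in sequentially. Tn n `` K \<subseteq> cball 0 M" by eventually_elim blast
    then show ?thesis
      using boundT[OF K] by (intro uniform_convergence_on_compact[OF T(2) _ K sv miss _ e]) auto
  qed
  have nonempty: "\<forall>\<^sub>F n in sequentially. Tn n `` {x} \<noteq> {}" if xV: "x \<in> V" for x
  proof -
    obtain M where "\<forall>\<^sub>F n in sequentially. {x} \<subseteq> interior (Domain (Tn n)) \<and> Tn n `` {x} \<subseteq> cball 0 M"
      using bound[of "{x}"] xV by auto
    then show ?thesis
    proof eventually_elim
      case (elim n)
      then have "x \<in> Domain (Tn n)" using interior_subset by blast
      then show ?case by blast
    qed
  qed
  have b1: "\<forall>\<^sub>F n in sequentially. K \<subseteq> interior (Domain (Tn n)) \<and> compact (Tn n `` K)"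
    if K: "compact K" "K \<subseteq> V" for K
  proof -
    obtain M where "\<forall>\<^sub>F n in sequentially. K \<subseteq> interior (Domain (Tn n)) \<and> Tn n `` K \<subseteq> cball 0 M"
      using bound[OF K] by blast
    then show ?thesis
      by eventually_elim (use compact_Image[OF Tn_closed K(1)] bounded_subset[OF bounded_cball] in blast)
  qed
  have b2: "(\<lambda>n. hausdorff_edist (Tn n `` K) (T `` K)) \<longlonglongrightarrow> 0"
    if K: "compact K" "K \<subseteq> V" and sv: "\<And>x. x \<in> frontier K \<Longrightarrow> single_valued_at T x" for K
  proof -
    obtain M where "\<forall>\<^sub>F n in sequentially. K \<subseteq> interior (Domain (Tn n)) \<and> Tn n `` K \<subseteq> cball 0 M"
      using bound[OF K] by blast
    then have M: "\<forall>\<^sub>F n in sequentially. Tn n `` K \<subseteq> cball 0 M" by eventually_elim blast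
    \<comment> \<open>Over an interior point of \<open>K\<close> an open box keeps the approximating
      pairs over \<open>K\<close>. Over a frontier point they might leave \<open>K\<close>; there
      single-valuedness helps, since all values of \<open>Tn n\<close> at \<open>x\<close> itself
      converge to \<open>y\<close>.\<close>
    have lower: "\<forall>\<^sub>F n in sequentially. \<exists>w\<in>Tn n `` K. dist w y < e" if y: "y \<in> T `` K" and e: "0 < e" for y e
    proof -
      obtain x where x: "x \<in> K" "(x, y) \<in> T" using y by blast
      then have xV: "x \<in> V" using K(2) by blast
      show ?thesis
      proof (cases "x \<in> interior K")
        case True
        then have "(x, y) \<in> T \<inter> (interior K \<times> ball y e)" using x e by simp
        then have "\<forall>\<^sub>F n in sequentially. Tn n \<inter> (interior K \<times> ball y e) \<noteq> {}"
          using K(2) interior_subset[of K] by (intro hitV open_Times open_interior open_ball) blast+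
        then show ?thesis
        proof eventually_elim
          case (elim n)
          then obtain a w where "(a, w) \<in> Tn n" "a \<in> interior K" "w \<in> ball y e" by blast
          then show ?case using interior_subset[of K] by (intro bexI[of _ w]) (auto simp: dist_commute)
        qed
      next
        case False
        then have "x \<in> frontier K"
          using x(1) K(1) by (simp add: frontier_def compact_imp_closed closure_closed)
        then have svx: "single_valued_at T x" by (rule sv)
        have "\<forall>\<^sub>F n in sequentially. \<forall>x\<in>{x}. \<forall>w\<in>Tn n `` {x}. norm (w - the_elem (T `` {x})) < e"
          using xV svx by (intro uniform e) auto
        with nonempty[OF xV] show ?thesis
        proof eventually_elim
          case (elim n)
          then obtain w where w: "w \<in> Tn n `` {x}" by blast
          have "y = the_elem (T `` {x})" using x(2) single_valued_atD(2)[OF svx] by simp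
          then have "dist w y < e" using elim w by (simp add: dist_norm)
          then show ?case using w x(1) by blast
        qed
      qed
    qed
    show ?thesis
      using boundT[OF K] by (intro hausdorff_edist_tendsto_0[OF T(2) _ K miss M lower]) auto
  qed
  have b3: "AE x in P. (\<forall>\<^sub>F n in sequentially. Tn n `` {x} \<noteq> {}) \<and>
      (\<lambda>n. SUP y\<in>Tn n `` {x}. ennreal (norm (y - the_elem (T `` {x})))) \<longlonglongrightarrow> 0"
    if W: "W \<subseteq> V" "\<And>x. x \<in> W \<Longrightarrow> single_valued_at T x" "measure P W = 1" for W
  proof -
    interpret P: prob_space P using assms(1) by (rule borel_prob_measureD)
    have "(\<lambda>n. SUP y\<in>Tn n `` {x}. ennreal (norm (y - the_elem (T `` {x})))) \<longlonglongrightarrow> 0" if "x \<in> W" for x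
    proof -
      have "(\<lambda>n. SUP x\<in>{x}. SUP y\<in>Tn n `` {x}. ennreal (norm (y - the_elem (T `` {x})))) \<longlonglongrightarrow> 0"
        using that W by (intro SUP_norm_tendsto_0I uniform) auto
      then show ?thesis by simp
    qed
    moreover have "AE x in P. x \<in> W" using W(3) by (rule P.AE_prob_1)
    ultimately show ?thesis using nonempty W(1) by (auto elim!: eventually_mono)
  qed

  \<comment> \<open>Parts (c) and (d): bounded range and convergence on the whole space\<close>
  have cd: "(Domain T = UNIV \<and>
        (\<forall>\<^sub>F n in sequentially. Domain (Tn n) = UNIV) \<and>
        limitin (fell_topology euclidean) Tn T sequentially)
      \<and> convex (closure (Range T)) \<and>
        (\<forall>E. (\<forall>x\<in>closure E. single_valued_at T x) \<and>
             (\<forall>u. recedes_in_direction E u \<longrightarrow>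
               strictly_convex_in_direction (closure (Range T)) u) \<longrightarrow>
          (\<lambda>n. SUP x\<in>E. SUP y\<in>Tn n `` {x}. ennreal (norm (y - the_elem (T `` {x})))) \<longlonglongrightarrow> 0)"
    if bd: "bounded (Range T)" and U: "open U" "U \<subseteq> spt P" "T `` U \<subseteq> interior (Range T)" "Range T \<subseteq> closure (T `` U)"
      and RTn: "\<forall>\<^sub>F n in sequentially. Range (Tn n) \<subseteq> closure (Range T)" for U
  proof -
    have UV: "U \<subseteq> V" using U(1,2) unfolding assms(16) by (rule interior_maximal[rotated])
    \<comment> \<open>The reference set is now the part of \<open>T\<close> over \<open>U\<close>
      instead of the support: it is approximated because \<open>U\<close> lies in \<open>V\<close>,
      and its values are dense in the range of \<open>T\<close>.\<close>
    define S where "S = T \<inter> U \<times> UNIV"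
    have RS: "Range S = T `` U" by (auto simp: S_def)
    have ST: "S \<subseteq> T" by (simp add: S_def)
    have S_approx: "\<forall>\<^sub>F n in sequentially. \<exists>q\<in>Tn n. dist q p < e" if "p \<in> S" "0 < e" for p e
      using that UV by (intro approx) (auto simp: S_def)
    have int: "interior (Range T) \<noteq> {}"
    proof
      assume "interior (Range T) = {}"
      then have "Range T = {}" using U(3,4) by simp
      then show False using maximal_cyclically_monotone_nonempty[OF T(1)] by (simp add: Range_empty_iff)
    qed
    have "interior (Range T) \<subseteq> closure (Range S)" unfolding RS using U(4) interior_subset by blast
    note miss = eventually_miss_compact_range[OF T ST int this cyc(2) RTn S_approx]
    have bdc: "bounded (closure (Range T))" using bd by (rule bounded_closure)
    then obtain M where M: "closure (Range T) \<subseteq> cball 0 M" by (auto simp: bounded_iff subset_eq)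
    have DTn: "\<forall>\<^sub>F n in sequentially. Domain (Tn n) = UNIV"
      using RTn by eventually_elim (use bounded_Range_imp_Domain_UNIV[OF Tn] bounded_subset[OF bdc] in blast)
    have imM: "\<forall>\<^sub>F n in sequentially. Tn n `` A \<subseteq> cball 0 M" for A
      using RTn by eventually_elim (use M in blast)
    have approx: "\<forall>\<^sub>F n in sequentially. \<exists>q\<in>Tn n. dist q p < e" if pT: "p \<in> T" and e: "0 < e" for p e
    proof -
      have p: "(fst p, snd p) \<in> T" using pT by simp
      have "\<forall>\<^sub>F n in sequentially. ball (fst p) 1 \<subseteq> Domain (Tn n) \<and> Tn n `` ball (fst p) 1 \<subseteq> cball 0 M"
        using DTn imM[of "ball (fst p) 1"] by eventually_elim simp
      from approximation_from_upper_limit[OF cyc(1) p open_UNIV UNIV_I Tn miss zero_less_one this e]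
      show ?thesis unfolding prod.collapse .
    qed
    have fell: "limitin (fell_topology euclidean) Tn T sequentially"
    proof (rule limitin_fell_topology)
      show "\<forall>\<^sub>F n in sequentially. Tn n \<inter> G \<noteq> {}" if "openin euclidean G" "T \<inter> G \<noteq> {}" for G
        using that by (intro hit approx) auto
    qed (use T(2) Tn_closed miss in auto)
    \<comment> \<open>Convexity of the closed range is convexity of the closed domain of the
      inverse.\<close>
    have "convex (closure (Domain (T\<inverse>)))"
      using int by (intro convex_closure_Domain maximal_cyclically_monotone_converse T(1)) simp
    then have conv: "convex (closure (Range T))" by simp
    have "(\<lambda>n. SUP x\<in>E. SUP y\<in>Tn n `` {x}. ennreal (norm (y - the_elem (T `` {x})))) \<longlonglongrightarrow> 0"
      if E: "\<And>x. x \<in> closure E \<Longrightarrow> single_valued_at T x"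
        "\<And>u. recedes_in_direction E u \<Longrightarrow> strictly_convex_in_direction (closure (Range T)) u" for E
    proof (rule SUP_norm_tendsto_0I)
      fix e :: real assume e: "0 < e"
      have svE: "single_valued_at T x" if "x \<in> E" for x using E(1) that closure_subset by blast
      obtain R where R: "\<forall>\<^sub>F n in sequentially. \<forall>x\<in>E. R \<le> norm x \<longrightarrow>
          (\<forall>y\<in>Tn n `` {x}. norm (y - the_elem (T `` {x})) < e)"
        by (rule uniform_convergence_at_infinity[OF cyc(1) bd cyc(2) RTn approx svE E(2) e])
      \<comment> \<open>Beyond radius \<open>R\<close> the recession argument applies. Within it,
        uniform convergence needs a compact set on which \<open>T\<close> is single-valued, and the
        closure of \<open>E\<close> supplies it.\<close>
      have "compact (closure E \<inter> cball 0 R)" by (intro closed_Int_compact) auto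
      moreover have "bounded (T `` (closure E \<inter> cball 0 R))" using bd by (rule bounded_subset) blast
      ultimately have "\<forall>\<^sub>F n in sequentially. \<forall>x\<in>closure E \<inter> cball 0 R. \<forall>y\<in>Tn n `` {x}. norm (y - the_elem (T `` {x})) < e"
        by (intro uniform_convergence_on_compact[OF T(2) _ _ subset_UNIV _ miss imM e]) (use E(1) in blast)+
      with R show "\<forall>\<^sub>F n in sequentially. \<forall>x\<in>E. \<forall>y\<in>Tn n `` {x}. norm (y - the_elem (T `` {x})) < e"
      proof eventually_elim
        case (elim n)
        show ?case
        proof
          fix x assume x: "x \<in> E"
          show "\<forall>y\<in>Tn n `` {x}. norm (y - the_elem (T `` {x})) < e"
          proof (cases "R \<le> norm x")
            case False
            then have "x \<in> closure E \<inter> cball 0 R" using x closure_subset[of E] by auto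
            then show ?thesis using elim(2) by blast
          qed (use elim(1) x in blast)
        qed
      qed
    qed
    then show ?thesis using bounded_Range_imp_Domain_UNIV[OF T(1) bd] DTn fell conv by blast
  qed
  have a: "weak_conv_to \<pi>n \<pi> \<and>
      V \<subseteq> Domain T \<and>
      limitin (fell_topology (top_of_set (V \<times> UNIV)))
        (\<lambda>n. Tn n \<inter> (V \<times> UNIV)) (T \<inter> (V \<times> UNIV)) sequentially \<and>
      (\<forall>K. compact K \<and> K \<subseteq> V \<times> UNIV \<and> T \<inter> K = {} \<longrightarrow>
        (\<forall>\<^sub>F n in sequentially. Tn n \<inter> K = {})) \<and>
      (\<forall>G. open G \<and> G \<subseteq> V \<times> UNIV \<and> T \<inter> G \<noteq> {} \<longrightarrow>
        (\<forall>\<^sub>F n in sequentially. Tn n \<inter> G \<noteq> {}))"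
    by (intro conjI allI impI weak VD fellV; elim conjE; intro miss hitV; assumption)
  show ?thesis
  proof (rule conjI[OF a], rule conjI, rule conjI)
    show "\<forall>K. compact K \<and> K \<subseteq> V \<longrightarrow>
        (\<forall>\<^sub>F n in sequentially. K \<subseteq> interior (Domain (Tn n)) \<and> compact (Tn n `` K)) \<and>
        ((\<forall>x\<in>frontier K. single_valued_at T x) \<longrightarrow>
          (\<lambda>n. hausdorff_edist (Tn n `` K) (T `` K)) \<longlonglongrightarrow> 0) \<and>
        ((\<forall>x\<in>K. single_valued_at T x) \<longrightarrow>
          (\<lambda>n. SUP x\<in>K. SUP y\<in>Tn n `` {x}. ennreal (norm (y - the_elem (T `` {x})))) \<longlonglongrightarrow> 0)"
      using b1 b2 uniform by (auto intro!: SUP_norm_tendsto_0I)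
  qed (use b3 cd in blast)+
qed

end
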